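(* Let $F$ be a number field, $\mathfrak{a}$ a fractional ideal of $F$, and let $\Lambda$ be a rank two $\mathcal{O}_F$-lattice of covolume $N(\mathfrak{a})\cdot|\Delta_F|$ with underlying projective module $\mathcal{O}_F\oplus\mathfrak{a}$ and metric given by $g=(g_\sigma)_\sigma\in SL(2,\mathbb{R})^{r_1}\times SL(2,\mathbb{C})^{r_2}$. Let $\tau_\Lambda=g(\mathrm{ImJ})\in\mathcal{H}^{r_1}\times\mathbb{H}^{r_2}$ be the corresponding point. Then $\Lambda$ is semi-stable if and only if $d(\eta,\tau_\Lambda)\ge 1$ for all cusps $\eta\in\mathbb{P}^1(F)$.
   Context: $F$ has ring of integers $\mathcal{O}_F$, discriminant $\Delta_F$, $r_1$ real and $r_2$ complex places; $N$ of a fractional ideal is its absolute norm. Lattices: the lattice $\Lambda$ attached to $g$ is the set of row vectors $(x,y)\in\mathcal{O}_F\oplus\mathfrak{a}\subset F^2$ embedded in $(\mathbb{R}^2)^{r_1}\times(\mathbb{C}^2)^{r_2}$, with norm at each archimedean place $\sigma$ given by $\|(x,y)\|_\sigma=\|(x_\sigma,y_\sigma)g_\sigma\|$ (standard Euclidean/Hermitian norm on the right). Covolumes of $\mathcal{O}_F$-lattices are taken with respect to the Euclidean structure $\sum_{\sigma\text{ real}}\langle\cdot,\cdot\rangle_\sigma+2\,\mathrm{Re}\sum_{\tau\text{ complex}}\langle\cdot,\cdot\rangle_\tau$, so that $\mathcal{O}_F$ has covolume $|\Delta_F|^{1/2}$. $\Lambda$ is semi-stable if $\mathrm{Vol}(\Lambda_1)^{\mathrm{rank}(\Lambda)}\ge\mathrm{Vol}(\Lambda)^{\mathrm{rank}(\Lambda_1)}$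 for all non-zero sub-$\mathcal{O}_F$-lattices $\Lambda_1\subset\Lambda$ (with the induced metrics). Upper half spaces: $\mathcal{H}=\{z=x+iy:y>0\}$ with $SL(2,\mathbb{R})$ acting by fractional linear transformations. $\mathbb{H}=\{P=z+rj: z\in\mathbb{C},r>0\}$, viewed inside Hamilton's quaternions, with $SL(2,\mathbb{C})$ acting by $\begin{pmatrix}a&b\\c&d\end{pmatrix}P=(aP+b)(cP+d)^{-1}$. Put $\Im(z)=y$, $J(P)=r$, and let $\|\cdot\|$ be the quaternion norm, $\|z+rj\|^2=|z|^2+r^2$ for $z\in\mathbb{C}$, $r>0$ (and in general $\|u+vj\|^2=|u|^2+|v|^2$ for $u,v\in\mathbb{C}$). $\mathrm{ImJ}:=(i,\dots,i;j,\dots,j)$ is the base point. Distance to cusps: write a cusp as $\eta=\left[\begin{smallmatrix}\alpha\\ \beta\end{smallmatrix}\right]\in\mathbb{P}^1(F)$, $\alpha,\beta\in F$ not both zero, and put $\mathfrak{b}:=\mathcal{O}_F\alpha+\mathfrak{a}\beta$. For $\tau=(z_1,\dots,z_{r_1};P_1,\dots,P_{r_2})$ the reciprocal distance is $$\mu(\eta,\tau):=\frac{1}{N(\mathfrak{a}\mathfrak{b}^{-2})}\cdot\frac{\prod_{i=1}^{r_1}\Im(z_i)\cdot\prod_{k=1}^{r_2}J(P_k)^2}{\prod_{i=1}^{r_1}|-\beta^{(i)}z_i+\alpha^{(i)}|^2\cdot\prod_{k=1}^{r_2}\|-\beta^{(k)}P_k+\alpha^{(k)}\|^4},$$ where $\alpha^{(\cdot)},\beta^{(\cdot)}$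 are the images under the corresponding embeddings; it is independent of the choice of $(\alpha,\beta)$. The distance of $\tau$ to $\eta$ is $d(\eta,\tau):=1/\mu(\eta,\tau)$. *)

theory Defs
  imports
    "Jordan_Normal_Form.Determinant"
    "HOL-Computational_Algebra.Computational_Algebra"
    "HOL-Analysis.Analysis"
begin

no_notation vec_index (infixl "$" 100)

section \<open>Number fields\<close>

text \<open>A number field is a type of characteristic zero that is finite-dimensional over
  \<open>\<rat>\<close>.\<close>

definition number_field :: "'f::field_char_0 itself \<Rightarrow> bool" where
  "number_field _ \<longleftrightarrow>
     (\<exists>B :: 'f set. finite B \<and> module.span (\<lambda>q x. of_rat q * x) B = UNIV)"

definition ring_of_integers :: "'f::field_char_0 set" ("\<O>") where
  "\<O> = {x. algebraic_int x}"

definition real_places :: "('f::field_char_0 \<Rightarrow> real) set" where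
  "real_places = {\<sigma>. field_hom \<sigma>}"

definition nonreal_embeddings :: "('f::field_char_0 \<Rightarrow> complex) set" where
  "nonreal_embeddings = {\<sigma>. field_hom \<sigma> \<and> \<not> range \<sigma> \<subseteq> \<real>}"

text \<open>A complex place is a pair of conjugate non-real embeddings. As usual one embedding is
  chosen from each pair; \<open>\<Phi>\<close> is the set of chosen embeddings.\<close>

definition complex_places :: "('f::field_char_0 \<Rightarrow> complex) set \<Rightarrow> bool" where
  "complex_places \<Phi> \<longleftrightarrow>
     \<Phi> \<subseteq> nonreal_embeddings \<and>
     (\<forall>\<sigma>\<in>nonreal_embeddings. \<sigma> \<in> \<Phi> \<longleftrightarrow> cnj \<circ> \<sigma> \<notin> \<Phi>)"

text \<open>\<open>s\<close> is the multiplication of integers on the additive group.\<close>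

definition int_basis :: "(int \<Rightarrow> 'v \<Rightarrow> 'v) \<Rightarrow> 'v::ab_group_add set \<Rightarrow> 'v list \<Rightarrow> bool" where
  "int_basis s L bs \<longleftrightarrow>
     distinct bs \<and> \<not> module.dependent s (set bs) \<and> module.span s (set bs) = L"

text \<open>\<open>det (\<sigma>\<^sub>i(b\<^sub>j))\<^sup>2\<close> for an integral basis \<open>b\<close> and the embeddings \<open>\<sigma>\<^sub>i\<close> into \<open>\<complex>\<close>; it does
  not depend on the choices. It is a rational integer, kept here as a complex number.\<close>

definition discriminant :: "'f::field_char_0 itself \<Rightarrow> complex" where
  "discriminant _ =
     (let bs = (SOME bs. int_basis (\<lambda>n x. of_int n * x) (\<O> :: 'f set) bs);
          \<sigma>s = (SOME \<sigma>s. distinct \<sigma>s \<and> set \<sigma>s = {\<sigma> :: 'f \<Rightarrow> complex. field_hom \<sigma>})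
      in (Determinant.det
            (Matrix.mat (length \<sigma>s) (length bs) (\<lambda>(i, j). (\<sigma>s ! i) (bs ! j))))\<^sup>2)"


section \<open>Fractional ideals\<close>

definition OF_submodule :: "('f::field_char_0 \<Rightarrow> 'v \<Rightarrow> 'v) \<Rightarrow> 'v::ab_group_add set \<Rightarrow> bool" where
  "OF_submodule s M \<longleftrightarrow>
     0 \<in> M \<and> (\<forall>v\<in>M. \<forall>w\<in>M. v + w \<in> M) \<and> (\<forall>c\<in>\<O>. \<forall>v\<in>M. s c v \<in> M)"

definition fractional_ideal :: "'f::field_char_0 set \<Rightarrow> bool" where
  "fractional_ideal I \<longleftrightarrow>
     OF_submodule (*) I \<and> I \<noteq> {0} \<and> (\<exists>d\<in>\<O>. d \<noteq> 0 \<and> (\<forall>x\<in>I. d * x \<in> \<O>))"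

definition ideal_mult :: "'f::field_char_0 set \<Rightarrow> 'f set \<Rightarrow> 'f set" where
  "ideal_mult I J = module.span (\<lambda>(n::int) x. of_int n * x) {x * y | x y. x \<in> I \<and> y \<in> J}"

definition ideal_inverse :: "'f::field_char_0 set \<Rightarrow> 'f set" where
  "ideal_inverse I = {x. \<forall>y\<in>I. x * y \<in> \<O>}"

definition ideal_index :: "'f::field_char_0 set \<Rightarrow> nat" where
  "ideal_index I = card ((\<O> :: 'f set) // {(x, y). x \<in> \<O> \<and> y \<in> \<O> \<and> x - y \<in> I})"

text \<open>The multiplicative extension of \<open>[\<O> : I]\<close> to fractional ideals: if \<open>dI \<subseteq> \<O>\<close> then
  \<open>N(I) = [\<O> : dI] / [\<O> : d\<O>]\<close>, independently of \<open>d\<close>.\<close>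

definition ideal_norm :: "'f::field_char_0 set \<Rightarrow> real" where
  "ideal_norm I =
     (let d = (SOME d. d \<in> \<O> \<and> d \<noteq> 0 \<and> (*) d ` I \<subseteq> \<O>)
      in real (ideal_index ((*) d ` I)) / real (ideal_index ((*) d ` \<O>)))"


section \<open>Lattices\<close>

definition SL2 :: "('k::field ^ 2 ^ 2) set" where
  "SL2 = {A. Determinants.det A = 1}"

definition std_module :: "'f::field_char_0 set \<Rightarrow> ('f ^ 2) set" where
  "std_module \<aa> = {v. v $ 1 \<in> \<O> \<and> v $ 2 \<in> \<aa>}"

definition local_vector :: "('f \<Rightarrow> 'k::field) \<Rightarrow> 'k ^ 2 ^ 2 \<Rightarrow> 'f ^ 2 \<Rightarrow> 'k ^ 2" where
  "local_vector \<sigma> A v = (\<chi> i. \<sigma> (v $ i)) v* A"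

definition hermitian :: "complex ^ 2 \<Rightarrow> complex ^ 2 \<Rightarrow> complex" where
  "hermitian x y = (\<Sum>i\<in>UNIV. x $ i * cnj (y $ i))"

definition lattice_inner ::
  "('f::field_char_0 \<Rightarrow> complex) set \<Rightarrow> (('f \<Rightarrow> real) \<Rightarrow> real ^ 2 ^ 2) \<Rightarrow>
   (('f \<Rightarrow> complex) \<Rightarrow> complex ^ 2 ^ 2) \<Rightarrow> 'f ^ 2 \<Rightarrow> 'f ^ 2 \<Rightarrow> real" where
  "lattice_inner \<Phi> g\<^sub>R g\<^sub>C v w =
     (\<Sum>\<sigma>\<in>real_places. inner (local_vector \<sigma> (g\<^sub>R \<sigma>) v) (local_vector \<sigma> (g\<^sub>R \<sigma>) w)) +
     2 * Re (\<Sum>\<sigma>\<in>\<Phi>. hermitian (local_vector \<sigma> (g\<^sub>C \<sigma>) v) (local_vector \<sigma> (g\<^sub>C \<sigma>) w))"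

text \<open>The covolume of a lattice in its real span, as the square root of the Gram
  determinant of a \<open>\<int>\<close>-basis (independent of the basis). The lattice need not have full rank.\<close>

definition covolume :: "('f::field_char_0 ^ 2 \<Rightarrow> 'f ^ 2 \<Rightarrow> real) \<Rightarrow> ('f ^ 2) set \<Rightarrow> real" where
  "covolume ip L =
     (let bs = (SOME bs. int_basis (\<lambda>n v. of_int n *s v) L bs); n = length bs
      in sqrt (Determinant.det (Matrix.mat n n (\<lambda>(i, j). ip (bs ! i) (bs ! j)))))"

text \<open>The rank of an \<open>\<O>\<close>-lattice in \<open>F\<^sup>2\<close> is the dimension of its \<open>F\<close>-span, which is what
  \<open>vec.dim\<close> returns for an arbitrary subset.\<close>

definition semistable :: "('f::field_char_0 ^ 2 \<Rightarrow> 'f ^ 2 \<Rightarrow> real) \<Rightarrow> ('f ^ 2) set \<Rightarrow> bool" where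
  "semistable ip L \<longleftrightarrow>
     (\<forall>L\<^sub>1. OF_submodule (*s) L\<^sub>1 \<and> L\<^sub>1 \<subseteq> L \<and> L\<^sub>1 \<noteq> {0} \<longrightarrow>
        covolume ip L\<^sub>1 ^ vec.dim L \<ge> covolume ip L ^ vec.dim L\<^sub>1)"


section \<open>Upper half spaces\<close>

text \<open>\<open>Quat u v\<close> is Hamilton's quaternion \<open>u + vj\<close>, where \<open>j\<^sup>2 = -1\<close> and \<open>ju = cnj u \<cdot> j\<close>.\<close>

datatype quat = Quat (quat_u: complex) (quat_v: complex)

definition quat_norm :: "quat \<Rightarrow> real" where
  "quat_norm q = sqrt ((cmod (quat_u q))\<^sup>2 + (cmod (quat_v q))\<^sup>2)"

instantiation quat :: division_ring
begin

definition "0 = Quat 0 0"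
definition "1 = Quat 1 0"
definition "p + q = Quat (quat_u p + quat_u q) (quat_v p + quat_v q)"
definition "p - q = Quat (quat_u p - quat_u q) (quat_v p - quat_v q)"
definition "- q = Quat (- quat_u q) (- quat_v q)"
definition "p * q = Quat (quat_u p * quat_u q - quat_v p * cnj (quat_v q))
                         (quat_u p * quat_v q + quat_v p * cnj (quat_u q))"
definition "inverse q = Quat (cnj (quat_u q) / of_real ((quat_norm q)\<^sup>2))
                             (- quat_v q / of_real ((quat_norm q)\<^sup>2))"
definition "p div q = p * inverse (q :: quat)"

lemma of_real_quat_norm_sq:
  "complex_of_real ((quat_norm q)\<^sup>2) = quat_u q * cnj (quat_u q) + quat_v q * cnj (quat_v q)"
proof -
  have "(quat_norm q)\<^sup>2 = (cmod (quat_u q))\<^sup>2 + (cmod (quat_v q))\<^sup>2"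
    by (simp add: quat_norm_def)
  thus ?thesis by (simp only: of_real_add complex_norm_square[symmetric])
qed

lemma quat_norm_sq_eq_0: "(quat_norm q)\<^sup>2 = 0 \<longleftrightarrow> q = 0"
  by (cases q) (auto simp: quat_norm_def zero_quat_def add_nonneg_eq_0_iff)

instance
proof
  fix q :: quat
  assume q: "q \<noteq> 0"
  define N where "N = complex_of_real ((quat_norm q)\<^sup>2)"
  have N0: "N \<noteq> 0" using q quat_norm_sq_eq_0[of q] by (simp add: N_def)
  have N: "quat_u q * cnj (quat_u q) + quat_v q * cnj (quat_v q) = N"
    by (simp only: N_def of_real_quat_norm_sq)
  have cN: "cnj N = N" by (simp add: N_def)
  have N': "cnj (quat_u q) * quat_u q / N + quat_v q * cnj (quat_v q) / N = 1"
    using N N0 by (simp add: add_divide_distrib[symmetric] mult.commute)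
  show "inverse q * q = 1"
    using N' by (simp add: times_quat_def inverse_quat_def one_quat_def N_def[symmetric, unfolded of_real_power])
  show "q * inverse q = 1"
    using N' cN by (simp add: times_quat_def inverse_quat_def one_quat_def N_def[symmetric, unfolded of_real_power] mult.commute)
qed (auto simp: zero_quat_def one_quat_def plus_quat_def minus_quat_def uminus_quat_def
      times_quat_def inverse_quat_def divide_quat_def quat.expand algebra_simps)

end

definition upper_half_plane :: "complex set" where
  "upper_half_plane = {z. Im z > 0}"

definition upper_half_space :: "quat set" where
  "upper_half_space = {Quat z (of_real r) | z r. r > 0}"

definition height :: "quat \<Rightarrow> real" where
  "height P = Re (quat_v P)"

definition act2 :: "real ^ 2 ^ 2 \<Rightarrow> complex \<Rightarrow> complex" where
  "act2 A z = (of_real (A $ 1 $ 1) * z + of_real (A $ 1 $ 2)) /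
              (of_real (A $ 2 $ 1) * z + of_real (A $ 2 $ 2))"

definition act3 :: "complex ^ 2 ^ 2 \<Rightarrow> quat \<Rightarrow> quat" where
  "act3 A P = (Quat (A $ 1 $ 1) 0 * P + Quat (A $ 1 $ 2) 0) *
              inverse (Quat (A $ 2 $ 1) 0 * P + Quat (A $ 2 $ 2) 0)"

text \<open>A point of the product of upper half spaces is a family of points indexed by the real
  places together with one indexed by the complex places.\<close>

type_synonym 'f point = "(('f \<Rightarrow> real) \<Rightarrow> complex) \<times> (('f \<Rightarrow> complex) \<Rightarrow> quat)"

definition ImJ :: "'f point" where
  "ImJ = ((\<lambda>_. \<i>), (\<lambda>_. Quat 0 1))"

definition act ::
  "(('f \<Rightarrow> real) \<Rightarrow> real ^ 2 ^ 2) \<Rightarrow> (('f \<Rightarrow> complex) \<Rightarrow> complex ^ 2 ^ 2) \<Rightarrow> 'f point \<Rightarrow> 'f point" where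
  "act g\<^sub>R g\<^sub>C \<tau> = ((\<lambda>\<sigma>. act2 (g\<^sub>R \<sigma>) (fst \<tau> \<sigma>)), (\<lambda>\<sigma>. act3 (g\<^sub>C \<sigma>) (snd \<tau> \<sigma>)))"

lemma act2_i_in_upper_half_plane:
  assumes "A \<in> SL2"
  shows "act2 A \<i> \<in> upper_half_plane"
proof -
  have d: "A $ 1 $ 1 * A $ 2 $ 2 - A $ 1 $ 2 * A $ 2 $ 1 = 1"
    using assms by (simp add: SL2_def det_2)
  hence "(A $ 2 $ 2)\<^sup>2 + (A $ 2 $ 1)\<^sup>2 > 0"
    by (metis diff_0 mult_zero_right neg_equal_0_iff_equal sum_power2_gt_zero_iff zero_neq_one)
  with d show ?thesis
    by (simp add: upper_half_plane_def act2_def Im_divide algebra_simps)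
qed

lemma act3_j_in_upper_half_space:
  assumes "A \<in> SL2"
  shows "act3 A (Quat 0 1) \<in> upper_half_space"
proof -
  have d: "A $ 1 $ 1 * A $ 2 $ 2 - A $ 1 $ 2 * A $ 2 $ 1 = 1"
    using assms by (simp add: SL2_def det_2)
  define q where "q = Quat (A $ 2 $ 2) (A $ 2 $ 1)"
  have "q \<noteq> 0" using d by (auto simp: q_def zero_quat_def)
  hence "(quat_norm q)\<^sup>2 > 0"
    using quat_norm_sq_eq_0[of q] by simp
  moreover have "\<exists>z. act3 A (Quat 0 1) = Quat z (of_real (1 / (quat_norm q)\<^sup>2))"
  proof -
    have "quat_v (act3 A (Quat 0 1)) =
        (A $ 1 $ 1 * A $ 2 $ 2 - A $ 1 $ 2 * A $ 2 $ 1) / of_real ((quat_norm q)\<^sup>2)"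
      by (simp add: act3_def times_quat_def plus_quat_def inverse_quat_def q_def diff_divide_distrib)
    thus ?thesis unfolding d by (metis of_real_1 of_real_divide quat.collapse)
  qed
  ultimately show ?thesis
    unfolding upper_half_space_def by (metis (mono_tags, lifting) mem_Collect_eq zero_less_divide_1_iff)
qed


section \<open>Distance to cusps\<close>

text \<open>The cusps: points of the projective line, i.e. non-zero vectors \<open>(\<alpha>, \<beta>)\<close> up to scaling.\<close>

definition cusps :: "('f::field_char_0 ^ 2) set set" where
  "cusps = (UNIV - {0}) // {(v, w). v \<noteq> 0 \<and> w \<noteq> 0 \<and> (\<exists>c. c \<noteq> 0 \<and> w = c *s v)}"

definition recip_dist_coords ::
  "('f::field_char_0 \<Rightarrow> complex) set \<Rightarrow> 'f set \<Rightarrow> 'f \<Rightarrow> 'f \<Rightarrow> 'f point \<Rightarrow> real" where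
  "recip_dist_coords \<Phi> \<aa> \<alpha> \<beta> \<tau> =
     (let \<bb> = {x * \<alpha> + y * \<beta> | x y. x \<in> \<O> \<and> y \<in> \<aa>} in
      1 / ideal_norm (ideal_mult \<aa> (ideal_mult (ideal_inverse \<bb>) (ideal_inverse \<bb>))) *
      (((\<Prod>\<sigma>\<in>real_places. Im (fst \<tau> \<sigma>)) * (\<Prod>\<sigma>\<in>\<Phi>. (height (snd \<tau> \<sigma>))\<^sup>2)) /
       ((\<Prod>\<sigma>\<in>real_places. (cmod (- of_real (\<sigma> \<beta>) * fst \<tau> \<sigma> + of_real (\<sigma> \<alpha>)))\<^sup>2) *
        (\<Prod>\<sigma>\<in>\<Phi>. quat_norm (- Quat (\<sigma> \<beta>) 0 * snd \<tau> \<sigma> + Quat (\<sigma> \<alpha>) 0) ^ 4))))"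

text \<open>The value does not depend on the representative \<open>(\<alpha>, \<beta>)\<close> of the cusp.\<close>

definition recip_dist ::
  "('f::field_char_0 \<Rightarrow> complex) set \<Rightarrow> 'f set \<Rightarrow> ('f ^ 2) set \<Rightarrow> 'f point \<Rightarrow> real" where
  "recip_dist \<Phi> \<aa> \<eta> \<tau> =
     (let v = (SOME v. v \<in> \<eta>) in recip_dist_coords \<Phi> \<aa> (v $ 1) (v $ 2) \<tau>)"

definition cusp_dist ::
  "('f::field_char_0 \<Rightarrow> complex) set \<Rightarrow> 'f set \<Rightarrow> ('f ^ 2) set \<Rightarrow> 'f point \<Rightarrow> real" where
  "cusp_dist \<Phi> \<aa> \<eta> \<tau> = 1 / recip_dist \<Phi> \<aa> \<eta> \<tau>"

end

theory Submission
  imports Defs "Jordan_Normal_Form.Char_Poly" "HOL-Library.Function_Algebras"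
    "HOL-Computational_Algebra.Field_as_Ring"
begin

no_notation vec_index (infixl "$" 100)
no_notation fps_nth (infixl "$" 75)

text \<open>A sublattice of full rank has at least the covolume of \<open>\<Lambda>\<close>, so only sublattices of rank one matter,
  and among those on a fixed line the largest is the intersection of \<open>\<Lambda>\<close> with the line. On the line
  through \<open>w = (-\<beta>, \<alpha>)\<close> this intersection is \<open>\<aa>\<bb>\<^sup>-\<^sup>1 w\<close>. Since \<open>\<langle>cw, dw\<rangle>\<close> is the sum over all embeddings of
  \<open>\<sigma>(c)\<close> times the conjugate of \<open>\<sigma>(d)\<close> times \<open>\<parallel>w\<parallel>\<^sup>2\<close> at \<open>\<sigma>\<close>, its squared covolume is \<open>N(\<aa>\<bb>\<^sup>-\<^sup>1)\<^sup>2 |\<Delta>|\<close> times the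
  product of the local norms of \<open>w\<close>, and each local norm is the corresponding factor
  \<open>|-\<beta>z + \<alpha>|\<^sup>2 / \<Im>(z)\<close> or \<open>\<parallel>-\<beta>P + \<alpha>\<parallel>\<^sup>4 / J(P)\<^sup>2\<close> of the distance. By multiplicativity of the ideal norm
  the quotient by \<open>Vol(\<Lambda>) = N(\<aa>) |\<Delta>|\<close> is the distance to the cusp.\<close>

section \<open>Finitely generated subgroups of a rational vector space\<close>

text \<open>The squares come from the ranks: with rank 2 for \<Lambda> and rank 1 for a line L,
  semi-stability along L reads Vol(L)^2 \<ge> Vol(\<Lambda>). The direction (-\<beta>, \<alpha>)
  comes from the action on row vectors: for g with rows (p, q) and (r, s), the number x g(i) + y
  equals ((p x + r y) i + (q x + s y)) / (r i + s), and the imaginary part of g(i) is 1 / |r i +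
  s|^2. A multiple k (-\<beta>, \<alpha>) lies in \<O> + \<aa> exactly when k\<bb> is contained in
  \<aa>; identifying these k with \<aa>\<bb>^-1 needs \<bb> to be invertible. Hence most of the
  proof is the arithmetic of \<O>: an integral basis, as many embeddings as the degree, invertible
  fractional ideals, a multiplicative norm. One quantity ties these to lattices:
  \<open>ideal_vol\<close>, the absolute determinant of the embeddings on a Z-basis. Its ratio to
  the value at \<O> is the ideal norm, its square at \<O> is |\<Delta>|, and it is the arithmetic
  factor in the covolume of a line.\<close>

locale rat_space = vector_space scale
  for scale :: "rat \<Rightarrow> 'v::ab_group_add \<Rightarrow> 'v" +
  fixes zs :: "int \<Rightarrow> 'v \<Rightarrow> 'v"
  assumes zs_eq: "zs n x = scale (of_int n) x"
begin

sublocale Z: Modules.module zs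
  by unfold_locales (simp_all add: zs_eq scale_right_distrib scale_left_distrib)

section \<open>Integer coordinates with respect to a list of vectors\<close>

definition zcomb :: "(nat \<Rightarrow> int) \<Rightarrow> 'v list \<Rightarrow> 'v" where
  "zcomb c bs = (\<Sum>i<length bs. zs (c i) (bs ! i))"

text \<open>Coefficients are indexed by positions, so a repeated entry already counts as a relation,
  and the coordinates of a second list form an integer matrix with one column per vector.\<close>

definition zindep :: "'v list \<Rightarrow> bool" where
  "zindep bs \<longleftrightarrow> (\<forall>c. zcomb c bs = 0 \<longrightarrow> (\<forall>i<length bs. c i = 0))"

definition zbasis :: "'v set \<Rightarrow> 'v list \<Rightarrow> bool" where
  "zbasis L bs \<longleftrightarrow> zindep bs \<and> L = range (\<lambda>c. zcomb c bs)"

lemma zcomb_Nil [simp]: "zcomb c [] = 0"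
  by (simp add: zcomb_def)

lemma zcomb_Cons: "zcomb c (b # bs) = zs (c 0) b + zcomb (\<lambda>i. c (Suc i)) bs"
  by (simp add: zcomb_def sum.lessThan_Suc_shift del: sum.lessThan_Suc)

lemma zcomb_add: "zcomb c bs + zcomb d bs = zcomb (\<lambda>i. c i + d i) bs"
  by (simp add: zcomb_def Z.scale_left_distrib sum.distrib)

lemma zcomb_diff: "zcomb c bs - zcomb d bs = zcomb (\<lambda>i. c i - d i) bs"
  by (simp add: zcomb_def Z.scale_left_diff_distrib sum_subtractf)

lemma zcomb_scale: "zs k (zcomb c bs) = zcomb (\<lambda>i. k * c i) bs"
  by (simp add: zcomb_def Z.scale_sum_right)

lemma zcomb_0 [simp]: "zcomb (\<lambda>i. 0) bs = 0"
  by (simp add: zcomb_def)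

lemma zcomb_sum: "(\<Sum>j\<in>J. zs (d j) (zcomb (C j) bs)) = zcomb (\<lambda>i. \<Sum>j\<in>J. d j * C j i) bs"
  by (simp add: zcomb_def Z.scale_sum_right Z.scale_sum_left sum.swap[of _ J])

lemma zcomb_cong: "(\<And>i. i < length bs \<Longrightarrow> c i = d i) \<Longrightarrow> zcomb c bs = zcomb d bs"
  by (simp add: zcomb_def)

lemma zcomb_unit: "j < length bs \<Longrightarrow> zcomb (\<lambda>i. if i = j then 1 else 0) bs = bs ! j"
proof -
  assume j: "j < length bs"
  have "zcomb (\<lambda>i. if i = j then 1 else 0) bs = (\<Sum>i<length bs. if i = j then bs ! j else 0)"
    unfolding zcomb_def by (intro sum.cong) auto
  thus ?thesis using j by simp
qed

lemma zindepD: "zindep bs \<Longrightarrow> zcomb c bs = zcomb d bs \<Longrightarrow> i < length bs \<Longrightarrow> c i = d i"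
proof -
  assume a: "zindep bs" "zcomb c bs = zcomb d bs" "i < length bs"
  hence "zcomb (\<lambda>i. c i - d i) bs = 0" using zcomb_diff[of c bs d] by simp
  with a have "c i - d i = 0" unfolding zindep_def by blast
  thus ?thesis by simp
qed

lemma zcomb_in_subspace: "Z.subspace L \<Longrightarrow> set bs \<subseteq> L \<Longrightarrow> zcomb c bs \<in> L"
  unfolding zcomb_def by (intro Z.subspace_sum Z.subspace_scale) (auto simp: subset_iff)

lemma subspace_range_zcomb: "Z.subspace (range (\<lambda>c. zcomb c bs))"
proof (intro Z.subspaceI)
  show "0 \<in> range (\<lambda>c. zcomb c bs)" using zcomb_0[of bs] by (metis rangeI)
qed (auto simp: zcomb_add zcomb_scale)

lemma zindep_distinct:
  assumes "zindep bs"
  shows "distinct bs"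
proof (rule ccontr)
  assume "\<not> distinct bs"
  then obtain i j where ij: "i < length bs" "j < length bs" "i \<noteq> j" "bs ! i = bs ! j"
    by (auto simp: distinct_conv_nth)
  have "zcomb (\<lambda>k. if k = i then 1 else 0) bs = zcomb (\<lambda>k. if k = j then 1 else 0) bs"
    using ij by (simp only: zcomb_unit)
  from zindepD[OF assms this ij(1)] ij(3) show False by simp
qed

lemma zspan_eq_range: "Z.span (set bs) = range (\<lambda>c. zcomb c bs)"
proof
  have "set bs \<subseteq> range (\<lambda>c. zcomb c bs)"
    by (auto simp: in_set_conv_nth) (metis rangeI zcomb_unit)
  thus "Z.span (set bs) \<subseteq> range (\<lambda>c. zcomb c bs)"
    by (intro Z.span_minimal subspace_range_zcomb)
  show "range (\<lambda>c. zcomb c bs) \<subseteq> Z.span (set bs)"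
    by (auto intro!: zcomb_in_subspace Z.span_superset)
qed

lemma zindep_iff: "zindep bs \<longleftrightarrow> distinct bs \<and> \<not> Z.dependent (set bs)"
proof
  assume z: "zindep bs"
  have d: "distinct bs" using z by (rule zindep_distinct)
  have "\<not> Z.dependent (set bs)"
  proof
    assume "Z.dependent (set bs)"
    then obtain u where u: "\<exists>v\<in>set bs. u v \<noteq> 0" "(\<Sum>v\<in>set bs. zs (u v) v) = 0"
      by (auto simp: Z.dependent_finite)
    have "(\<Sum>v\<in>set bs. zs (u v) v) = zcomb (\<lambda>i. u (bs ! i)) bs"
      unfolding zcomb_def using sum.reindex_bij_betw[OF bij_betw_nth[OF d refl refl], of "\<lambda>v. zs (u v) v"] by simp
    with u z show False unfolding zindep_def by (metis in_set_conv_nth)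
  qed
  with d show "distinct bs \<and> \<not> Z.dependent (set bs)" by simp
next
  assume a: "distinct bs \<and> \<not> Z.dependent (set bs)"
  show "zindep bs" unfolding zindep_def
  proof (intro allI impI)
    fix c i assume c: "zcomb c bs = 0" and i: "i < length bs"
    define u where "u v = c (the_inv_into {..<length bs} ((!) bs) v)" for v
    have inj: "inj_on ((!) bs) {..<length bs}"
      using a by (auto simp: inj_on_def distinct_conv_nth)
    have u: "u (bs ! k) = c k" if "k < length bs" for k
      using the_inv_into_f_f[OF inj, of k] that by (simp add: u_def)
    have "(\<Sum>v\<in>set bs. zs (u v) v) = (\<Sum>i<length bs. zs (u (bs ! i)) (bs ! i))"
      using a sum.reindex_bij_betw[OF bij_betw_nth[of bs, OF _ refl refl], of "\<lambda>v. zs (u v) v"] by simp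
    also have "\<dots> = 0" using c by (simp add: u zcomb_def)
    finally have "u (bs ! i) = 0" using a i Z.independentD[of "set bs" "set bs" u "bs ! i"] by auto
    thus "c i = 0" using u i by simp
  qed
qed

lemma int_basis_iff: "int_basis zs L bs \<longleftrightarrow> zbasis L bs"
  unfolding int_basis_def zbasis_def zindep_iff zspan_eq_range by auto

lemma zbasis_mem: "zbasis L bs \<Longrightarrow> i < length bs \<Longrightarrow> bs ! i \<in> L"
  unfolding zbasis_def by (metis rangeI zcomb_unit)

lemma zbasis_coords:
  assumes "zbasis L bs" "set cs \<subseteq> L"
  obtains A where "A \<in> carrier_mat (length bs) (length cs)"
    "\<And>j. j < length cs \<Longrightarrow> cs ! j = zcomb (\<lambda>i. A $$ (i, j)) bs"
proof -
  have "\<forall>j. \<exists>c. j < length cs \<longrightarrow> cs ! j = zcomb c bs"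
    using assms unfolding zbasis_def by (metis (no_types, lifting) image_iff nth_mem subsetD)
  then obtain C where C: "\<And>j. j < length cs \<Longrightarrow> cs ! j = zcomb (C j) bs" by metis
  show ?thesis
    by (rule that[of "Matrix.mat (length bs) (length cs) (\<lambda>(i,j). C j i)"])
      (auto simp: C intro!: zcomb_cong)
qed

text \<open>A singular integer matrix has a non-zero kernel vector with integer entries, and such a
  vector is an integral relation among \<open>cs\<close>.\<close>

lemma zindep_coords_det_nonzero:
  assumes "zindep cs" "A \<in> carrier_mat (length bs) (length cs)" "length bs = length cs"
    "\<And>j. j < length cs \<Longrightarrow> cs ! j = zcomb (\<lambda>i. A $$ (i, j)) bs"
  shows "Determinant.det A \<noteq> 0"
proof
  let ?n = "length cs"
  have A: "A \<in> carrier_mat ?n ?n" using assms by simp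
  assume "Determinant.det A = 0"
  with det_0_iff_vec_prod_zero[OF A] obtain v where
    v: "v \<in> carrier_vec ?n" "v \<noteq> 0\<^sub>v ?n" "A *\<^sub>v v = 0\<^sub>v ?n" by auto
  have "zcomb (vec_index v) cs = (\<Sum>j<?n. zs (vec_index v j) (zcomb (\<lambda>i. A $$ (i, j)) bs))"
    unfolding zcomb_def[of _ cs] using assms(4) by simp
  also have "\<dots> = zcomb (\<lambda>i. \<Sum>j<?n. vec_index v j * A $$ (i, j)) bs" by (rule zcomb_sum)
  also have "\<dots> = zcomb (\<lambda>i. 0) bs"
  proof (rule zcomb_cong)
    fix i assume i: "i < length bs"
    have "vec_index (A *\<^sub>v v) i = (\<Sum>j<?n. A $$ (i, j) * vec_index v j)"
      using i A v(1) assms(3) by (auto simp: scalar_prod_def row_def atLeast0LessThan intro!: sum.cong)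
    moreover have "vec_index (A *\<^sub>v v) i = 0" unfolding v(3) using i assms(3) by simp
    ultimately show "(\<Sum>j<?n. vec_index v j * A $$ (i, j)) = 0" by (simp only: mult.commute)
  qed
  finally have "\<forall>i<?n. vec_index v i = 0" using assms(1) by (simp add: zindep_def)
  hence "v = 0\<^sub>v ?n" using v(1) by (intro eq_vecI) auto
  with v(2) show False by simp
qed

lemma coords_compose:
  assumes "A \<in> carrier_mat (length bs) (length cs)" "B \<in> carrier_mat (length cs) (length ds)"
    "\<And>j. j < length cs \<Longrightarrow> cs ! j = zcomb (\<lambda>i. A $$ (i, j)) bs"
    "\<And>j. j < length ds \<Longrightarrow> ds ! j = zcomb (\<lambda>i. B $$ (i, j)) cs"
    "j < length ds"
  shows "ds ! j = zcomb (\<lambda>i. (A * B) $$ (i, j)) bs"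
proof -
  have "ds ! j = (\<Sum>k<length cs. zs (B $$ (k, j)) (zcomb (\<lambda>i. A $$ (i, k)) bs))"
    using assms by (simp add: zcomb_def[of _ cs])
  also have "\<dots> = zcomb (\<lambda>i. \<Sum>k<length cs. B $$ (k, j) * A $$ (i, k)) bs" by (rule zcomb_sum)
  also have "\<dots> = zcomb (\<lambda>i. (A * B) $$ (i, j)) bs"
    using assms(1,2,5) by (intro zcomb_cong)
      (auto simp: scalar_prod_def atLeast0LessThan mult.commute intro!: sum.cong)
  finally show ?thesis .
qed

lemma coords_unique:
  assumes "zindep bs" "A \<in> carrier_mat (length bs) m" "B \<in> carrier_mat (length bs) m"
    "\<And>j. j < m \<Longrightarrow> zcomb (\<lambda>i. A $$ (i, j)) bs = zcomb (\<lambda>i. B $$ (i, j)) bs"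
  shows "A = B"
proof (rule eq_matI)
  fix i j assume "i < dim_row B" "j < dim_col B"
  thus "A $$ (i, j) = B $$ (i, j)"
    using zindepD[OF assms(1) assms(4), of j i] assms(2,3) by auto
qed (use assms(2,3) in auto)

text \<open>Coordinates in both directions give integer matrices with product 1, so the determinant
  is a unit of the integers. This is why volumes and Gram determinants do not depend on the
  basis.\<close>

lemma zbasis_change_det:
  assumes "zbasis L bs" "zbasis L cs" "length bs = length cs"
    "A \<in> carrier_mat (length bs) (length cs)"
    "\<And>j. j < length cs \<Longrightarrow> cs ! j = zcomb (\<lambda>i. A $$ (i, j)) bs"
  shows "\<bar>Determinant.det A\<bar> = 1"
proof -
  let ?n = "length cs"
  have sub: "set bs \<subseteq> L" using zbasis_mem[OF assms(1)] by (auto simp: in_set_conv_nth)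
  obtain B where B: "B \<in> carrier_mat (length cs) (length bs)"
    "\<And>j. j < length bs \<Longrightarrow> bs ! j = zcomb (\<lambda>i. B $$ (i, j)) cs"
    using zbasis_coords[OF assms(2) sub] by metis
  have "A * B = 1\<^sub>m ?n"
  proof (rule coords_unique[of bs _ ?n])
    show "zindep bs" using assms(1) by (simp add: zbasis_def)
    fix j assume j: "j < ?n"
    have "zcomb (\<lambda>i. (A * B) $$ (i, j)) bs = bs ! j"
      using coords_compose[OF assms(4) B(1) assms(5) B(2)] j assms(3) by simp
    also have "\<dots> = zcomb (\<lambda>i. 1\<^sub>m ?n $$ (i, j)) bs"
      using j assms(3) by (subst zcomb_unit[symmetric]) (auto intro!: zcomb_cong)
    finally show "zcomb (\<lambda>i. (A * B) $$ (i, j)) bs = zcomb (\<lambda>i. 1\<^sub>m ?n $$ (i, j)) bs" .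
  qed (use assms B in auto)
  hence "Determinant.det A * Determinant.det B = 1"
    using det_mult[of A ?n B] assms(3,4) B(1) by simp
  thus ?thesis by (metis abs_1 abs_mult abs_zmult_eq_1)
qed

section \<open>Coset representatives and the Hermite normal form\<close>

definition transversal :: "'v set \<Rightarrow> 'v set \<Rightarrow> 'v set \<Rightarrow> bool" where
  "transversal L L' T \<longleftrightarrow> T \<subseteq> L \<and> (\<forall>x\<in>L. \<exists>t\<in>T. x - t \<in> L') \<and> (\<forall>t\<in>T. \<forall>t'\<in>T. t - t' \<in> L' \<longrightarrow> t = t')"

text \<open>Passes from representatives to the quotient set counted by \<open>ideal_index\<close>.
  Representatives are the working notion because they can be assembled one basis vector at a time
  and carried along multiplication by an element.\<close>

lemma card_quotient_transversal:
  assumes "Z.subspace L'" "transversal L L' T"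
  shows "bij_betw (\<lambda>t. {(x, y). x \<in> L \<and> y \<in> L \<and> x - y \<in> L'} `` {t}) T (L // {(x, y). x \<in> L \<and> y \<in> L \<and> x - y \<in> L'})"
proof -
  let ?R = "{(x, y). x \<in> L \<and> y \<in> L \<and> x - y \<in> L'}"
  note s = Z.subspace_0[OF assms(1)] Z.subspace_neg[OF assms(1)] Z.subspace_add[OF assms(1)]
  have neg: "y - x \<in> L'" if "x - y \<in> L'" for x y using s(2)[OF that] by simp
  have tr: "x - z \<in> L'" if "x - y \<in> L'" "y - z \<in> L'" for x y z using s(3)[OF that] by simp
  have eq: "?R `` {x} = ?R `` {y}" if "x - y \<in> L'" "x \<in> L" "y \<in> L" for x y
    using that(2,3) tr[OF that(1)] tr[OF neg[OF that(1)]] by blast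
  show ?thesis unfolding bij_betw_def
  proof
    show "inj_on (\<lambda>t. ?R `` {t}) T"
    proof (rule inj_onI)
      fix t t' assume t: "t \<in> T" "t' \<in> T" "?R `` {t} = ?R `` {t'}"
      have "t' \<in> ?R `` {t'}" using t assms(2) s(1) by (auto simp: transversal_def)
      hence "t - t' \<in> L'" using t(3) by auto
      thus "t = t'" using t assms(2) by (auto simp: transversal_def)
    qed
    show "(\<lambda>t. ?R `` {t}) ` T = L // ?R"
    proof
      show "(\<lambda>t. ?R `` {t}) ` T \<subseteq> L // ?R"
        using assms(2) by (auto simp: transversal_def quotient_def)
      show "L // ?R \<subseteq> (\<lambda>t. ?R `` {t}) ` T"
      proof
        fix X assume "X \<in> L // ?R"
        then obtain x where x: "x \<in> L" "X = ?R `` {x}" by (auto simp: quotient_def)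
        obtain t where t: "t \<in> T" "x - t \<in> L'" using x assms(2) by (auto simp: transversal_def)
        have "?R `` {x} = ?R `` {t}" using t x assms(2) by (intro eq) (auto simp: transversal_def)
        thus "X \<in> (\<lambda>t. ?R `` {t}) ` T" using t(1) x(2) by blast
      qed
    qed
  qed
qed

text \<open>The Hermite normal form: the coefficients of \<open>b\<close> in \<open>L'\<close> form an ideal \<open>d\<int>\<close>, and the part
  of \<open>L'\<close> in the span of the remaining basis vectors is handled by induction.\<close>

theorem subgroup_hermite_basis:
  assumes "zindep bs" "Z.subspace L'" "L' \<subseteq> range (\<lambda>c. zcomb c bs)"
  shows "\<exists>cs A. zbasis L' cs \<and> length cs \<le> length bs \<and> A \<in> carrier_mat (length bs) (length cs) \<and>
    (\<forall>j<length cs. cs ! j = zcomb (\<lambda>i. A $$ (i, j)) bs) \<and>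
    (length cs = length bs \<longrightarrow> (\<exists>T. finite T \<and> int (card T) = \<bar>Determinant.det A\<bar> \<and>
       transversal (range (\<lambda>c. zcomb c bs)) L' T))"
  using assms
proof (induction bs arbitrary: L')
  case Nil
  have L': "L' = {0}" using Nil.prems Z.subspace_0 by auto
  have "zbasis L' []" unfolding L' zbasis_def zindep_def by auto
  moreover have "transversal (range (\<lambda>c. zcomb c [])) L' {0}" by (auto simp: L' transversal_def)
  ultimately show ?case
    by (intro exI[of _ "[]"] exI[of _ "1\<^sub>m 0"]) (auto intro!: exI[of _ "{0}"])
next
  case (Cons b bs)
  let ?L0 = "range (\<lambda>c. zcomb c bs)" and ?n = "length bs"
  have indep0: "zindep bs" unfolding zindep_def
  proof (intro allI impI)
    fix c i assume c: "zcomb c bs = 0" "i < length bs"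
    have "zcomb (case_nat 0 c) (b # bs) = 0" using c by (simp add: zcomb_Cons)
    with Cons.prems(1) c(2) have "case_nat 0 c (Suc i) = 0"
      unfolding zindep_def by (metis Suc_less_eq length_Cons)
    thus "c i = 0" by simp
  qed
  have uniq: "k = k' \<and> x = x'" if "zs k b + x = zs k' b + x'" "x \<in> ?L0" "x' \<in> ?L0" for k k' x x'
  proof -
    from that(2,3) obtain c c' where c: "x = zcomb c bs" "x' = zcomb c' bs" by auto
    have "zcomb (case_nat k c) (b # bs) = zcomb (case_nat k' c') (b # bs)"
      using that c by (simp add: zcomb_Cons)
    from zindepD[OF Cons.prems(1) this, of 0] have "k = k'" by simp
    thus ?thesis using that by simp
  qed
  note sL = Z.subspace_0[OF Cons.prems(2)] Z.subspace_add[OF Cons.prems(2)]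
    Z.subspace_diff[OF Cons.prems(2)] Z.subspace_scale[OF Cons.prems(2)]
  note s0 = subspace_range_zcomb[of bs]
  note sL0 = Z.subspace_0[OF s0] Z.subspace_add[OF s0] Z.subspace_diff[OF s0] Z.subspace_scale[OF s0]
  have split: "\<exists>k. \<exists>x\<in>?L0. y = zs k b + x" if "y \<in> range (\<lambda>c. zcomb c (b # bs))" for y
    using that by (auto simp: zcomb_Cons)
  have mem: "zs k b + x \<in> range (\<lambda>c. zcomb c (b # bs))" if "x \<in> ?L0" for k x
  proof -
    from that obtain c where "x = zcomb c bs" by auto
    hence "zs k b + x = zcomb (case_nat k c) (b # bs)" by (simp add: zcomb_Cons)
    thus ?thesis by blast
  qed
  have sub': "Z.subspace (L' \<inter> ?L0)" by (intro Z.subspace_inter Cons.prems s0)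
  obtain cs A where IH: "zbasis (L' \<inter> ?L0) cs" "length cs \<le> ?n" "A \<in> carrier_mat ?n (length cs)"
    "\<And>j. j < length cs \<Longrightarrow> cs ! j = zcomb (\<lambda>i. A $$ (i, j)) bs"
    "length cs = ?n \<Longrightarrow> (\<exists>T. finite T \<and> int (card T) = \<bar>Determinant.det A\<bar> \<and> transversal ?L0 (L' \<inter> ?L0) T)"
    using Cons.IH[OF indep0 sub'] by auto
  define C where "C = {k. \<exists>x\<in>?L0. zs k b + x \<in> L'}"
  show ?case
  proof (cases "\<exists>k\<in>C. k > 0")
    case False
    have C0: "k = 0" if "k \<in> C" for k
    proof (rule ccontr)
      assume k: "k \<noteq> 0"
      from that obtain x where x: "x \<in> ?L0" "zs k b + x \<in> L'" by (auto simp: C_def)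
      have "zs (-k) b + zs (-1) x \<in> L'" using sL(4)[OF x(2), of "-1"]
        by (simp add: Z.scale_right_distrib)
      hence "-k \<in> C" using sL0(4)[OF x(1), of "-1"] unfolding C_def by blast
      moreover have "k > 0 \<or> -k > 0" using k by auto
      ultimately show False using False that by blast
    qed
    have "L' \<subseteq> ?L0"
    proof
      fix y assume y: "y \<in> L'"
      from split[OF subsetD[OF Cons.prems(3) y]] obtain k x where kx: "x \<in> ?L0" "y = zs k b + x" by blast
      with y have "k \<in> C" unfolding C_def by blast
      hence "k = 0" by (rule C0)
      with kx show "y \<in> ?L0" by (simp only: Z.scale_zero_left add_0_left)
    qed
    hence L': "L' \<inter> ?L0 = L'" by blast
    \<comment> \<open>The top row is zero because no vector of \<open>cs\<close> involves
      \<open>b\<close>. As \<open>cs\<close> is shorter than \<open>b # bs\<close>, the clause about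
      \<open>T\<close> holds vacuously.\<close>
    let ?A = "Matrix.mat (Suc ?n) (length cs) (\<lambda>(i, j). case i of 0 \<Rightarrow> 0 | Suc i \<Rightarrow> A $$ (i, j))"
    show ?thesis
      using IH(1,2) by (intro exI[of _ cs] exI[of _ ?A]) (auto simp: L' zcomb_Cons IH(4) intro!: zcomb_cong)
  next
    case True
    define dn where "dn = (LEAST m. m > 0 \<and> int m \<in> C)"
    have ex: "\<exists>m. m > 0 \<and> int m \<in> C" using True by (metis zero_less_imp_eq_int of_nat_0_less_iff)
    have dn: "dn > 0" "int dn \<in> C" using LeastI_ex[OF ex] by (simp_all add: dn_def)
    have dmin: "dn \<le> m" if "m > 0" "int m \<in> C" for m
      unfolding dn_def using that by (auto intro: Least_le)
    define d where "d = int dn"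
    have d: "d > 0" "d \<in> C" using dn by (simp_all add: d_def)
    obtain x0 where x0: "x0 \<in> ?L0" "zs d b + x0 \<in> L'" using d by (auto simp: C_def)
    define w where "w = zs d b + x0"
    obtain e where e: "x0 = zcomb e bs" using x0 by auto
    \<comment> \<open>Subtracting \<open>q\<close> copies of \<open>w\<close> lowers the coefficient
      of \<open>b\<close> by \<open>q * d\<close> and changes the rest only within the span of
      \<open>bs\<close>. Every division with remainder below goes through this identity.\<close>
    have red: "zs (k - q * d) b + (x - zs q x0) = (zs k b + x) - zs q w" for k q x
      by (simp add: w_def Z.scale_right_distrib Z.scale_left_diff_distrib)
    have dvd: "d dvd k" if k: "k \<in> C" for k
    proof (rule ccontr)
      assume "\<not> d dvd k"
      hence r: "k mod d > 0" "k mod d < d" using d(1) pos_mod_bound[of d k] pos_mod_sign[of d k]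
        unfolding dvd_eq_mod_eq_0 by linarith+
      from k obtain x where x: "x \<in> ?L0" "zs k b + x \<in> L'" by (auto simp: C_def)
      have "zs (k mod d) b + (x - zs (k div d) x0) \<in> L'"
        using red[of k "k div d" x] sL(3)[OF x(2) sL(4)[OF x0(2)]] by (simp only: minus_div_mult_eq_mod w_def)
      hence "k mod d \<in> C" using x x0 unfolding C_def by (blast intro: sL0)
      hence "dn \<le> Int.nat (k mod d)" using r by (intro dmin) auto
      with r show False by (simp add: d_def)
    qed
    let ?m = "length cs"
    \<comment> \<open>The first column holds the coordinates of \<open>w\<close>, namely
      \<open>d\<close> above those of \<open>x0\<close>; the vectors of \<open>cs\<close> have no
      component along \<open>b\<close>. The matrix is block triangular, so its determinant is
      \<open>d\<close> times that of \<open>A\<close>.\<close>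
    define A' where "A' = four_block_mat (Matrix.mat 1 1 (\<lambda>_. d)) (0\<^sub>m 1 ?m) (Matrix.mat ?n 1 (\<lambda>(i, j). e i)) A"
    have A'c: "A' \<in> carrier_mat (Suc ?n) (Suc ?m)" unfolding A'_def using IH(3)
      by (metis four_block_carrier_mat mat_carrier plus_1_eq_Suc)
    have A'0: "A' $$ (0, 0) = d" "i < ?n \<Longrightarrow> A' $$ (Suc i, 0) = e i" "j < ?m \<Longrightarrow> A' $$ (0, Suc j) = 0"
      "i < ?n \<Longrightarrow> j < ?m \<Longrightarrow> A' $$ (Suc i, Suc j) = A $$ (i, j)" for i j
      using IH(3) by (auto simp: A'_def)
    have basis: "zbasis L' (w # cs)" unfolding zbasis_def
    proof
      show "zindep (w # cs)" unfolding zindep_def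
      proof (intro allI impI)
        fix c i assume c: "zcomb c (w # cs) = 0" and i: "i < length (w # cs)"
        let ?y = "zcomb (\<lambda>i. c (Suc i)) cs"
        have y: "?y \<in> L' \<inter> ?L0" using IH(1) by (auto simp: zbasis_def)
        have "zs (c 0 * d) b + (zs (c 0) x0 + ?y) = zs 0 b + 0"
          using c by (simp add: zcomb_Cons w_def Z.scale_right_distrib add.assoc)
        moreover have "zs (c 0) x0 + ?y \<in> ?L0" using y x0(1) by (blast intro: sL0)
        ultimately have "c 0 * d = 0 \<and> zs (c 0) x0 + ?y = 0" using sL0(1) by (intro uniq)
        hence "c 0 = 0" "?y = 0" using d(1) by auto
        hence "\<forall>i<?m. c (Suc i) = 0" using IH(1) unfolding zbasis_def zindep_def by blast
        with \<open>c 0 = 0\<close> i show "c i = 0" by (cases i) auto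
      qed
      show "L' = range (\<lambda>c. zcomb c (w # cs))"
      proof
        show "range (\<lambda>c. zcomb c (w # cs)) \<subseteq> L'"
        proof clarify
          fix c
          have "zcomb (\<lambda>i. c (Suc i)) cs \<in> L'" using IH(1) by (auto simp: zbasis_def)
          thus "zcomb c (w # cs) \<in> L'" unfolding zcomb_Cons w_def by (rule sL(2)[OF sL(4)[OF x0(2)]])
        qed
        show "L' \<subseteq> range (\<lambda>c. zcomb c (w # cs))"
        proof
          fix y assume y: "y \<in> L'"
          from split[OF subsetD[OF Cons.prems(3) y]] obtain k x where kx: "x \<in> ?L0" "y = zs k b + x" by blast
          with y have "k \<in> C" unfolding C_def by blast
          then obtain q where q: "k = q * d" using dvd by (metis dvdE mult.commute)
          have "y - zs q w = x - zs q x0" using red[of k q x] kx by (simp add: q)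
          moreover have "y - zs q w \<in> L'" unfolding w_def by (rule sL(3)[OF y sL(4)[OF x0(2)]])
          moreover have "x - zs q x0 \<in> ?L0" using kx x0(1) by (blast intro: sL0)
          ultimately have "y - zs q w \<in> L' \<inter> ?L0" by simp
          then obtain c where "y - zs q w = zcomb c cs" using IH(1) by (auto simp: zbasis_def)
          hence "y = zcomb (case_nat q c) (w # cs)" by (simp add: zcomb_Cons algebra_simps)
          thus "y \<in> range (\<lambda>c. zcomb c (w # cs))" by blast
        qed
      qed
    qed
    have coords: "(w # cs) ! j = zcomb (\<lambda>i. A' $$ (i, j)) (b # bs)" if "j < Suc ?m" for j
    proof (cases j)
      case 0
      have "zcomb (\<lambda>i. A' $$ (Suc i, 0)) bs = x0" unfolding e
        by (rule zcomb_cong) (simp add: A'0)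
      thus ?thesis using 0 by (simp add: zcomb_Cons A'0 w_def)
    next
      case (Suc k)
      have "zcomb (\<lambda>i. A' $$ (Suc i, Suc k)) bs = cs ! k" using that Suc
        by (subst IH(4)) (auto intro!: zcomb_cong simp: A'0)
      thus ?thesis using Suc that by (simp add: zcomb_Cons A'0)
    qed
    have T: "\<exists>T. finite T \<and> int (card T) = \<bar>Determinant.det A'\<bar> \<and>
        transversal (range (\<lambda>c. zcomb c (b # bs))) L' T" if len: "?m = ?n"
    proof -
      obtain T0 where T0: "finite T0" "int (card T0) = \<bar>Determinant.det A\<bar>" "transversal ?L0 (L' \<inter> ?L0) T0"
        using IH(5)[OF len] by blast
      \<comment> \<open>Copies of \<open>w\<close> reduce the coefficient of \<open>b\<close> to the
        range from 0 to \<open>d - 1\<close>, after which \<open>T0\<close> represents what is left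
        in the span of \<open>bs\<close>. This gives \<open>d * card T0\<close> representatives,
        matching the determinant of \<open>A'\<close>.\<close>
      define T where "T = (\<lambda>(r, t). zs r b + t) ` ({0..<d} \<times> T0)"
      have T0L: "T0 \<subseteq> ?L0" using T0(3) by (simp add: transversal_def)
      have inj: "inj_on (\<lambda>(r, t). zs r b + t) ({0..<d} \<times> T0)"
      proof (rule inj_onI, clarify)
        fix r t r' t' assume *: "t \<in> T0" "t' \<in> T0" "zs r b + t = zs r' b + t'"
        show "r = r' \<and> t = t'" by (rule uniq[OF *(3)]) (use * T0L in auto)
      qed
      have "Determinant.det A' = d * Determinant.det A" unfolding A'_def
        by (subst det_four_block_mat_upper_right_zero[of _ 1 _ ?n])
           (use IH(3) len det_single[of "Matrix.mat 1 1 (\<lambda>_. d)"] in auto)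
      moreover have "card T = Int.nat d * card T0" unfolding T_def card_image[OF inj] by (simp add: card_cartesian_product)
      ultimately have cT: "int (card T) = \<bar>Determinant.det A'\<bar>" using T0(2) d(1) by (simp add: abs_mult)
      have "transversal (range (\<lambda>c. zcomb c (b # bs))) L' T" unfolding transversal_def
      proof (intro conjI ballI impI)
        show "T \<subseteq> range (\<lambda>c. zcomb c (b # bs))"
        proof
          fix s assume "s \<in> T"
          then obtain r t where "s = zs r b + t" "t \<in> T0" by (auto simp: T_def)
          with T0L mem[of t r] show "s \<in> range (\<lambda>c. zcomb c (b # bs))" by (simp only: subset_iff)
        qed
      next
        fix y assume "y \<in> range (\<lambda>c. zcomb c (b # bs))"
        then obtain k x where kx: "x \<in> ?L0" "y = zs k b + x" using split by blast
        have "x - zs (k div d) x0 \<in> ?L0" using kx x0(1) by (blast intro: sL0)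
        then obtain t where t: "t \<in> T0" "x - zs (k div d) x0 - t \<in> L' \<inter> ?L0"
          using T0(3) unfolding transversal_def by blast
        have "y - (zs (k mod d) b + t) = (x - zs (k div d) x0 - t) + zs (k div d) w"
        proof -
          have "y = zs (k mod d) b + (x - zs (k div d) x0) + zs (k div d) w"
            using red[of k "k div d" x] unfolding minus_div_mult_eq_mod kx(2) by (metis diff_add_cancel)
          moreover have "u + X + W - (u + t) = X - t + W" for u X W :: 'v by (simp add: algebra_simps)
          ultimately show ?thesis by simp
        qed
        hence "y - (zs (k mod d) b + t) \<in> L'" using sL(2)[OF _ sL(4)[OF x0(2)]] t(2) unfolding w_def by (metis IntD1)
        moreover have "zs (k mod d) b + t \<in> T" using t(1) d(1) by (auto simp: T_def)
        ultimately show "\<exists>t\<in>T. y - t \<in> L'" by blast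
      next
        fix s s' assume *: "s \<in> T" "s' \<in> T" "s - s' \<in> L'"
        then obtain r t r' t' where rt: "s = zs r b + t" "s' = zs r' b + t'" "0 \<le> r" "r < d" "0 \<le> r'" "r' < d"
          "t \<in> T0" "t' \<in> T0" by (auto simp: T_def)
        have ss: "s - s' = zs (r - r') b + (t - t')" using rt by (simp add: Z.scale_left_diff_distrib)
        have tt: "t - t' \<in> ?L0" using rt T0L by (blast intro: sL0)
        have "r - r' \<in> C" using *(3) tt unfolding ss C_def by blast
        hence "d dvd r - r'" by (rule dvd)
        hence r: "r = r'" using rt by (metis dvd_imp_mod_0 mod_eq_dvd_iff mod_pos_pos_trivial)
        hence "t - t' \<in> L' \<inter> ?L0" using * ss tt by simp
        hence "t = t'" using T0(3) rt by (auto simp: transversal_def)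
        with r rt show "s = s'" by simp
      qed
      thus ?thesis using cT T0(1) by (intro exI[of _ T]) (simp add: T_def)
    qed
    show ?thesis
    proof (intro exI[of _ "w # cs"] exI[of _ A'] conjI impI allI)
      show "length (w # cs) \<le> length (b # bs)" using IH(2) by simp
      show "A' \<in> carrier_mat (length (b # bs)) (length (w # cs))" using A'c by simp
      show "(w # cs) ! j = zcomb (\<lambda>i. A' $$ (i, j)) (b # bs)" if "j < length (w # cs)" for j
        by (rule coords) (use that in simp)
      show "\<exists>T. finite T \<and> int (card T) = \<bar>Determinant.det A'\<bar> \<and>
        transversal (range (\<lambda>c. zcomb c (b # bs))) L' T" if "length (w # cs) = length (b # bs)"
        by (rule T) (use that in simp)
    qed (rule basis)
  qed
qed

section \<open>Rational independence, rank and index\<close>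

lemma common_denominator:
  assumes "finite S"
  shows "\<exists>k>0. \<forall>v\<in>S. of_int k * (u v :: rat) \<in> \<int>"
  using assms
proof induction
  case empty
  show ?case by (auto intro: exI[of _ 1])
next
  case (insert v S)
  then obtain k where k: "k > 0" "\<forall>v\<in>S. of_int k * u v \<in> \<int>" by auto
  obtain p q where q: "q > 0" "u v = of_int p / of_int q"
    by (metis quotient_of_div quotient_of_denom_pos surj_pair)
  have "of_int (k * q) * u w \<in> \<int>" if "w \<in> insert v S" for w
  proof (cases "w = v")
    case True
    have "of_int (k * q) * u v = of_int (k * p)" using q by simp
    thus ?thesis using True by (metis Ints_of_int)
  next
    case False
    hence "of_int q * (of_int k * u w) \<in> \<int>" using that k by (intro Ints_mult[of "of_int q"]) auto
    moreover have "of_int q * (of_int k * u w) = of_int (k * q) * u w" by simp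
    ultimately show ?thesis by (simp only:)
  qed
  thus ?case using k q by (intro exI[of _ "k * q"]) auto
qed

text \<open>Clearing denominators turns a rational relation into an integral one. Consequently the
  length of a \<open>zbasis\<close> is a rational dimension, which is how ranks are compared
  later.\<close>

lemma zindep_independent:
  assumes "zindep bs"
  shows "\<not> dependent (set bs)"
proof
  assume "dependent (set bs)"
  then obtain u where u: "\<exists>v\<in>set bs. u v \<noteq> 0" "(\<Sum>v\<in>set bs. scale (u v) v) = 0"
    by (auto simp: dependent_finite)
  obtain k where k: "k > 0" "\<forall>v\<in>set bs. of_int k * u v \<in> \<int>"
    using common_denominator[of "set bs" u] by auto
  define c where "c i = \<lfloor>of_int k * u (bs ! i)\<rfloor>" for i
  have c: "of_int (c i) = of_int k * u (bs ! i)" if "i < length bs" for i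
    using k(2) that by (auto simp: c_def elim!: Ints_cases)
  have "zcomb c bs = (\<Sum>i<length bs. scale (of_int k * u (bs ! i)) (bs ! i))"
    unfolding zcomb_def zs_eq by (intro sum.cong) (auto simp: c)
  also have "\<dots> = scale (of_int k) (\<Sum>i<length bs. scale (u (bs ! i)) (bs ! i))"
    by (simp add: scale_sum_right)
  also have "(\<Sum>i<length bs. scale (u (bs ! i)) (bs ! i)) = (\<Sum>v\<in>set bs. scale (u v) v)"
    using sum.reindex_bij_betw[OF bij_betw_nth[OF zindep_distinct[OF assms] refl refl], of "\<lambda>v. scale (u v) v"]
    by simp
  finally have "\<forall>i<length bs. c i = 0" using u(2) assms by (simp add: zindep_def)
  hence "of_int k * u (bs ! i) = 0" if "i < length bs" for i using c[OF that] that by simp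
  with u(1) k(1) show False by (auto simp: in_set_conv_nth)
qed

lemma zcomb_in_span: "zcomb c bs \<in> span (set bs)"
  unfolding zcomb_def zs_eq by (intro span_sum span_scale span_base) auto

lemma zbasis_length:
  assumes "zbasis L bs"
  shows "length bs = dim L"
proof -
  have "card (set bs) = dim L"
  proof (rule basis_card_eq_dim)
    show "set bs \<subseteq> L" using zbasis_mem[OF assms] by (auto simp: in_set_conv_nth)
    show "L \<subseteq> span (set bs)" using assms zcomb_in_span by (auto simp: zbasis_def)
    show "\<not> dependent (set bs)" using assms by (auto simp: zbasis_def zindep_independent)
  qed
  thus ?thesis using assms by (simp add: zbasis_def zindep_distinct distinct_card)
qed

lemma zbasis_subspace: "zbasis L bs \<Longrightarrow> Z.subspace L"
  unfolding zbasis_def using subspace_range_zcomb by auto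

lemma zbasis_subgroup:
  assumes "zbasis L bs" "Z.subspace L'" "L' \<subseteq> L"
  shows "\<exists>cs. zbasis L' cs"
  using subgroup_hermite_basis[of bs L'] assms by (auto simp: zbasis_def)

text \<open>The Hermite basis \<open>cs0\<close> gives the index as the absolute determinant of
  \<open>A0\<close>. The given basis \<open>cs\<close> differs from it by a unimodular matrix, which
  does not affect the absolute value.\<close>

lemma index_eq_det:
  assumes "zbasis L bs" "zbasis L' cs" "L' \<subseteq> L" "length bs = length cs"
    "A \<in> carrier_mat (length bs) (length cs)"
    "\<And>j. j < length cs \<Longrightarrow> cs ! j = zcomb (\<lambda>i. A $$ (i, j)) bs"
  shows "int (card (L // {(x, y). x \<in> L \<and> y \<in> L \<and> x - y \<in> L'})) = \<bar>Determinant.det A\<bar>"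
proof -
  have L: "L = range (\<lambda>c. zcomb c bs)" "zindep bs" using assms(1) by (auto simp: zbasis_def)
  have sub: "Z.subspace L'" using assms(2) by (rule zbasis_subspace)
  have "L' \<subseteq> range (\<lambda>c. zcomb c bs)" using assms(3) L(1) by simp
  from subgroup_hermite_basis[OF L(2) sub this]
  obtain cs0 A0 where cs0: "zbasis L' cs0" "A0 \<in> carrier_mat (length bs) (length cs0)"
    "\<And>j. j < length cs0 \<Longrightarrow> cs0 ! j = zcomb (\<lambda>i. A0 $$ (i, j)) bs"
    and T: "length cs0 = length bs \<Longrightarrow> (\<exists>T. finite T \<and> int (card T) = \<bar>Determinant.det A0\<bar> \<and> transversal L L' T)"
    unfolding L(1)[symmetric] by blast
  have len: "length cs0 = length cs" using zbasis_length[OF cs0(1)] zbasis_length[OF assms(2)] by simp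
  then obtain T where T: "int (card T) = \<bar>Determinant.det A0\<bar>" "transversal L L' T" using T assms(4) by auto
  have sub: "set cs \<subseteq> L'" using zbasis_mem[OF assms(2)] by (auto simp: in_set_conv_nth)
  obtain U where U: "U \<in> carrier_mat (length cs0) (length cs)"
    "\<And>j. j < length cs \<Longrightarrow> cs ! j = zcomb (\<lambda>i. U $$ (i, j)) cs0"
    using zbasis_coords[OF cs0(1) sub] by metis
  have "A = A0 * U"
  proof (rule coords_unique[OF L(2) assms(5)])
    show "A0 * U \<in> carrier_mat (length bs) (length cs)" using cs0(2) U(1) by simp
    show "zcomb (\<lambda>i. A $$ (i, j)) bs = zcomb (\<lambda>i. (A0 * U) $$ (i, j)) bs" if "j < length cs" for j
      using coords_compose[OF cs0(2) U(1) cs0(3) U(2) that] assms(6)[OF that] by simp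
  qed
  moreover have "\<bar>Determinant.det U\<bar> = 1" using zbasis_change_det[OF cs0(1) assms(2) len U] .
  ultimately have "\<bar>Determinant.det A\<bar> = \<bar>Determinant.det A0\<bar>"
    using cs0(2) U(1) len assms(4) det_mult[of A0 "length cs" U] by (simp add: abs_mult)
  moreover have "card (L // {(x, y). x \<in> L \<and> y \<in> L \<and> x - y \<in> L'}) = card T"
    using bij_betw_same_card[OF card_quotient_transversal[OF _ T(2)]] zbasis_subspace[OF assms(2)] by simp
  ultimately show ?thesis using T(1) by simp
qed

end

section \<open>Algebraic integers\<close>

text \<open>The integer scaling is a separate parameter so that it becomes
  \<open>of_int n * x\<close> literally; the integral spans then agree on the nose with those in
  \<open>ideal_mult\<close> and \<open>int_basis\<close>.\<close>

global_interpretation F: rat_space "\<lambda>q (x::'f::field_char_0). of_rat q * x" "\<lambda>n x. of_int n * x"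
  by unfold_locales (simp_all add: algebra_simps of_rat_add of_rat_mult)

text \<open>The coordinates of the products \<open>x * ws ! j\<close> form an integer matrix with
  eigenvector \<open>ws\<close> and eigenvalue \<open>x\<close>, so \<open>x\<close> is a root of
  its characteristic polynomial, which is monic with integer coefficients.\<close>

lemma algebraic_int_stable_list:
  fixes x :: "'f::field_char_0"
  assumes "w \<in> set ws" "w \<noteq> 0" "\<And>w. w \<in> set ws \<Longrightarrow> x * w \<in> F.Z.span (set ws)"
  shows "algebraic_int x"
proof -
  let ?n = "length ws"
  have "\<forall>j. \<exists>c. j < ?n \<longrightarrow> x * ws ! j = F.zcomb c ws"
  proof
    fix j
    show "\<exists>c. j < ?n \<longrightarrow> x * ws ! j = F.zcomb c ws"
      using assms(3)[of "ws ! j"] unfolding F.zspan_eq_range by (cases "j < ?n") auto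
  qed
  then obtain C where C: "\<And>j. j < ?n \<Longrightarrow> x * ws ! j = F.zcomb (C j) ws" by metis
  define A where "A = Matrix.mat ?n ?n (\<lambda>(j, i). C j i)"
  define B where "B = (map_mat of_int A :: 'f mat)"
  have A: "A \<in> carrier_mat ?n ?n" and B: "B \<in> carrier_mat ?n ?n" by (simp_all add: A_def B_def)
  have "eigenvector B (vec_of_list ws) x" unfolding eigenvector_def
  proof (intro conjI)
    show "vec_of_list ws \<in> carrier_vec (dim_row B)" using B by (auto intro: carrier_vecI)
    obtain j where j: "j < ?n" "ws ! j = w" using assms(1) by (auto simp: in_set_conv_nth)
    hence "vec_index (vec_of_list ws) j \<noteq> vec_index (0\<^sub>v (dim_row B)) j"
      using assms(2) B by (simp add: vec_of_list_index)
    thus "vec_of_list ws \<noteq> 0\<^sub>v (dim_row B)" by metis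
    show "B *\<^sub>v vec_of_list ws = x \<cdot>\<^sub>v vec_of_list ws"
    proof (rule eq_vecI)
      fix j assume "j < dim_vec (x \<cdot>\<^sub>v vec_of_list ws)"
      hence j: "j < ?n" by simp
      have "vec_index (B *\<^sub>v vec_of_list ws) j = (\<Sum>i<?n. of_int (C j i) * ws ! i)"
        using j by (auto simp: B_def A_def scalar_prod_def vec_of_list_index atLeast0LessThan intro!: sum.cong)
      also have "\<dots> = x * ws ! j" using C[OF j] by (simp add: F.zcomb_def)
      finally show "vec_index (B *\<^sub>v vec_of_list ws) j = vec_index (x \<cdot>\<^sub>v vec_of_list ws) j"
        using j by (simp add: vec_of_list_index)
    qed (use B in simp)
  qed
  hence "eigenvalue B x" by (auto simp: eigenvalue_def)
  hence "poly (char_poly B) x = 0" using eigenvalue_root_char_poly[OF B] by simp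
  moreover have "char_poly B = map_poly of_int (char_poly A)"
    unfolding B_def by (rule of_int_hom.char_poly_hom[OF A])
  moreover have "lead_coeff (char_poly A) = 1" using degree_monic_char_poly[OF A] by simp
  ultimately show ?thesis unfolding algebraic_int_altdef_ipoly by metis
qed

lemma algebraic_int_stable:
  fixes x :: "'f::field_char_0"
  assumes "finite S" "w \<in> S" "w \<noteq> 0" "\<And>w. w \<in> S \<Longrightarrow> x * w \<in> F.Z.span S"
  shows "algebraic_int x"
proof -
  obtain ws where "set ws = S" using assms(1) finite_list by blast
  thus ?thesis using algebraic_int_stable_list[of w ws x] assms by auto
qed

lemma span_mult_closed:
  fixes x :: "'f::field_char_0"
  assumes "\<And>w. w \<in> S \<Longrightarrow> x * w \<in> F.Z.span S" "y \<in> F.Z.span S"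
  shows "x * y \<in> F.Z.span S"
  using assms(2)
proof (induction rule: F.Z.span_induct)
  case base
  show ?case
    by (rule F.Z.subspaceI) (auto simp: distrib_left F.Z.span_zero F.Z.span_add mult.left_commute[of x] F.Z.span_scale)
qed (use assms in auto)

lemma algebraic_int_pow_reduce:
  fixes x :: "'f::field_char_0"
  assumes "algebraic_int x"
  obtains m c where "m > 0" "x ^ m = (\<Sum>i<m. of_int (c i) * x ^ i)"
proof -
  obtain p where p: "poly (map_poly of_int p) x = 0" "lead_coeff p = 1"
    using assms unfolding algebraic_int_altdef_ipoly by blast
  have d: "degree p > 0"
  proof (rule ccontr)
    assume "\<not> degree p > 0"
    then obtain a where "p = [:a:]" using degree_eq_zeroE by blast
    with p show False by simp
  qed
  have "0 = (\<Sum>i\<le>degree p. of_int (coeff p i) * x ^ i)"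
    using p(1) by (simp add: poly_altdef)
  also have "{..degree p} = insert (degree p) {..<degree p}" by auto
  also have "(\<Sum>i\<in>\<dots>. of_int (coeff p i) * x ^ i) = x ^ degree p + (\<Sum>i<degree p. of_int (coeff p i) * x ^ i)"
    using p(2) by simp
  finally have "x ^ degree p = (\<Sum>i<degree p. of_int (- coeff p i) * x ^ i)"
    by (simp add: sum_negf eq_neg_iff_add_eq_0)
  with d show ?thesis by (rule that)
qed

text \<open>The monomials \<open>x ^ i * y ^ j\<close> with exponents below the degrees of the two
  monic equations generate a group stable under \<open>x\<close> and under \<open>y\<close>, hence
  under their sum and product.\<close>

lemma algebraic_int_add_mult:
  fixes x y :: "'f::field_char_0"
  assumes "algebraic_int x" "algebraic_int y"
  shows "algebraic_int (x + y)" "algebraic_int (x * y)"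
proof -
  obtain m c where m: "m > 0" "x ^ m = (\<Sum>i<m. of_int (c i) * x ^ i)"
    using algebraic_int_pow_reduce[OF assms(1)] .
  obtain k d where k: "k > 0" "y ^ k = (\<Sum>i<k. of_int (d i) * y ^ i)"
    using algebraic_int_pow_reduce[OF assms(2)] .
  define S where "S = (\<lambda>(i, j). x ^ i * y ^ j) ` ({..<m} \<times> {..<k})"
  have S: "x ^ i * y ^ j \<in> S" if "i < m" "j < k" for i j using that by (auto simp: S_def)
  have fin: "finite S" by (simp add: S_def)
  have one: "1 \<in> S" using S[of 0 0] m k by simp
  have x: "x * w \<in> F.Z.span S" if w: "w \<in> S" for w
  proof -
    obtain i j where ij: "i < m" "j < k" "w = x ^ i * y ^ j" using w by (auto simp: S_def)
    show ?thesis
    proof (cases "Suc i < m")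
      case True
      hence "x ^ Suc i * y ^ j \<in> S" using S ij by blast
      thus ?thesis using ij by (auto intro: F.Z.span_base simp: mult.assoc)
    next
      case False
      hence "m = Suc i" using ij by simp
      hence "x * w = x ^ m * y ^ j" using ij by simp
      also have "\<dots> = (\<Sum>i<m. of_int (c i) * (x ^ i * y ^ j))"
        by (simp add: m(2) sum_distrib_right mult.assoc)
      also have "\<dots> \<in> F.Z.span S"
        using S ij by (intro F.Z.span_sum F.Z.span_scale F.Z.span_base) auto
      finally show ?thesis .
    qed
  qed
  have y: "y * w \<in> F.Z.span S" if w: "w \<in> S" for w
  proof -
    obtain i j where ij: "i < m" "j < k" "w = x ^ i * y ^ j" using w by (auto simp: S_def)
    show ?thesis
    proof (cases "Suc j < k")
      case True
      hence "x ^ i * y ^ Suc j \<in> S" using S ij by blast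
      moreover have "y * w = x ^ i * y ^ Suc j" using ij by (simp add: mult_ac)
      ultimately show ?thesis by (simp only: F.Z.span_base)
    next
      case False
      hence "k = Suc j" using ij by simp
      hence "y * w = x ^ i * y ^ k" using ij by simp
      also have "\<dots> = (\<Sum>j<k. of_int (d j) * (x ^ i * y ^ j))"
        by (simp add: k(2) sum_distrib_left mult_ac)
      also have "\<dots> \<in> F.Z.span S"
        using S ij by (intro F.Z.span_sum F.Z.span_scale F.Z.span_base) auto
      finally show ?thesis .
    qed
  qed
  have xy: "x * y * w \<in> F.Z.span S" if "w \<in> S" for w
    using span_mult_closed[of S x, OF x y[OF that]] by (simp add: mult.assoc)
  show "algebraic_int (x + y)"
    by (rule algebraic_int_stable[OF fin one]) (auto simp: distrib_right intro: F.Z.span_add x y)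
  show "algebraic_int (x * y)"
    by (rule algebraic_int_stable[OF fin one]) (auto intro: xy)
qed

lemma algebraic_int_of_int: "algebraic_int (of_int n :: 'f::field_char_0)"
  by (rule int_imp_algebraic_int) auto

lemma algebraic_int_sum:
  "(\<And>i. i \<in> I \<Longrightarrow> algebraic_int (f i :: 'f::field_char_0)) \<Longrightarrow> algebraic_int (sum f I)"
  by (induction I rule: infinite_finite_induct) (auto intro: algebraic_int_add_mult)

lemma algebraic_int_1: "algebraic_int (1 :: 'f::field_char_0)"
  using algebraic_int_of_int[of 1] by simp

lemma algebraic_int_prod:
  "(\<And>i. i \<in> I \<Longrightarrow> algebraic_int (f i :: 'f::field_char_0)) \<Longrightarrow> algebraic_int (prod f I)"
  by (induction I rule: infinite_finite_induct) (auto intro: algebraic_int_add_mult algebraic_int_1)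

lemma algebraic_int_power: "algebraic_int (x :: 'f::field_char_0) \<Longrightarrow> algebraic_int (x ^ n)"
  by (induction n) (auto intro: algebraic_int_add_mult algebraic_int_1)

lemma algebraic_int_det:
  assumes "A \<in> carrier_mat n n" "\<And>i j. i < n \<Longrightarrow> j < n \<Longrightarrow> algebraic_int (A $$ (i, j) :: 'f::field_char_0)"
  shows "algebraic_int (Determinant.det A)"
proof -
  have "algebraic_int (of_int (sign p) * (\<Prod>i = 0..<n. A $$ (i, p i)) :: 'f)" if p: "p permutes {0..<n}" for p
  proof (intro algebraic_int_add_mult algebraic_int_of_int algebraic_int_prod assms(2))
    fix i assume i: "i \<in> {0..<n}"
    with permutes_in_image[OF p, of i] show "p i < n" by simp
  qed auto
  thus ?thesis unfolding det_def'[OF assms(1)] by (intro algebraic_int_sum) auto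
qed

lemma algebraic_int_hom:
  assumes "field_hom \<sigma>" "algebraic_int (x :: 'f::field_char_0)"
  shows "algebraic_int (\<sigma> x :: 'g::field_char_0)"
proof -
  interpret field_hom \<sigma> by fact
  obtain p where p: "poly (map_poly of_int p) x = 0" "lead_coeff p = 1"
    using assms(2) unfolding algebraic_int_altdef_ipoly by blast
  have "poly (map_poly of_int p) (\<sigma> x) = \<sigma> (poly (map_poly of_int p) x)"
    by (simp add: poly_altdef hom_distribs)
  with p show ?thesis unfolding algebraic_int_altdef_ipoly by (intro exI[of _ p]) simp
qed

text \<open>The leading coefficient \<open>l\<close> of an integer polynomial vanishing at
  \<open>x\<close> works up to sign: \<open>l * x ^ m\<close> is an integer combination of lower
  powers, so multiplication by \<open>l * x\<close> preserves the group generated by the powers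
  below \<open>m\<close>.\<close>

lemma algebraic_int_multiple:
  assumes "algebraic (x :: 'f::field_char_0)"
  obtains k :: int where "k > 0" "algebraic_int (of_int k * x)"
proof -
  obtain p :: "int poly" where p: "p \<noteq> 0" "poly (map_poly of_int p) x = 0"
    using assms by (elim algebraicE') auto
  define m where "m = degree p"
  define l where "l = lead_coeff p"
  define ws where "ws = (\<lambda>i. of_int (l ^ (m - 1)) * x ^ i) ` {..<m}"
  have l: "l \<noteq> 0" using p by (simp add: l_def)
  have m: "m > 0"
  proof (rule ccontr)
    assume "\<not> m > 0"
    then obtain a where "p = [:a:]" unfolding m_def using degree_eq_zeroE by blast
    with p show False by simp
  qed
  have "0 = (\<Sum>i\<le>m. of_int (coeff p i) * x ^ i)"
    using p(2) by (simp add: poly_altdef m_def)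
  also have "{..m} = insert m {..<m}" by auto
  also have "(\<Sum>i\<in>\<dots>. of_int (coeff p i) * x ^ i) = of_int l * x ^ m + (\<Sum>i<m. of_int (coeff p i) * x ^ i)"
    by (simp add: l_def m_def)
  finally have red: "of_int l * x ^ m = (\<Sum>i<m. of_int (- coeff p i) * x ^ i)"
    by (simp add: sum_negf eq_neg_iff_add_eq_0)
  have "algebraic_int (of_int l * x)"
  proof (rule algebraic_int_stable)
    let ?S = "(\<lambda>i. x ^ i) ` {..<m}"
    show "finite ?S" by simp
    show "1 \<in> ?S" using m by (auto intro!: image_eqI[of _ _ 0])
    fix w assume "w \<in> ?S"
    then obtain i where i: "i < m" "w = x ^ i" by auto
    show "of_int l * x * w \<in> F.Z.span ?S"
    proof (cases "Suc i < m")
      case True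
      have "of_int l * x ^ Suc i \<in> F.Z.span ?S"
        using True by (intro F.Z.span_scale F.Z.span_base) (auto simp del: power_Suc)
      thus ?thesis using i by (simp add: mult.assoc)
    next
      case False
      hence "m = Suc i" using i by simp
      hence "of_int l * x * w = of_int l * x ^ m" using i by simp
      also have "\<dots> \<in> F.Z.span ?S" unfolding red
        by (intro F.Z.span_sum F.Z.span_scale F.Z.span_base) auto
      finally show ?thesis .
    qed
  qed simp
  hence "algebraic_int (of_int \<bar>l\<bar> * x)" by (cases "l \<ge> 0") auto
  thus ?thesis using that[of "\<bar>l\<bar>"] l by simp
qed

text \<open>The cofactor \<open>\<gamma>\<close> plays the role of the product of the other conjugates of \<open>x\<close>.\<close>

lemma algebraic_int_divides_int:
  assumes "algebraic_int (x :: 'f::field_char_0)" "x \<noteq> 0"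
  obtains \<gamma> and k :: int where "algebraic_int \<gamma>" "k > 0" "\<gamma> * x = of_int k"
proof -
  obtain p where p: "poly (map_poly of_int p) x = 0" "lead_coeff p = 1"
    using assms unfolding algebraic_int_altdef_ipoly by blast
  hence "p \<noteq> 0" by auto
  thus ?thesis using p(1) that
  proof (induction p)
    case (pCons a p)
    show ?case
    proof (cases "a = 0")
      case True
      with pCons assms(2) show ?thesis by (auto simp: of_int_hom.map_poly_pCons_hom)
    next
      case False
      \<comment> \<open>The polynomial is \<open>a\<close> plus the variable times \<open>p\<close>,
        so the value of \<open>p\<close> at \<open>x\<close>, multiplied by \<open>x\<close>, is
        \<open>- a\<close>. The sign is corrected in the two cases below.\<close>
      define \<gamma> where "\<gamma> = poly (map_poly of_int p) x"
      have g: "algebraic_int \<gamma>" unfolding \<gamma>_def poly_altdef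
        by (intro algebraic_int_sum algebraic_int_add_mult)
          (auto simp: algebraic_int_of_int algebraic_int_power assms(1))
      have e: "\<gamma> * x = of_int (- a)" using pCons.prems(2)
        by (simp add: of_int_hom.map_poly_pCons_hom \<gamma>_def mult.commute eq_neg_iff_add_eq_0 add.commute)
      show ?thesis
      proof (cases "a < 0")
        case True
        show ?thesis by (rule pCons.prems(3)[OF g _ e]) (use True in simp)
      next
        case False
        have "- \<gamma> * x = of_int a" using e by (metis minus_mult_left minus_minus of_int_minus)
        moreover have "algebraic_int (- \<gamma>)" using g by auto
        ultimately show ?thesis using False \<open>a \<noteq> 0\<close> by (intro pCons.prems(3)[of "-\<gamma>" a]) auto
      qed
    qed
  qed simp
qed

section \<open>The embeddings of a number field into \<open>\<complex>\<close>\<close>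

definition embeddings :: "('f::field_char_0 \<Rightarrow> complex) set" where
  "embeddings = {\<sigma>. field_hom \<sigma>}"

definition rat_linear :: "('f::field_char_0 \<Rightarrow> complex) \<Rightarrow> bool" where
  "rat_linear \<mu> \<longleftrightarrow> (\<forall>x y. \<mu> (x + y) = \<mu> x + \<mu> y) \<and> (\<forall>q x. \<mu> (of_rat q * x) = of_rat q * \<mu> x)"

text \<open>The embeddings are counted inside this complex vector space: they turn out to be a basis
  of the subspace of rationally linear functionals.\<close>

global_interpretation CF: vector_space "\<lambda>c (f::'f::field_char_0 \<Rightarrow> complex) x. c * f x"
  by unfold_locales (auto simp: fun_eq_iff algebra_simps)

lemma sum_fun_apply: "(\<Sum>i\<in>I. f i) x = (\<Sum>i\<in>I. f i x)"
  by (induction I rule: infinite_finite_induct) auto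

lemma hom_of_rat:
  assumes "field_hom (\<sigma> :: 'f::field_char_0 \<Rightarrow> 'g::field_char_0)"
  shows "\<sigma> (of_rat q) = of_rat q"
proof -
  interpret field_hom \<sigma> by fact
  show ?thesis by (cases q) (simp add: of_rat_rat hom_distribs)
qed

lemma rat_linear_embedding: "field_hom \<sigma> \<Longrightarrow> rat_linear \<sigma>"
proof -
  assume h: "field_hom \<sigma>"
  interpret field_hom \<sigma> by fact
  show ?thesis by (simp add: rat_linear_def hom_distribs hom_of_rat[OF h])
qed

lemma rat_linear_sum:
  assumes "rat_linear \<mu>"
  shows "\<mu> (\<Sum>i\<in>I. of_rat (q i) * z i) = (\<Sum>i\<in>I. of_rat (q i) * \<mu> (z i))"
proof -
  have "\<mu> 0 = of_rat 0 * \<mu> 0" using assms unfolding rat_linear_def by (metis mult_zero_left of_rat_0)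
  hence "\<mu> 0 = 0" by simp
  with assms show ?thesis
    by (induction I rule: infinite_finite_induct) (auto simp: rat_linear_def)
qed

lemma subspace_rat_linear: "CF.subspace {\<mu>. rat_linear \<mu>}"
  by (rule CF.subspaceI) (auto simp: rat_linear_def algebra_simps)

text \<open>Artin's argument: substituting \<open>y * x\<close> for \<open>x\<close> and subtracting
  \<open>\<tau> y\<close> times the original relation removes the term of \<tau>. The remaining
  coefficient of \<rho> is multiplied by \<open>\<rho> y - \<tau> y\<close>, and \<open>y\<close> is
  chosen to make this non-zero.\<close>

lemma artin_independent:
  assumes "finite S" "S \<subseteq> embeddings" "\<And>x. (\<Sum>\<sigma>\<in>S. c \<sigma> * \<sigma> x) = 0" "\<sigma> \<in> S"
  shows "c \<sigma> = 0"
  using assms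
proof (induction S arbitrary: c \<sigma> rule: finite_induct)
  case (insert \<tau> S)
  have hom: "\<rho> (x * y) = \<rho> x * \<rho> y" "\<rho> 1 = 1" if "\<rho> \<in> insert \<tau> S" for \<rho> x y
  proof -
    interpret field_hom \<rho> using that insert.prems(1) by (auto simp: embeddings_def)
    show "\<rho> (x * y) = \<rho> x * \<rho> y" "\<rho> 1 = 1" by (simp_all add: hom_distribs)
  qed
  have zero: "c \<rho> = 0" if \<rho>: "\<rho> \<in> S" for \<rho>
  proof -
    from \<rho> insert.hyps have "\<rho> \<noteq> \<tau>" by auto
    then obtain y where y: "\<rho> y \<noteq> \<tau> y" by auto
    have "(\<Sum>\<sigma>\<in>S. (c \<sigma> * (\<sigma> y - \<tau> y)) * \<sigma> x) = 0" for x
    proof -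
      have "(\<Sum>\<sigma>\<in>insert \<tau> S. c \<sigma> * \<sigma> (y * x)) - \<tau> y * (\<Sum>\<sigma>\<in>insert \<tau> S. c \<sigma> * \<sigma> x) = 0"
        using insert.prems(2) by simp
      moreover have "(\<Sum>\<sigma>\<in>insert \<tau> S. c \<sigma> * \<sigma> (y * x)) - \<tau> y * (\<Sum>\<sigma>\<in>insert \<tau> S. c \<sigma> * \<sigma> x) =
          (\<Sum>\<sigma>\<in>insert \<tau> S. (c \<sigma> * (\<sigma> y - \<tau> y)) * \<sigma> x)"
        unfolding sum_distrib_left sum_subtractf[symmetric]
        by (intro sum.cong) (auto simp: hom algebra_simps)
      ultimately show ?thesis using insert.hyps by simp
    qed
    hence "c \<rho> * (\<rho> y - \<tau> y) = 0" using insert.IH[of "\<lambda>\<sigma>. c \<sigma> * (\<sigma> y - \<tau> y)"] insert.prems(1) \<rho> by auto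
    thus ?thesis using y by simp
  qed
  have "c \<tau> * \<tau> 1 + (\<Sum>\<sigma>\<in>S. c \<sigma> * \<sigma> 1) = 0" using insert.prems(2)[of 1] insert.hyps by simp
  hence "c \<tau> = 0" using zero hom(2)[of \<tau>] by simp
  with zero insert.prems(3) show ?case by auto
qed simp

lemma independent_embeddings: "\<not> CF.dependent embeddings"
  unfolding CF.independent_explicit_finite_subsets
proof (intro allI impI ballI)
  fix S u \<sigma> assume S: "S \<subseteq> embeddings" "finite S" "(\<Sum>v\<in>S. (\<lambda>x. u v * v x)) = 0" "\<sigma> \<in> S"
  have "(\<Sum>\<sigma>\<in>S. u \<sigma> * \<sigma> x) = 0" for x
    using fun_cong[OF S(3), of x] by (simp add: sum_fun_apply)
  from artin_independent[OF S(2,1) this S(4)] show "u \<sigma> = 0" .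
qed

text \<open>The functionals \<open>\<mu>\<close> on \<open>F\<close> form an \<open>F\<close>-module via \<open>(x \<cdot> \<mu>)(y) = \<mu>(xy)\<close>, and each \<open>x\<close> acts
  diagonalizably since its minimal polynomial is separable. The joint eigenvectors are the
  multiples of the embeddings.\<close>

definition shift :: "'f::field_char_0 \<Rightarrow> complex \<Rightarrow> ('f \<Rightarrow> complex) \<Rightarrow> 'f \<Rightarrow> complex" where
  "shift x a \<mu> = (\<lambda>y. \<mu> (x * y) - a * \<mu> y)"

text \<open>The polynomial \<open>f\<close> evaluated at the operator that sends \<mu> to the
  functional \<open>y \<mapsto> \<mu> (x * y)\<close>.\<close>

definition poly_act :: "'f::field_char_0 \<Rightarrow> complex poly \<Rightarrow> ('f \<Rightarrow> complex) \<Rightarrow> 'f \<Rightarrow> complex" where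
  "poly_act x f \<mu> = (\<lambda>y. \<Sum>k\<le>degree f. coeff f k * \<mu> (x ^ k * y))"

lemma poly_act_bound:
  assumes "degree f \<le> N"
  shows "poly_act x f \<mu> y = (\<Sum>k\<le>N. coeff f k * \<mu> (x ^ k * y))"
  unfolding poly_act_def using assms
  by (intro sum.mono_neutral_left) (auto simp: coeff_eq_0)

lemma poly_act_linear_factor: "poly_act x ([:- a, 1:] * f) \<mu> = poly_act x f (shift x a \<mu>)"
proof
  fix y
  let ?d = "degree f"
  have eq: "[:- a, 1:] * f = pCons 0 f - Polynomial.smult a f" by simp
  have "degree ([:- a, 1:] * f) \<le> Suc ?d"
    using degree_mult_le[of "[:- a, 1:]" f] by simp
  from poly_act_bound[OF this]
  have "poly_act x ([:- a, 1:] * f) \<mu> y =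
      (\<Sum>k\<le>Suc ?d. coeff (pCons 0 f) k * \<mu> (x ^ k * y)) - (\<Sum>k\<le>Suc ?d. a * coeff f k * \<mu> (x ^ k * y))"
    unfolding eq by (simp only: coeff_diff coeff_smult left_diff_distrib sum_subtractf)
  also have "(\<Sum>k\<le>Suc ?d. coeff (pCons 0 f) k * \<mu> (x ^ k * y)) = (\<Sum>k\<le>?d. coeff f k * \<mu> (x ^ Suc k * y))"
    by (simp only: sum.atMost_Suc_shift) simp
  also have "(\<Sum>k\<le>Suc ?d. a * coeff f k * \<mu> (x ^ k * y)) = (\<Sum>k\<le>?d. a * coeff f k * \<mu> (x ^ k * y))"
    by (simp add: coeff_eq_0)
  also have "(\<Sum>k\<le>?d. coeff f k * \<mu> (x ^ Suc k * y)) - (\<Sum>k\<le>?d. a * coeff f k * \<mu> (x ^ k * y)) =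
      poly_act x f (shift x a \<mu>) y"
    unfolding poly_act_def shift_def sum_subtractf[symmetric]
    by (intro sum.cong) (auto simp: algebra_simps)
  finally show "poly_act x ([:- a, 1:] * f) \<mu> y = poly_act x f (shift x a \<mu>) y" .
qed

lemma poly_act_prod_list: "poly_act x (\<Prod>r\<leftarrow>rs. [:- r, 1:]) \<mu> = fold (shift x) rs \<mu>"
proof (induction rs arbitrary: \<mu>)
  case Nil
  show ?case by (simp add: poly_act_def)
next
  case (Cons r rs)
  have "poly_act x (\<Prod>r\<leftarrow>r # rs. [:- r, 1:]) \<mu> = poly_act x ([:- r, 1:] * (\<Prod>r\<leftarrow>rs. [:- r, 1:])) \<mu>"
    by (simp only: list.map prod_list.Cons)
  thus ?case by (simp only: poly_act_linear_factor Cons fold_Cons comp_apply)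
qed

text \<open>With rational coefficients the polynomial can be moved inside \<mu>, where its value at
  \<open>x\<close> appears as a factor.\<close>

lemma poly_act_rat:
  assumes "rat_linear \<mu>" "poly (map_poly of_rat p) x = 0"
  shows "poly_act x (map_poly of_rat p) \<mu> y = 0"
proof -
  have "poly_act x (map_poly of_rat p) \<mu> y = (\<Sum>k\<le>degree p. of_rat (coeff p k) * \<mu> (x ^ k * y))"
    by (simp add: poly_act_def)
  also have "\<dots> = \<mu> (\<Sum>k\<le>degree p. of_rat (coeff p k) * (x ^ k * y))"
    by (rule rat_linear_sum[OF assms(1), symmetric])
  also have "(\<Sum>k\<le>degree p. of_rat (coeff p k) * (x ^ k * y)) = poly (map_poly of_rat p) x * y"
    by (simp add: poly_altdef sum_distrib_right mult.assoc)
  also have "\<mu> \<dots> = 0" using assms(2) rat_linear_sum[OF assms(1), of "\<lambda>_. 0" "\<lambda>_. 0" "{}"] by simp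
  finally show ?thesis .
qed

text \<open>Induction on the roots. The shift by \<open>r\<close> sends \<mu> into the sum of the
  eigenspaces of the other roots, and it is surjective on that sum; so \<mu> agrees with some
  \<kappa> from the sum up to an element killed by the shift, that is, an eigenvector for
  \<open>r\<close>. The invariant space \<open>W\<close> lets eigenvalues of other field elements be
  kept fixed.\<close>

lemma eigen_decomposition:
  assumes "distinct rs" "CF.subspace W" "\<And>\<mu>. \<mu> \<in> W \<Longrightarrow> (\<lambda>y. \<mu> (x * y)) \<in> W"
    "\<mu> \<in> W" "fold (shift x) rs \<mu> = 0"
  shows "\<mu> \<in> CF.span {\<nu> \<in> W. \<exists>a\<in>set rs. \<forall>y. \<nu> (x * y) = a * \<nu> y}"
  using assms(1,4,5)
proof (induction rs arbitrary: \<mu>)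
  case Nil
  show ?case using Nil.prems(3) by (simp only: fold_simps(1) CF.span_zero)
next
  case (Cons r rs)
  let ?G = "\<lambda>rs. {\<nu> \<in> W. \<exists>a\<in>set rs. \<forall>y. \<nu> (x * y) = a * \<nu> y}"
  have shiftW: "shift x r \<mu> \<in> W"
  proof -
    have "shift x r \<mu> = (\<lambda>y. \<mu> (x * y)) - (\<lambda>y. r * \<mu> y)" by (auto simp: shift_def)
    thus ?thesis using assms(3) Cons.prems(2) CF.subspace_diff[OF assms(2)] CF.subspace_scale[OF assms(2)]
      by metis
  qed
  have GW: "CF.span (?G rs) \<subseteq> W" by (rule CF.span_minimal[OF _ assms(2)]) auto
  have "shift x r \<mu> \<in> CF.span (?G rs)" using Cons shiftW by auto
  moreover have "\<exists>\<kappa>\<in>CF.span (?G rs). shift x r \<kappa> = \<nu>" if "\<nu> \<in> CF.span (?G rs)" for \<nu>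
    using that
  proof (induction rule: CF.span_induct)
    case base
    have "CF.subspace {\<nu>. \<exists>\<kappa>\<in>CF.span (?G rs). shift x r \<kappa> = \<nu>}"
    proof (rule CF.subspaceI)
      show "0 \<in> {\<nu>. \<exists>\<kappa>\<in>CF.span (?G rs). shift x r \<kappa> = \<nu>}"
        by (auto intro!: bexI[of _ 0] CF.span_zero simp: shift_def)
    next
      fix \<nu> \<nu>' assume "\<nu> \<in> {\<nu>. \<exists>\<kappa>\<in>CF.span (?G rs). shift x r \<kappa> = \<nu>}" "\<nu>' \<in> {\<nu>. \<exists>\<kappa>\<in>CF.span (?G rs). shift x r \<kappa> = \<nu>}"
      then obtain \<kappa> \<kappa>' where k: "\<kappa> \<in> CF.span (?G rs)" "shift x r \<kappa> = \<nu>" "\<kappa>' \<in> CF.span (?G rs)" "shift x r \<kappa>' = \<nu>'"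
        by auto
      have "shift x r (\<kappa> + \<kappa>') = \<nu> + \<nu>'" unfolding k(2)[symmetric] k(4)[symmetric]
        by (auto simp: shift_def algebra_simps)
      thus "\<nu> + \<nu>' \<in> {\<nu>. \<exists>\<kappa>\<in>CF.span (?G rs). shift x r \<kappa> = \<nu>}" using CF.span_add[OF k(1,3)] by blast
    next
      fix c \<nu> assume "\<nu> \<in> {\<nu>. \<exists>\<kappa>\<in>CF.span (?G rs). shift x r \<kappa> = \<nu>}"
      then obtain \<kappa> where k: "\<kappa> \<in> CF.span (?G rs)" "shift x r \<kappa> = \<nu>" by auto
      have "shift x r (\<lambda>x. c * \<kappa> x) = (\<lambda>x. c * \<nu> x)" unfolding k(2)[symmetric]
        by (auto simp: shift_def algebra_simps)
      thus "(\<lambda>x. c * \<nu> x) \<in> {\<nu>. \<exists>\<kappa>\<in>CF.span (?G rs). shift x r \<kappa> = \<nu>}" using CF.span_scale[OF k(1)] by blast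
    qed
    thus ?case by simp
  next
    case (step \<nu>)
    then obtain b where b: "b \<in> set rs" "\<nu> \<in> W" "\<And>y. \<nu> (x * y) = b * \<nu> y" by auto
    have br: "b - r \<noteq> 0" using b(1) Cons.prems(1) by auto
    \<comment> \<open>On the eigenspace of \<open>b\<close> the shift is multiplication by
      \<open>b - r\<close>, which is invertible since the roots are distinct.\<close>
    have "shift x r (\<lambda>y. inverse (b - r) * \<nu> y) = \<nu>"
    proof
      fix y
      have "inverse (b - r) * (b * z) - r * (inverse (b - r) * z) = (inverse (b - r) * (b - r)) * z" for z
        by (simp add: algebra_simps)
      thus "shift x r (\<lambda>y. inverse (b - r) * \<nu> y) y = \<nu> y"
        using br by (simp add: shift_def b(3))
    qed
    moreover have "(\<lambda>y. inverse (b - r) * \<nu> y) \<in> CF.span (?G rs)"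
      using b by (intro CF.span_scale CF.span_base) auto
    ultimately show ?case by blast
  qed
  ultimately obtain \<kappa> where k: "\<kappa> \<in> CF.span (?G rs)" "shift x r \<kappa> = shift x r \<mu>" by blast
  have "\<mu> - \<kappa> \<in> W" using k(1) GW Cons.prems(2) CF.subspace_diff[OF assms(2)] by blast
  moreover have "(\<mu> - \<kappa>) (x * y) = r * (\<mu> - \<kappa>) y" for y
    using fun_cong[OF k(2), of y] by (simp add: shift_def algebra_simps)
  ultimately have "\<mu> - \<kappa> \<in> ?G (r # rs)" by auto
  hence "\<mu> - \<kappa> \<in> CF.span (?G (r # rs))" by (rule CF.span_base)
  moreover have "\<kappa> \<in> CF.span (?G (r # rs))"
    using k(1) CF.span_mono[of "?G rs" "?G (r # rs)"] by auto
  ultimately have "(\<mu> - \<kappa>) + \<kappa> \<in> CF.span (?G (r # rs))" by (rule CF.span_add)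
  thus ?case by simp
qed

section \<open>Separable rational polynomials and their complex roots\<close>

lemma number_field_basis:
  assumes "number_field TYPE('f::field_char_0)"
  obtains B :: "'f::field_char_0 set" where "finite B" "\<not> F.dependent B" "F.span B = UNIV"
proof -
  obtain B :: "'f set" where B: "finite B" "F.span B = UNIV" using assms by (auto simp: number_field_def)
  obtain C where C: "C \<subseteq> B" "\<not> F.dependent C" "B \<subseteq> F.span C"
    using F.maximal_independent_subset[of B] by auto
  have "F.span C = UNIV" using B(2) C(3) F.span_minimal[OF C(3) F.subspace_span] by auto
  thus ?thesis using that C B finite_subset by blast
qed

text \<open>A polynomial of least degree among those vanishing at \<open>x\<close> is taken. A
  non-trivial common factor with the derivative would split it into two factors of smaller degree,
  one of which vanishes at \<open>x\<close>.\<close>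

lemma number_field_separable:
  assumes "number_field TYPE('f::field_char_0)"
  obtains p :: "rat poly" where "p \<noteq> 0" "poly (map_poly of_rat p) (x :: 'f::field_char_0) = 0" "gcd p (pderiv p) = 1"
proof -
  obtain B :: "'f set" where B: "finite B" "\<not> F.dependent B" "F.span B = UNIV"
    using number_field_basis[OF assms] .
  have "\<exists>p :: rat poly. p \<noteq> 0 \<and> poly (map_poly of_rat p) x = 0"
  \<comment> \<open>If two powers coincide, the set of powers may be too small for the dimension
    count, but then the difference of the two monomials already vanishes at
    \<open>x\<close>.\<close>
  proof (cases "inj_on (\<lambda>i. x ^ i) {..card B}")
    case True
    let ?S = "(\<lambda>i. x ^ i) ` {..card B}"
    have "F.dependent ?S"
    proof (rule ccontr)
      assume "\<not> F.dependent ?S"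
      from F.independent_span_bound[OF B(1) this] have "card ?S \<le> card B" using B(3) by auto
      thus False using card_image[OF True] by simp
    qed
    then obtain u where u: "\<exists>v\<in>?S. u v \<noteq> 0" "(\<Sum>v\<in>?S. of_rat (u v) * v) = 0"
      by (auto simp: F.dependent_finite)
    define p where "p = (\<Sum>i\<le>card B. Polynomial.monom (u (x ^ i)) i)"
    have c: "coeff p i = u (x ^ i)" if "i \<le> card B" for i
      using that by (simp add: p_def coeff_sum)
    have "p \<noteq> 0" using u(1) c by (metis (no_types, lifting) atMost_iff coeff_0 imageE)
    moreover have "degree p \<le> card B" unfolding p_def
      by (intro degree_sum_le) (auto intro: order.trans[OF degree_monom_le])
    hence "poly (map_poly of_rat p) x = (\<Sum>i\<le>card B. of_rat (coeff p i) * x ^ i)"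
      by (simp add: poly_altdef) (intro sum.mono_neutral_left, auto simp: coeff_eq_0)
    hence "poly (map_poly of_rat p) x = (\<Sum>i\<le>card B. of_rat (u (x ^ i)) * x ^ i)"
      using c by simp
    hence "poly (map_poly of_rat p) x = 0" using u(2) by (simp add: sum.reindex[OF True])
    ultimately show ?thesis by blast
  next
    case False
    then obtain i j where ij: "i < j" "x ^ i = x ^ j"
      unfolding inj_on_def by (metis linorder_neqE_nat)
    let ?p = "Polynomial.monom (1::rat) j - Polynomial.monom 1 i"
    have "coeff ?p j = 1" using ij by simp
    hence "?p \<noteq> 0" by (metis coeff_0 zero_neq_one)
    moreover have "map_poly of_rat ?p = Polynomial.monom (1 :: 'f) j - Polynomial.monom 1 i"
      by (intro poly_eqI) (simp add: coeff_map_poly of_rat_diff)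
    hence "poly (map_poly of_rat ?p) x = 0" using ij(2) by (simp add: poly_monom)
    ultimately show ?thesis by blast
  qed
  moreover define R where "R q \<longleftrightarrow> q \<noteq> 0 \<and> poly (map_poly of_rat q) x = 0" for q :: "rat poly"
  ultimately obtain p0 where "R p0" by blast
  from ex_has_least_nat[of R, OF this, of degree] obtain p where "R p" "\<And>q. R q \<Longrightarrow> degree p \<le> degree q"
    by blast
  hence p: "p \<noteq> 0" "poly (map_poly of_rat p) x = 0"
    and pmin: "\<And>q. q \<noteq> 0 \<Longrightarrow> poly (map_poly of_rat q) x = 0 \<Longrightarrow> degree p \<le> degree q"
    by (auto simp: R_def)
  have dp: "degree p > 0"
  proof (rule ccontr)
    assume "\<not> degree p > 0"
    then obtain a where "p = [:a:]" using degree_eq_zeroE by blast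
    with p show False by simp
  qed
  have "gcd p (pderiv p) = 1"
  proof (rule ccontr)
    let ?g = "gcd p (pderiv p)"
    assume g1: "?g \<noteq> 1"
    have g0: "?g \<noteq> 0" using p by simp
    have "degree ?g \<noteq> 0"
    proof
      assume "degree ?g = 0"
      hence "is_unit ?g" using is_unit_iff_degree[OF g0] by blast
      thus False using g1 is_unit_gcd_iff by blast
    qed
    have "pderiv p \<noteq> 0" using dp by (simp add: pderiv_eq_0_iff)
    hence "degree ?g \<le> degree (pderiv p)" by (intro dvd_imp_degree_le) auto
    hence gl: "degree ?g < degree p" using dp by (simp add: degree_pderiv)
    obtain h where h: "p = ?g * h" by (meson dvdE gcd_dvd1)
    have "h \<noteq> 0" using h p(1) by auto
    hence "degree p = degree ?g + degree h" using h g0 by (metis degree_mult_eq)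
    hence hl: "degree h < degree p" using \<open>degree ?g \<noteq> 0\<close> by simp
    interpret mp: map_poly_comm_ring_hom "of_rat :: rat \<Rightarrow> 'f" ..
    have "map_poly of_rat p = (map_poly of_rat ?g * map_poly of_rat h :: 'f poly)"
      by (subst h) (rule mp.hom_mult)
    hence "poly (map_poly of_rat ?g) x * poly (map_poly of_rat h) x = 0"
      using p(2) by simp
    hence "poly (map_poly of_rat ?g) x = 0 \<or> poly (map_poly of_rat h) x = 0" by simp
    thus False
    proof
      assume "poly (map_poly of_rat ?g) x = 0"
      from pmin[OF g0 this] gl show False by (meson leD)
    next
      assume "poly (map_poly of_rat h) x = 0"
      from pmin[OF \<open>h \<noteq> 0\<close> this] hl show False by (meson leD)
    qed
  qed
  with p show ?thesis by (rule that)
qed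

lemma number_field_algebraic:
  assumes "number_field TYPE('f::field_char_0)"
  shows "algebraic (x :: 'f::field_char_0)"
proof -
  obtain p :: "rat poly" where p: "p \<noteq> 0" "poly (map_poly of_rat p) x = 0"
    using number_field_separable[OF assms, of x] .
  show ?thesis
  proof (rule algebraicI')
    show "map_poly of_rat p \<noteq> (0 :: 'f poly)" using p(1) by simp
    show "coeff (map_poly of_rat p) i \<in> (\<rat> :: 'f set)" for i by simp
  qed (use p in simp)
qed

lemma separable_distinct_roots:
  fixes P :: "complex poly"
  assumes "P \<noteq> 0" "gcd P (pderiv P) = 1"
  obtains c rs where "c \<noteq> 0" "P = Polynomial.smult c (\<Prod>r\<leftarrow>rs. [:- r, 1:])" "distinct rs"
proof -
  define l where "l = lead_coeff P"
  obtain rs where rs: "P = Polynomial.smult l (\<Prod>r\<leftarrow>rs. [:- r, 1:])"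
    using fundamental_theorem_algebra_factorized[of P] by (metis l_def)
  have "distinct rs"
  proof (rule ccontr)
    assume "\<not> distinct rs"
    then obtain xs r ys zs where d: "rs = xs @ [r] @ ys @ [r] @ zs" using not_distinct_decomp by blast
    define Q where "Q = Polynomial.smult l ((\<Prod>r\<leftarrow>xs. [:- r, 1:]) * (\<Prod>r\<leftarrow>ys. [:- r, 1:]) * (\<Prod>r\<leftarrow>zs. [:- r, 1:]))"
    have P: "P = [:- r, 1:] * ([:- r, 1:] * Q)"
      unfolding rs d Q_def
      by (simp only: map_append prod_list.append list.map prod_list.Cons prod_list.Nil mult_smult_right mult_1_right mult_1_left mult_ac)
    have "[:- r, 1:] dvd P" unfolding P by (rule dvd_triv_left)
    moreover have "[:- r, 1:] dvd pderiv P"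
    proof
      have p1: "pderiv [:- r, 1:] = 1" by (simp add: pderiv_pCons)
      show "pderiv P = [:- r, 1:] * (pderiv ([:- r, 1:] * Q) + Q)"
        unfolding P by (simp only: pderiv_mult[of "[:- r, 1:]" "[:- r, 1:] * Q"] p1 mult_1_right distrib_left)
    qed
    ultimately have "[:- r, 1:] dvd 1" using gcd_greatest assms(2) by metis
    thus False by (simp add: is_unit_iff_degree)
  qed
  with rs assms(1) show ?thesis by (intro that[of l rs]) (auto simp: l_def)
qed

text \<open>One element of the field is added at a time. The space \<open>W\<close> records the
  eigenvalues already found for \<open>X\<close>, and commutativity makes it stable under
  multiplication by \<open>x\<close>. The gcd condition carries over from the rationals to the
  complex numbers, so \<open>x\<close> acts with distinct linear factors.\<close>

lemma rat_linear_in_span_eigen: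
  assumes nf: "number_field TYPE('f::field_char_0)" and "finite X" "rat_linear (\<mu> :: 'f::field_char_0 \<Rightarrow> complex)"
  shows "\<mu> \<in> CF.span {\<nu>. rat_linear \<nu> \<and> (\<forall>x\<in>X. \<exists>a. \<forall>y. \<nu> (x * y) = a * \<nu> y)}"
  using assms(2,3)
proof (induction X arbitrary: \<mu> rule: finite_induct)
  case empty
  thus ?case by (auto intro: CF.span_base)
next
  case (insert x X)
  let ?G = "\<lambda>X. {\<nu>. rat_linear \<nu> \<and> (\<forall>x\<in>X. \<exists>a. \<forall>y. \<nu> (x * y) = a * \<nu> y)}"
  have "?G X \<subseteq> CF.span (?G (insert x X))"
  proof
    fix \<nu> assume n: "\<nu> \<in> ?G X"
    then obtain e where e: "\<And>z y. z \<in> X \<Longrightarrow> \<nu> (z * y) = e z * \<nu> y" by (auto simp: Ball_def) metis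
    define W where "W = {\<kappa>. rat_linear \<kappa> \<and> (\<forall>z\<in>X. \<forall>y. \<kappa> (z * y) = e z * \<kappa> y)}"
    have W: "CF.subspace W"
      by (rule CF.subspaceI) (auto simp: W_def rat_linear_def algebra_simps)
    have inv: "(\<lambda>y. \<kappa> (x * y)) \<in> W" if "\<kappa> \<in> W" for \<kappa>
    proof -
      have q: "x * (of_rat q * y) = of_rat q * (x * y)" for q y by (simp add: mult.left_commute)
      have "\<kappa> (x * (z * y)) = e z * \<kappa> (x * y)" if "z \<in> X" for z y
        using that \<open>\<kappa> \<in> W\<close> by (subst mult.left_commute) (simp add: W_def)
      thus ?thesis using that by (simp add: W_def rat_linear_def distrib_left q)
    qed
    have nW: "\<nu> \<in> W" using n e by (auto simp: W_def)
    obtain p :: "rat poly" where p: "p \<noteq> 0" "poly (map_poly of_rat p) x = 0" "gcd p (pderiv p) = 1"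
      using number_field_separable[OF nf, of x] .
    let ?P = "map_poly of_rat p :: complex poly"
    interpret of_rat_gcd: field_hom' "of_rat :: rat \<Rightarrow> complex" by unfold_locales
    have "gcd ?P (pderiv ?P) = map_poly of_rat (gcd p (pderiv p))"
      by (simp add: of_rat_gcd.map_poly_gcd of_rat_hom.map_poly_pderiv)
    hence "gcd ?P (pderiv ?P) = 1" using p(3) by simp
    then obtain c rs where rs: "c \<noteq> 0" "?P = Polynomial.smult c (\<Prod>r\<leftarrow>rs. [:- r, 1:])" "distinct rs"
      using separable_distinct_roots[of ?P] p(1) by auto
    have "fold (shift x) rs \<nu> y = 0" for y
    proof -
      have "0 = poly_act x ?P \<nu> y" using poly_act_rat[OF _ p(2)] n by simp
      also have "\<dots> = c * poly_act x (\<Prod>r\<leftarrow>rs. [:- r, 1:]) \<nu> y"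
        unfolding rs(2) by (simp add: poly_act_def rs(1) sum_distrib_left mult.assoc)
      finally show ?thesis using rs(1) by (simp add: poly_act_prod_list)
    qed
    hence "fold (shift x) rs \<nu> = 0" by auto
    from eigen_decomposition[OF rs(3) W inv nW this]
    show "\<nu> \<in> CF.span (?G (insert x X))"
      by (rule rev_subsetD[OF _ CF.span_mono]) (auto simp: W_def)
  qed
  hence "CF.span (?G X) \<subseteq> CF.span (?G (insert x X))"
    by (rule CF.span_minimal[OF _ CF.subspace_span])
  thus ?case using insert by blast
qed

lemma span_embeddings:
  assumes nf: "number_field TYPE('f::field_char_0)"
  shows "CF.span (embeddings :: ('f::field_char_0 \<Rightarrow> complex) set) = {\<mu>. rat_linear \<mu>}"
proof
  show "CF.span (embeddings :: ('f \<Rightarrow> complex) set) \<subseteq> {\<mu>. rat_linear \<mu>}"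
    by (rule CF.span_minimal[OF _ subspace_rat_linear]) (auto simp: embeddings_def rat_linear_embedding)
  obtain B :: "'f set" where B: "finite B" "\<not> F.dependent B" "F.span B = UNIV"
    using number_field_basis[OF nf] .
  let ?G = "{\<nu>. rat_linear \<nu> \<and> (\<forall>x\<in>B. \<exists>a. \<forall>y. \<nu> (x * y) = a * \<nu> y)}"
  have "?G \<subseteq> CF.span embeddings"
  proof
    fix \<nu> assume n: "\<nu> \<in> ?G"
    hence lin: "\<nu> (x + y) = \<nu> x + \<nu> y" "\<nu> (of_rat q * x) = of_rat q * \<nu> x" for x y q
      by (auto simp: rat_linear_def)
    have n0: "\<nu> 0 = 0" using lin(2)[of 0] by simp
    have "F.subspace {x. \<exists>a. \<forall>y. \<nu> (x * y) = a * \<nu> y}"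
    proof (rule F.subspaceI)
      show "0 \<in> {x. \<exists>a. \<forall>y. \<nu> (x * y) = a * \<nu> y}" using n0 by (auto intro!: exI[of _ 0])
    next
      fix x x' assume "x \<in> {x. \<exists>a. \<forall>y. \<nu> (x * y) = a * \<nu> y}" "x' \<in> {x. \<exists>a. \<forall>y. \<nu> (x * y) = a * \<nu> y}"
      then obtain a a' where "\<And>y. \<nu> (x * y) = a * \<nu> y" "\<And>y. \<nu> (x' * y) = a' * \<nu> y" by auto
      thus "x + x' \<in> {x. \<exists>a. \<forall>y. \<nu> (x * y) = a * \<nu> y}"
        by (auto simp: distrib_right lin intro!: exI[of _ "a + a'"])
    next
      fix q x assume "x \<in> {x. \<exists>a. \<forall>y. \<nu> (x * y) = a * \<nu> y}"
      then obtain a where "\<And>y. \<nu> (x * y) = a * \<nu> y" by auto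
      thus "of_rat q * x \<in> {x. \<exists>a. \<forall>y. \<nu> (x * y) = a * \<nu> y}"
        by (auto simp: mult.assoc lin intro!: exI[of _ "of_rat q * a"])
    qed
    from F.span_minimal[OF _ this, of B] n B(3)
    have ex: "\<exists>a. \<forall>y. \<nu> (x * y) = a * \<nu> y" for x by auto
    show "\<nu> \<in> CF.span embeddings"
    proof (cases "\<nu> 1 = 0")
      case True
      have "\<nu> x = 0" for x
      proof -
        obtain a where "\<And>y. \<nu> (x * y) = a * \<nu> y" using ex[of x] by blast
        from this[of 1] show ?thesis using True by simp
      qed
      hence "\<nu> = 0" by auto
      thus ?thesis by (simp add: CF.span_zero)
    next
      case False
      \<comment> \<open>The eigenvalue of \<open>x\<close> on \<nu> is
        \<open>\<nu> x / \<nu> 1\<close>, and eigenvalues multiply, so this normalisation turns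
        \<nu> into a ring homomorphism.\<close>
      define \<psi> where "\<psi> x = \<nu> x / \<nu> 1" for x
      have "field_hom \<psi>"
      proof
        fix x y
        show "\<psi> (x + y) = \<psi> x + \<psi> y" by (simp add: \<psi>_def lin add_divide_distrib)
        obtain a where a: "\<And>y. \<nu> (x * y) = a * \<nu> y" using ex[of x] by blast
        from a[of 1] have "\<psi> x = a" using False by (simp add: \<psi>_def)
        thus "\<psi> (x * y) = \<psi> x * \<psi> y" by (simp add: \<psi>_def a)
      qed (use False n0 in \<open>auto simp: \<psi>_def\<close>)
      hence "\<psi> \<in> CF.span embeddings" by (auto simp: embeddings_def intro: CF.span_base)
      hence "(\<lambda>x. \<nu> 1 * \<psi> x) \<in> CF.span embeddings" by (rule CF.span_scale)
      moreover have "(\<lambda>x. \<nu> 1 * \<psi> x) = \<nu>" using False by (auto simp: \<psi>_def)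
      ultimately show ?thesis by simp
    qed
  qed
  hence "CF.span ?G \<subseteq> CF.span embeddings" by (rule CF.span_minimal[OF _ CF.subspace_span])
  thus "{\<mu>. rat_linear \<mu>} \<subseteq> CF.span (embeddings :: ('f \<Rightarrow> complex) set)"
    using rat_linear_in_span_eigen[OF nf B(1)] by blast
qed

text \<open>Two independent families are compared: the embeddings and the coordinate functionals of
  a rational basis. Each lies in the span of the other, one direction being
  \<open>span_embeddings\<close>, so they have the same size.\<close>

theorem card_embeddings:
  assumes nf: "number_field TYPE('f::field_char_0)"
  shows "finite (embeddings :: ('f::field_char_0 \<Rightarrow> complex) set)"
    "card (embeddings :: ('f::field_char_0 \<Rightarrow> complex) set) = F.dim (UNIV :: 'f::field_char_0 set)"
proof -
  obtain B :: "'f set" where B: "finite B" "\<not> F.dependent B" "F.span B = UNIV"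
    using number_field_basis[OF nf] .
  define \<Lambda> :: "'f \<Rightarrow> 'f \<Rightarrow> complex" where "\<Lambda> b x = of_rat (F.representation B x b)" for b x
  have lin: "rat_linear (\<Lambda> b)" for b
    using B by (auto simp: rat_linear_def \<Lambda>_def F.representation_add F.representation_scale of_rat_add of_rat_mult)
  have eval: "\<Lambda> b c = (if b = c then 1 else 0)" if "c \<in> B" for b c
    using F.representation_basis[OF B(2) that] by (auto simp: \<Lambda>_def)
  have inj: "inj_on \<Lambda> B"
    by (rule inj_onI) (metis eval zero_neq_one)
  have indep: "\<not> CF.dependent (\<Lambda> ` B)"
  proof
    assume "CF.dependent (\<Lambda> ` B)"
    then obtain u where u: "\<exists>v\<in>\<Lambda> ` B. u v \<noteq> 0" "(\<Sum>v\<in>\<Lambda> ` B. (\<lambda>x. u v * v x)) = 0"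
      using B(1) by (auto simp: CF.dependent_finite)
    have "u (\<Lambda> c) = 0" if c: "c \<in> B" for c
    proof -
      have "0 = (\<Sum>b\<in>B. u (\<Lambda> b) * \<Lambda> b c)"
        using fun_cong[OF u(2), of c] by (simp add: sum_fun_apply sum.reindex[OF inj])
      also have "\<dots> = (\<Sum>b\<in>B. if b = c then u (\<Lambda> b) else 0)"
        by (intro sum.cong) (auto simp: eval c)
      finally show ?thesis using B(1) c by simp
    qed
    with u(1) show False by auto
  qed
  have "embeddings \<subseteq> CF.span (\<Lambda> ` B)"
  proof
    fix \<sigma> :: "'f \<Rightarrow> complex" assume "\<sigma> \<in> embeddings"
    hence s: "rat_linear \<sigma>" by (auto simp: embeddings_def rat_linear_embedding)
    have "\<sigma> = (\<Sum>b\<in>B. (\<lambda>x. \<sigma> b * \<Lambda> b x))"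
    proof
      fix x
      have "x = (\<Sum>b\<in>B. of_rat (F.representation B x b) * b)"
        using F.sum_representation_eq[OF B(2) _ B(1) subset_refl, of x] B(3) by simp
      hence "\<sigma> x = (\<Sum>b\<in>B. of_rat (F.representation B x b) * \<sigma> b)"
        using rat_linear_sum[OF s, of "F.representation B x" "\<lambda>b. b" B] by simp
      thus "\<sigma> x = (\<Sum>b\<in>B. (\<lambda>x. \<sigma> b * \<Lambda> b x)) x" by (simp add: sum_fun_apply \<Lambda>_def mult.commute)
    qed
    also have "\<dots> \<in> CF.span (\<Lambda> ` B)" by (intro CF.span_sum CF.span_scale CF.span_base) auto
    finally show "\<sigma> \<in> CF.span (\<Lambda> ` B)" .
  qed
  from CF.independent_span_bound[OF _ independent_embeddings this] B(1)
  have 1: "finite (embeddings :: ('f \<Rightarrow> complex) set)" "card (embeddings :: ('f \<Rightarrow> complex) set) \<le> card (\<Lambda> ` B)" by auto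
  have "\<Lambda> ` B \<subseteq> CF.span embeddings" unfolding span_embeddings[OF nf] using lin by auto
  from CF.independent_span_bound[OF 1(1) indep this] 1(2)
  have "card (embeddings :: ('f \<Rightarrow> complex) set) = card (\<Lambda> ` B)" by simp
  also have "\<dots> = card B" by (rule card_image[OF inj])
  also have "\<dots> = F.dim (UNIV :: 'f set)" using F.basis_card_eq_dim[of B UNIV] B by auto
  finally show "card (embeddings :: ('f \<Rightarrow> complex) set) = F.dim (UNIV :: 'f set)" .
  show "finite (embeddings :: ('f \<Rightarrow> complex) set)" by (rule 1)
qed

lemma independent_spans:
  assumes nf: "number_field TYPE('f::field_char_0)"
    and "\<not> F.dependent (S :: 'f::field_char_0 set)" "card S = F.dim (UNIV :: 'f::field_char_0 set)"
  shows "F.span S = UNIV"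
proof -
  obtain B :: "'f set" where B: "finite B" "\<not> F.dependent B" "F.span B = UNIV"
    using number_field_basis[OF nf] .
  interpret fd: finite_dimensional_vector_space "\<lambda>q (x::'f). of_rat q * x" B
    by unfold_locales (use B in auto)
  show ?thesis using fd.card_ge_dim_independent[of S UNIV] assms by auto
qed

lemma spanning_independent:
  assumes nf: "number_field TYPE('f::field_char_0)"
    and "finite S" "F.span (S :: 'f::field_char_0 set) = UNIV" "card S \<le> F.dim (UNIV :: 'f::field_char_0 set)"
  shows "\<not> F.dependent S"
proof -
  obtain B :: "'f set" where B: "finite B" "\<not> F.dependent B" "F.span B = UNIV"
    using number_field_basis[OF nf] .
  interpret fd: finite_dimensional_vector_space "\<lambda>q (x::'f). of_rat q * x" B
    by unfold_locales (use B in auto)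
  show ?thesis using fd.card_le_dim_spanning[of S UNIV] assms by auto
qed

definition emb_mat :: "('f \<Rightarrow> complex) list \<Rightarrow> 'f list \<Rightarrow> complex mat" where
  "emb_mat \<sigma>s ws = Matrix.mat (length \<sigma>s) (length ws) (\<lambda>(i, j). (\<sigma>s ! i) (ws ! j))"

text \<open>A kernel vector of the transpose is a complex relation between the embeddings that holds
  on \<open>ws\<close>, hence on its rational span, which is the whole field. This contradicts
  \<open>artin_independent\<close>.\<close>

lemma emb_mat_det_nonzero:
  assumes "distinct \<sigma>s" "set \<sigma>s = (embeddings :: ('f::field_char_0 \<Rightarrow> complex) set)"
    "length ws = length \<sigma>s" "F.span (set ws) = UNIV"
  shows "Determinant.det (emb_mat \<sigma>s ws) \<noteq> 0"
proof
  let ?n = "length \<sigma>s"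
  let ?M = "emb_mat \<sigma>s ws"
  have M: "?M \<in> carrier_mat ?n ?n" using assms(3) by (simp add: emb_mat_def)
  assume "Determinant.det ?M = 0"
  hence "Determinant.det (transpose_mat ?M) = 0" using Determinant.det_transpose[OF M] by simp
  then obtain v where v: "v \<in> carrier_vec ?n" "v \<noteq> 0\<^sub>v ?n" "transpose_mat ?M *\<^sub>v v = 0\<^sub>v ?n"
    using det_0_iff_vec_prod_zero_field[of "transpose_mat ?M" ?n] M by auto
  have col: "(\<Sum>i<?n. vec_index v i * (\<sigma>s ! i) (ws ! j)) = 0" if j: "j < ?n" for j
  proof -
    have "vec_index (transpose_mat ?M *\<^sub>v v) j = (\<Sum>i<?n. (\<sigma>s ! i) (ws ! j) * vec_index v i)"
      using j v(1) assms(3) by (auto simp: emb_mat_def scalar_prod_def atLeast0LessThan intro!: sum.cong)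
    moreover have "vec_index (transpose_mat ?M *\<^sub>v v) j = 0" unfolding v(3) using j by simp
    ultimately show ?thesis by (simp only: mult.commute)
  qed
  let ?Z = "{x. (\<Sum>i<?n. vec_index v i * (\<sigma>s ! i) x) = 0}"
  have lin: "rat_linear (\<sigma>s ! i)" if "i < ?n" for i
    using that assms(2) nth_mem[OF that] by (auto simp: embeddings_def rat_linear_embedding)
  have "F.subspace ?Z"
  proof (rule F.subspaceI)
    show "0 \<in> ?Z" using rat_linear_sum[OF lin, of _ "\<lambda>_. 0" "\<lambda>_. 0" "{}"] by simp
  next
    fix x y assume "x \<in> ?Z" "y \<in> ?Z"
    moreover have "(\<Sum>i<?n. vec_index v i * (\<sigma>s ! i) (x + y)) =
      (\<Sum>i<?n. vec_index v i * (\<sigma>s ! i) x) + (\<Sum>i<?n. vec_index v i * (\<sigma>s ! i) y)"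
      unfolding sum.distrib[symmetric] using lin by (intro sum.cong) (auto simp: rat_linear_def algebra_simps)
    ultimately show "x + y \<in> ?Z" by simp
  next
    fix q x assume "x \<in> ?Z"
    moreover have "(\<Sum>i<?n. vec_index v i * (\<sigma>s ! i) (of_rat q * x)) =
      of_rat q * (\<Sum>i<?n. vec_index v i * (\<sigma>s ! i) x)"
      unfolding sum_distrib_left using lin by (intro sum.cong) (auto simp: rat_linear_def algebra_simps)
    ultimately show "of_rat q * x \<in> ?Z" by simp
  qed
  moreover have "set ws \<subseteq> ?Z" using col assms(3) by (auto simp: in_set_conv_nth)
  ultimately have Z: "(\<Sum>i<?n. vec_index v i * (\<sigma>s ! i) x) = 0" for x
    using F.span_minimal[of "set ws" ?Z] assms(4) by auto
  have injs: "inj_on ((!) \<sigma>s) {..<?n}" using assms(1) by (auto simp: inj_on_def distinct_conv_nth)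
  define c where "c \<sigma> = vec_index v (the_inv_into {..<?n} ((!) \<sigma>s) \<sigma>)" for \<sigma>
  have c: "c (\<sigma>s ! i) = vec_index v i" if "i < ?n" for i
    using the_inv_into_f_f[OF injs, of i] that by (simp add: c_def)
  have "(\<Sum>\<sigma>\<in>set \<sigma>s. c \<sigma> * \<sigma> x) = 0" for x
  proof -
    have "(\<Sum>\<sigma>\<in>set \<sigma>s. c \<sigma> * \<sigma> x) = (\<Sum>i<?n. c (\<sigma>s ! i) * (\<sigma>s ! i) x)"
      using sum.reindex_bij_betw[OF bij_betw_nth[OF assms(1) refl refl], of "\<lambda>\<sigma>. c \<sigma> * \<sigma> x"] by simp
    also have "\<dots> = 0" using Z[of x] by (simp add: c)
    finally show ?thesis .
  qed
  from artin_independent[OF finite_set _ this] assms(2) have "c \<sigma> = 0" if "\<sigma> \<in> set \<sigma>s" for \<sigma>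
    using that by auto
  hence "vec_index v i = 0" if "i < ?n" for i using c[OF that] that by auto
  hence "v = 0\<^sub>v ?n" using v(1) by (intro eq_vecI) auto
  with v(2) show False by simp
qed

section \<open>Volumes of fractional ideals\<close>

context rat_space
begin

lemma independent_zindep:
  assumes "distinct bs" "\<not> dependent (set bs)"
  shows "zindep bs"
  unfolding zindep_iff
proof (intro conjI notI)
  assume "Z.dependent (set bs)"
  then obtain u where u: "\<exists>v\<in>set bs. u v \<noteq> 0" "(\<Sum>v\<in>set bs. zs (u v) v) = 0"
    by (auto simp: Z.dependent_finite)
  hence "(\<Sum>v\<in>set bs. scale (of_int (u v)) v) = 0" by (simp add: zs_eq)
  with u(1) have "dependent (set bs)" unfolding dependent_finite[OF finite_set]
    by (intro exI[of _ "\<lambda>v. of_int (u v)"]) auto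
  with assms(2) show False by simp
qed (rule assms)

lemma zbasis_transversal:
  assumes "zbasis L bs" "zbasis L' cs" "L' \<subseteq> L" "length bs = length cs"
  obtains T where "finite T" "transversal L L' T"
proof -
  have "zindep bs" "L' \<subseteq> range (\<lambda>c. zcomb c bs)" using assms by (auto simp: zbasis_def)
  from subgroup_hermite_basis[OF this(1) zbasis_subspace[OF assms(2)] this(2)] obtain cs0 where
    "zbasis L' cs0" "length cs0 = length bs \<longrightarrow> (\<exists>T. finite T \<and> transversal (range (\<lambda>c. zcomb c bs)) L' T)"
    by blast
  moreover from this(1) have "length cs0 = length cs" using zbasis_length assms(2) by metis
  ultimately show ?thesis using that assms(1,4) by (auto simp: zbasis_def)
qed

end

lemma ring_of_integers_simps:
  "(0 :: 'f::field_char_0) \<in> \<O>" "(1 :: 'f::field_char_0) \<in> \<O>" "of_int k \<in> (\<O> :: 'f::field_char_0 set)"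
  "x \<in> \<O> \<Longrightarrow> y \<in> \<O> \<Longrightarrow> x + y \<in> (\<O> :: 'f::field_char_0 set)"
  "x \<in> \<O> \<Longrightarrow> y \<in> \<O> \<Longrightarrow> x * y \<in> (\<O> :: 'f::field_char_0 set)"
  "x \<in> \<O> \<Longrightarrow> - x \<in> (\<O> :: 'f::field_char_0 set)"
  "x \<in> \<O> \<Longrightarrow> x ^ m \<in> (\<O> :: 'f::field_char_0 set)"
  unfolding ring_of_integers_def mem_Collect_eq
  by (fact algebraic_int_0 algebraic_int_1 algebraic_int_of_int algebraic_int_add_mult
      algebraic_int_minus algebraic_int_power)+

lemma subspace_ring_of_integers: "F.Z.subspace (\<O> :: 'f::field_char_0 set)"
  by (rule F.Z.subspaceI) (auto intro: ring_of_integers_simps)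

lemma OF_submodule_subspace: "OF_submodule (*) I \<Longrightarrow> F.Z.subspace (I :: 'f::field_char_0 set)"
  by (rule F.Z.subspaceI) (auto simp: OF_submodule_def intro: ring_of_integers_simps)

lemma fractional_ideal_subspace: "fractional_ideal I \<Longrightarrow> F.Z.subspace (I :: 'f::field_char_0 set)"
  by (auto simp: fractional_ideal_def OF_submodule_subspace)

lemma fractional_ideal_ring_of_integers: "fractional_ideal (\<O> :: 'f::field_char_0 set)"
  unfolding fractional_ideal_def
proof (intro conjI bexI[of _ 1])
  show "OF_submodule (*) (\<O> :: 'f set)"
    by (simp add: OF_submodule_def ring_of_integers_simps(1,4,5))
  show "\<O> \<noteq> {0 :: 'f}" using ring_of_integers_simps(2) by (metis singletonD zero_neq_one)
qed (simp_all add: ring_of_integers_simps(2))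

lemma zbasis_scale:
  assumes "F.zbasis I bs" "(d :: 'f::field_char_0) \<noteq> 0"
  shows "F.zbasis ((*) d ` I) (map ((*) d) bs)"
proof -
  have z: "F.zcomb c (map ((*) d) bs) = d * F.zcomb c bs" for c
    by (simp add: F.zcomb_def sum_distrib_left mult.left_commute)
  have "F.zindep (map ((*) d) bs)"
    using assms unfolding F.zbasis_def F.zindep_def by (simp add: z)
  thus ?thesis using assms(1) unfolding F.zbasis_def by (auto simp: z)
qed

lemma emb_mat_coords:
  assumes "A \<in> carrier_mat (length bs) (length cs)"
    "\<And>j. j < length cs \<Longrightarrow> cs ! j = F.zcomb (\<lambda>i. A $$ (i, j)) bs"
    "set \<sigma>s \<subseteq> embeddings"
  shows "emb_mat \<sigma>s cs = emb_mat \<sigma>s bs * map_mat of_int A"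
proof (rule eq_matI)
  fix i j assume "i < dim_row (emb_mat \<sigma>s bs * map_mat of_int A)" "j < dim_col (emb_mat \<sigma>s bs * map_mat of_int A)"
  hence i: "i < length \<sigma>s" and j: "j < length cs" using assms(1) by (auto simp: emb_mat_def)
  interpret field_hom "\<sigma>s ! i" using nth_mem[OF i] assms(3) by (auto simp: embeddings_def)
  have "emb_mat \<sigma>s cs $$ (i, j) = (\<sigma>s ! i) (\<Sum>k<length bs. of_int (A $$ (k, j)) * bs ! k)"
    using i j by (simp add: emb_mat_def assms(2) F.zcomb_def)
  also have "\<dots> = (\<Sum>k<length bs. (\<sigma>s ! i) (bs ! k) * of_int (A $$ (k, j)))"
    by (simp add: hom_distribs) (simp add: mult.commute)
  also have "\<dots> = (emb_mat \<sigma>s bs * map_mat of_int A) $$ (i, j)"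
    using i j assms(1) by (simp add: emb_mat_def scalar_prod_def atLeast0LessThan)
  finally show "emb_mat \<sigma>s cs $$ (i, j) = (emb_mat \<sigma>s bs * map_mat of_int A) $$ (i, j)" .
qed (use assms(1) in \<open>auto simp: emb_mat_def\<close>)

section \<open>Volumes from the embeddings, and the integral basis\<close>

locale num_field =
  fixes ty :: "'f::field_char_0 itself"
  assumes nf: "number_field TYPE('f)"
begin

definition deg :: nat where "deg = F.dim (UNIV :: 'f set)"

text \<open>The choice made inside \<open>discriminant\<close>, repeated verbatim so that
  \<open>discriminant_eq\<close> follows by unfolding.\<close>

definition embs :: "('f \<Rightarrow> complex) list" where
  "embs = (SOME \<sigma>s. distinct \<sigma>s \<and> set \<sigma>s = {\<sigma>. field_hom \<sigma>})"

lemma embs: "distinct embs" "set embs = embeddings" "length embs = deg"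
proof -
  obtain \<sigma>s where "set \<sigma>s = (embeddings :: ('f \<Rightarrow> complex) set)" "distinct \<sigma>s"
    using card_embeddings(1)[OF nf] finite_distinct_list by blast
  hence "\<exists>\<sigma>s. distinct \<sigma>s \<and> set \<sigma>s = {\<sigma> :: 'f \<Rightarrow> complex. field_hom \<sigma>}" by (auto simp: embeddings_def)
  from someI_ex[OF this] show "distinct embs" "set embs = embeddings"
    unfolding embs_def embeddings_def by auto
  thus "length embs = deg" using card_embeddings(2)[OF nf] distinct_card[of embs] by (simp add: deg_def)
qed

lemma hom_embs: "i < deg \<Longrightarrow> field_hom (embs ! i)"
  using embs nth_mem[of i embs] by (auto simp: embeddings_def)

text \<open>For a Z-basis of an ideal this is the covolume of the ideal in the metric that counts
  complex places twice: the Gram matrix is the transpose of \<open>emb_mat\<close> times its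
  conjugate.\<close>

definition list_vol :: "'f list \<Rightarrow> real" where
  "list_vol bs = cmod (Determinant.det (emb_mat embs bs))"

lemma list_vol_coords:
  assumes "length bs = deg" "length cs = deg" "A \<in> carrier_mat deg deg"
    "\<And>j. j < deg \<Longrightarrow> cs ! j = F.zcomb (\<lambda>i. A $$ (i, j)) bs"
  shows "list_vol cs = \<bar>of_int (Determinant.det A)\<bar> * list_vol bs"
proof -
  have "emb_mat embs cs = emb_mat embs bs * map_mat of_int A"
    using assms embs by (intro emb_mat_coords) auto
  moreover have "emb_mat embs bs \<in> carrier_mat deg deg" using assms embs by (simp add: emb_mat_def)
  ultimately show ?thesis unfolding list_vol_def
    using assms(3) by (simp add: det_mult of_int_hom.hom_det norm_mult mult.commute)
qed

definition abs_norm :: "'f \<Rightarrow> real" where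
  "abs_norm d = (\<Prod>\<sigma>\<in>embeddings. cmod (\<sigma> d))"

lemma abs_norm_pos: "d \<noteq> 0 \<Longrightarrow> abs_norm d > 0"
  unfolding abs_norm_def
proof (rule prod_pos)
  fix \<sigma> :: "'f \<Rightarrow> complex" assume d: "d \<noteq> 0" "\<sigma> \<in> embeddings"
  then interpret field_hom \<sigma> by (simp add: embeddings_def)
  show "cmod (\<sigma> d) > 0" using d(1) by simp
qed

lemma prod_embs: "(\<Prod>i = 0..<deg. f (embs ! i)) = (\<Prod>\<sigma>\<in>embeddings. f \<sigma>)"
  using prod.reindex_bij_betw[OF bij_betw_nth[OF embs(1) refl refl], of f] embs
  by (simp add: atLeast0LessThan)

text \<open>Multiplication by \<open>d\<close> scales the row of each embedding by the image of
  \<open>d\<close>, so the matrix acquires a diagonal factor whose determinant is the field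
  norm.\<close>

lemma list_vol_scale:
  assumes "length bs = deg"
  shows "list_vol (map ((*) d) bs) = abs_norm d * list_vol bs"
proof -
  define D where "D = Matrix.mat deg deg (\<lambda>(i, j). if i = j then (embs ! i) d else 0)"
  have D: "D \<in> carrier_mat deg deg" by (simp add: D_def)
  have M: "emb_mat embs bs \<in> carrier_mat deg deg" using assms embs by (simp add: emb_mat_def)
  have "emb_mat embs (map ((*) d) bs) = D * emb_mat embs bs"
  proof (rule eq_matI)
    fix i j assume "i < dim_row (D * emb_mat embs bs)" "j < dim_col (D * emb_mat embs bs)"
    hence i: "i < deg" and j: "j < deg" using D M by auto
    interpret field_hom "embs ! i" by (rule hom_embs[OF i])
    have "(D * emb_mat embs bs) $$ (i, j) = (\<Sum>k<deg. D $$ (i, k) * emb_mat embs bs $$ (k, j))"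
      using i j D M by (simp add: scalar_prod_def atLeast0LessThan)
    also have "\<dots> = (\<Sum>k<deg. if k = i then (embs ! i) d * (embs ! i) (bs ! j) else 0)"
      by (rule sum.cong) (use i j assms embs in \<open>auto simp: D_def emb_mat_def\<close>)
    also have "\<dots> = (embs ! i) (d * bs ! j)" using i by (simp add: hom_distribs)
    finally show "emb_mat embs (map ((*) d) bs) $$ (i, j) = (D * emb_mat embs bs) $$ (i, j)"
      using i j assms embs by (simp add: emb_mat_def)
  qed (use D assms embs in \<open>auto simp: emb_mat_def\<close>)
  moreover have "upper_triangular D" by (auto simp: D_def)
  hence "Determinant.det D = (\<Prod>i = 0..<deg. (embs ! i) d)"
    using det_upper_triangular[OF _ D] by (simp add: prod_list_diag_prod D_def)
  hence "cmod (Determinant.det D) = abs_norm d"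
    using prod_embs[of "\<lambda>\<sigma>. cmod (\<sigma> d)"] by (simp add: prod_norm abs_norm_def)
  ultimately show ?thesis unfolding list_vol_def
    using D M by (simp add: det_mult norm_mult)
qed

lemma ex_int_multiple:
  obtains k :: int where "k > 0" "of_int k * (x :: 'f) \<in> \<O>"
  using algebraic_int_multiple[OF number_field_algebraic[OF nf], of x]
  by (auto simp: ring_of_integers_def)

lemma list_vol_pos:
  assumes "length bs = deg" "F.span (set bs) = UNIV"
  shows "list_vol bs > 0"
  using emb_mat_det_nonzero[of embs bs] embs assms by (simp add: list_vol_def)

lemma zindep_vol_pos:
  assumes "F.zindep bs" "length bs = deg"
  shows "list_vol bs > 0"
  using assms independent_spans[OF nf F.zindep_independent[OF assms(1)]]
  by (intro list_vol_pos) (auto simp: deg_def F.zindep_distinct distinct_card)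

text \<open>The denominators of the coordinates of algebraic integers with respect to a basis \<open>ws\<close> of
  algebraic integers are bounded: by Cramer's rule every coordinate times \<open>det (\<sigma>\<^sub>i(w\<^sub>j))\<close> is an
  algebraic integer, and the determinant divides a rational integer \<open>k\<close>.\<close>

lemma ring_of_integers_zbasis: "\<exists>bs. F.zbasis (\<O> :: 'f set) bs"
proof -
  obtain B :: "'f set" where B: "finite B" "\<not> F.dependent B" "F.span B = UNIV"
    using number_field_basis[OF nf] .
  obtain bs where bs: "set bs = B" "distinct bs" using finite_distinct_list[OF B(1)] by blast
  have len: "length bs = deg"
    using F.basis_card_eq_dim[of B UNIV] B bs distinct_card[of bs] by (simp add: deg_def)
  have "\<forall>b. \<exists>k::int. k > 0 \<and> of_int k * (b :: 'f) \<in> \<O>" using ex_int_multiple by metis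
  then obtain m :: "'f \<Rightarrow> int" where m: "\<And>b. m b > 0" "\<And>b. of_int (m b) * b \<in> \<O>" by metis
  define ws where "ws = map (\<lambda>b. of_int (m b) * b) bs"
  have lenw: "length ws = deg" by (simp add: ws_def len)
  have wsO: "ws ! j \<in> \<O>" if "j < deg" for j using that m len by (simp add: ws_def)
  have "B \<subseteq> F.span (set ws)"
  proof
    fix b assume b: "b \<in> B"
    have "of_rat (inverse (of_int (m b))) * (of_int (m b) * b) \<in> F.span (set ws)"
      using b bs by (intro F.span_scale F.span_base) (auto simp: ws_def)
    moreover have "of_rat (inverse (of_int (m b))) * (of_int (m b) * b) = b"
      using m(1)[of b] by (simp add: of_rat_inverse)
    ultimately show "b \<in> F.span (set ws)" by simp
  qed
  hence span: "F.span (set ws) = UNIV" using B(3) F.span_minimal[OF _ F.subspace_span] by blast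
  have "card (set ws) \<ge> deg" using F.dim_le_card[of UNIV "set ws"] span by (simp add: deg_def)
  hence distw: "distinct ws" using lenw card_length[of ws] by (intro card_distinct) simp
  have indepw: "\<not> F.dependent (set ws)"
    using spanning_independent[OF nf finite_set span] card_length[of ws] lenw by (simp add: deg_def)
  let ?M = "emb_mat embs ws"
  let ?d = "Determinant.det ?M"
  have M: "?M \<in> carrier_mat deg deg" using lenw embs by (simp add: emb_mat_def)
  have d0: "?d \<noteq> 0" using list_vol_pos[OF lenw span] by (auto simp: list_vol_def)
  have algM: "algebraic_int (?M $$ (i, j))" if "i < deg" "j < deg" for i j
    using that wsO[of j] algebraic_int_hom[OF hom_embs[of i]] lenw embs
    by (simp add: emb_mat_def ring_of_integers_def)
  have "algebraic_int ?d" by (rule algebraic_int_det[OF M algM])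
  then obtain \<gamma> k where k: "algebraic_int \<gamma>" "k > 0" "\<gamma> * ?d = complex_of_int k"
    using algebraic_int_divides_int[of ?d] d0 by metis
  \<comment> \<open>The aim is to place \<O> inside the group generated by these fractions; as a
    subgroup of a group with a basis it then has one itself.\<close>
  define vs where "vs = map (\<lambda>w. w / of_int k) ws"
  have lenv: "length vs = deg" by (simp add: vs_def lenw)
  have "F.zindep ws" using distw indepw by (rule F.independent_zindep)
  moreover have z: "F.zcomb c vs = F.zcomb c ws / of_int k" for c
    by (simp add: F.zcomb_def vs_def sum_divide_distrib)
  ultimately have vs: "F.zbasis (range (\<lambda>c. F.zcomb c vs)) vs"
    using k(2) by (auto simp: F.zbasis_def F.zindep_def vs_def[THEN arg_cong[of _ _ length]])
  have "\<O> \<subseteq> range (\<lambda>c. F.zcomb c vs)"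
  proof
    fix x :: 'f assume x: "x \<in> \<O>"
    define q where "q j = F.representation (set ws) x (ws ! j)" for j
    have xq: "x = (\<Sum>j<deg. of_rat (q j) * ws ! j)"
    proof -
      have "x = (\<Sum>w\<in>set ws. of_rat (F.representation (set ws) x w) * w)"
        using F.sum_representation_eq[OF indepw _ finite_set subset_refl, of x] span by simp
      also have "\<dots> = (\<Sum>j<deg. of_rat (q j) * ws ! j)"
        using sum.reindex_bij_betw[OF bij_betw_nth[OF distw refl refl], of "\<lambda>w. of_rat (F.representation (set ws) x w) * w"]
        by (simp add: q_def lenw)
      finally show ?thesis .
    qed
    let ?q = "Matrix.vec deg (\<lambda>j. of_rat (q j)) :: complex Matrix.vec"
    have Mq: "vec_index (?M *\<^sub>v ?q) i = (embs ! i) x" if i: "i < deg" for i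
    proof -
      have lin: "rat_linear (embs ! i)" by (rule rat_linear_embedding[OF hom_embs[OF i]])
      have "vec_index (?M *\<^sub>v ?q) i = (\<Sum>j<deg. of_rat (q j) * (embs ! i) (ws ! j))"
        using i lenw embs by (auto simp: emb_mat_def scalar_prod_def atLeast0LessThan mult.commute intro!: sum.cong)
      thus ?thesis using rat_linear_sum[OF lin, of q "(!) ws" "{..<deg}"] xq by simp
    qed
    have int: "\<exists>c. of_int k * q j = of_int c" if j: "j < deg" for j
    proof -
      \<comment> \<open>The new column consists of the images of \<open>x\<close>, so all entries
        remain algebraic integers. By Cramer's rule this determinant is \<open>q j\<close> times
        \<open>?d\<close>.\<close>
      have "algebraic_int (Determinant.det (replace_col ?M (?M *\<^sub>v ?q) j))"
      proof (rule algebraic_int_det)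
        show "replace_col ?M (?M *\<^sub>v ?q) j \<in> carrier_mat deg deg" using M by (auto simp: replace_col_def)
        fix i l assume il: "i < deg" "l < deg"
        have "algebraic_int ((embs ! i) x)"
          using algebraic_int_hom[OF hom_embs[OF il(1)]] x by (simp add: ring_of_integers_def)
        thus "algebraic_int (replace_col ?M (?M *\<^sub>v ?q) j $$ (i, l))"
          using il M Mq[OF il(1)] algM[OF il] by (auto simp: replace_col_def)
      qed
      hence "algebraic_int (of_rat (q j) * ?d)"
        using cramer_lemma_mat[OF M _ j, of ?q] j by simp
      \<comment> \<open>The factor \<gamma> trades the determinant for the integer \<open>k\<close>,
        and a rational algebraic integer is an integer.\<close>
      from algebraic_int_add_mult(2)[OF k(1) this]
      have "algebraic_int (of_rat (q j) * (\<gamma> * ?d))" by (simp add: mult_ac)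
      hence "algebraic_int (complex_of_rat (of_int k * q j))"
        by (simp add: k(3) of_rat_mult mult.commute)
      from rational_algebraic_int_is_int[OF this] obtain c where "complex_of_rat (of_int k * q j) = of_int c"
        by (auto elim: Ints_cases)
      hence "complex_of_rat (of_int k * q j) = of_rat (of_int c)" by simp
      thus ?thesis by (subst (asm) of_rat_eq_iff) blast
    qed
    then obtain c where c: "\<And>j. j < deg \<Longrightarrow> of_int k * q j = of_int (c j)" by metis
    have "of_int k * x = F.zcomb c ws"
    proof -
      have "of_int k * x = (\<Sum>j<deg. of_rat (of_int k * q j) * ws ! j)"
        by (subst xq) (simp add: sum_distrib_left of_rat_mult mult.assoc)
      also have "\<dots> = (\<Sum>j<deg. of_int (c j) * ws ! j)" by (intro sum.cong) (auto simp: c)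
      finally show ?thesis by (simp add: F.zcomb_def lenw)
    qed
    moreover have "x = of_int k * x / of_int k" using k(2) by simp
    ultimately have "x = F.zcomb c vs" unfolding z by (simp only:)
    thus "x \<in> range (\<lambda>c. F.zcomb c vs)" by blast
  qed
  from F.zbasis_subgroup[OF vs subspace_ring_of_integers this] show ?thesis .
qed

text \<open>For a non-zero \<open>y\<close> in \<open>I\<close> and any \<open>x\<close>, a positive
  integer \<open>k\<close> makes \<open>k x / y\<close> integral, so \<open>k x\<close> is an
  integral multiple of \<open>y\<close> and lies in \<open>I\<close>.\<close>

lemma fractional_ideal_span:
  assumes "fractional_ideal (I :: 'f set)"
  shows "F.span I = UNIV"
proof -
  obtain y where y: "y \<in> I" "y \<noteq> 0"
    using assms unfolding fractional_ideal_def OF_submodule_def by blast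
  have "x \<in> F.span I" for x
  proof -
    obtain k where k: "k > 0" "of_int k * (x / y) \<in> \<O>" using ex_int_multiple .
    moreover have "OF_submodule (*) I" using assms by (simp add: fractional_ideal_def)
    ultimately have "of_int k * (x / y) * y \<in> I" using y(1) unfolding OF_submodule_def by blast
    hence "of_int k * x \<in> I" using y by simp
    hence "of_rat (inverse (of_int k)) * (of_int k * x) \<in> F.span I" by (intro F.span_scale F.span_base)
    moreover have "of_rat (inverse (of_int k)) * (of_int k * x) = x"
      using k(1) by (simp add: of_rat_inverse)
    ultimately show ?thesis by simp
  qed
  thus ?thesis by auto
qed

lemma fractional_ideal_zbasis_length:
  assumes "fractional_ideal (I :: 'f set)" "F.zbasis I bs"
  shows "length bs = deg"
  using F.zbasis_length[OF assms(2)] F.span_eq_dim[of I UNIV] fractional_ideal_span[OF assms(1)]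
  by (simp add: deg_def)

lemma fractional_ideal_zbasis:
  assumes "fractional_ideal (I :: 'f set)"
  obtains bs where "F.zbasis I bs" "length bs = deg"
proof -
  obtain d where d: "d \<in> \<O>" "d \<noteq> 0" "\<And>x. x \<in> I \<Longrightarrow> d * x \<in> \<O>"
    using assms by (auto simp: fractional_ideal_def)
  obtain bs where bs: "F.zbasis (\<O> :: 'f set) bs" using ring_of_integers_zbasis by blast
  have "I \<subseteq> (*) (inverse d) ` \<O>"
  proof
    fix x assume "x \<in> I"
    hence "x = inverse d * (d * x)" "d * x \<in> \<O>" using d by auto
    thus "x \<in> (*) (inverse d) ` \<O>" by blast
  qed
  from F.zbasis_subgroup[OF zbasis_scale[OF bs] fractional_ideal_subspace[OF assms] this] d(2)
  obtain cs where "F.zbasis I cs" by auto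
  thus ?thesis using that fractional_ideal_zbasis_length[OF assms] by blast
qed

section \<open>Volume, index and norm of a fractional ideal\<close>

definition ideal_vol :: "'f set \<Rightarrow> real" where
  "ideal_vol I = list_vol (SOME bs. F.zbasis I bs)"

lemma ideal_vol_eq:
  assumes "fractional_ideal I" "F.zbasis I bs"
  shows "ideal_vol I = list_vol bs"
proof -
  define cs where "cs = (SOME bs. F.zbasis I bs)"
  have cs: "F.zbasis I cs" using someI[of "F.zbasis I"] assms(2) unfolding cs_def by blast
  note len = fractional_ideal_zbasis_length[OF assms] fractional_ideal_zbasis_length[OF assms(1) cs]
  have "set cs \<subseteq> I" using F.zbasis_mem[OF cs] by (auto simp: in_set_conv_nth)
  from F.zbasis_coords[OF assms(2) this] obtain A where A: "A \<in> carrier_mat deg deg"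
    "\<And>j. j < deg \<Longrightarrow> cs ! j = F.zcomb (\<lambda>i. A $$ (i, j)) bs"
    unfolding len by metis
  have "\<bar>Determinant.det A\<bar> = 1" using F.zbasis_change_det[OF assms(2) cs] A len by simp
  hence "\<bar>real_of_int (Determinant.det A)\<bar> = 1" by linarith
  thus ?thesis using list_vol_coords[OF len A] unfolding ideal_vol_def cs_def by simp
qed

lemma ideal_vol_pos: "fractional_ideal I \<Longrightarrow> ideal_vol I > 0"
  by (metis F.zbasis_def fractional_ideal_zbasis ideal_vol_eq zindep_vol_pos)

definition index_rel :: "'f set \<Rightarrow> 'f set \<Rightarrow> ('f \<times> 'f) set" where
  "index_rel I K = {(x, y). x \<in> I \<and> y \<in> I \<and> x - y \<in> K}"

text \<open>The index and the ratio of the volumes are both the absolute determinant of the matrix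
  that expresses a basis of \<open>K\<close> in a basis of \<open>I\<close>.\<close>

lemma ideal_vol_index:
  assumes "fractional_ideal I" "fractional_ideal K" "K \<subseteq> I"
  shows "ideal_vol K = card (I // index_rel I K) * ideal_vol I"
proof -
  obtain bs where bs: "F.zbasis I bs" "length bs = deg" using fractional_ideal_zbasis[OF assms(1)] .
  obtain cs where cs: "F.zbasis K cs" "length cs = deg" using fractional_ideal_zbasis[OF assms(2)] .
  have "set cs \<subseteq> K" using F.zbasis_mem[OF cs(1)] by (auto simp: in_set_conv_nth)
  hence "set cs \<subseteq> I" using assms(3) by (rule order.trans)
  from F.zbasis_coords[OF bs(1) this] obtain A where A: "A \<in> carrier_mat deg deg"
    "\<And>j. j < deg \<Longrightarrow> cs ! j = F.zcomb (\<lambda>i. A $$ (i, j)) bs"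
    unfolding bs(2) cs(2) by metis
  have "int (card (I // index_rel I K)) = \<bar>Determinant.det A\<bar>"
    unfolding index_rel_def using F.index_eq_det[OF bs(1) cs(1) assms(3), of A] A bs(2) cs(2) by simp
  hence "real (card (I // index_rel I K)) = \<bar>of_int (Determinant.det A)\<bar>"
    by (metis of_int_abs of_int_of_nat_eq)
  thus ?thesis using list_vol_coords[OF bs(2) cs(2) A] ideal_vol_eq assms bs cs by simp
qed

lemma fractional_ideal_scale:
  assumes "fractional_ideal (I :: 'f set)" "d \<noteq> 0"
  shows "fractional_ideal ((*) d ` I)"
proof -
  obtain e where e: "e \<in> \<O>" "e \<noteq> 0" "\<And>x. x \<in> I \<Longrightarrow> e * x \<in> \<O>"
    using assms by (auto simp: fractional_ideal_def)
  obtain k where k: "k > 0" "of_int k * inverse d \<in> \<O>" using ex_int_multiple .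
  obtain y where y: "y \<in> I" "y \<noteq> 0"
    using assms unfolding fractional_ideal_def OF_submodule_def by blast
  have sub: "OF_submodule (*) I" using assms by (simp add: fractional_ideal_def)
  show ?thesis unfolding fractional_ideal_def
  proof (intro conjI bexI[of _ "of_int k * inverse d * e"])
    show "OF_submodule (*) ((*) d ` I)" unfolding OF_submodule_def
    proof (intro conjI ballI)
      show "0 \<in> (*) d ` I" using sub by (auto simp: OF_submodule_def intro!: image_eqI[of _ _ 0])
      fix v assume "v \<in> (*) d ` I"
      then obtain x where x: "x \<in> I" "v = d * x" by auto
      show "v + w \<in> (*) d ` I" if w: "w \<in> (*) d ` I" for w
      proof -
        from w obtain x' where "x' \<in> I" "w = d * x'" by auto
        thus ?thesis using x sub by (auto simp: OF_submodule_def intro!: image_eqI[of _ _ "x + x'"] simp: distrib_left)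
      qed
      show "c * v \<in> (*) d ` I" if "c \<in> \<O>" for c
        using x sub that by (auto simp: OF_submodule_def intro!: image_eqI[of _ _ "c * x"])
    qed
    show "(*) d ` I \<noteq> {0}" using y assms(2) by (metis imageI mult_eq_0_iff singletonD)
    show "of_int k * inverse d * e \<noteq> 0" using k e assms(2) by simp
    show "of_int k * inverse d * e \<in> \<O>" by (rule ring_of_integers_simps(5)[OF k(2) e(1)])
    show "\<forall>x\<in>(*) d ` I. of_int k * inverse d * e * x \<in> \<O>"
    proof
      fix x assume "x \<in> (*) d ` I"
      then obtain z where z: "z \<in> I" "x = d * z" by auto
      have "of_int k * inverse d * e * x = of_int k * (e * z)" using z assms(2) by simp
      thus "of_int k * inverse d * e * x \<in> \<O>"
        using ring_of_integers_simps(5)[OF ring_of_integers_simps(3) e(3)[OF z(1)]] by (simp only:)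
    qed
  qed
qed

lemma ideal_vol_scale:
  assumes "fractional_ideal I" "d \<noteq> 0"
  shows "ideal_vol ((*) d ` I) = abs_norm d * ideal_vol I"
proof -
  obtain bs where bs: "F.zbasis I bs" "length bs = deg" using fractional_ideal_zbasis[OF assms(1)] .
  show ?thesis
    using ideal_vol_eq[OF fractional_ideal_scale[OF assms] zbasis_scale[OF bs(1) assms(2)]]
      ideal_vol_eq[OF assms(1) bs(1)] list_vol_scale[OF bs(2), of d] by simp
qed

lemma ideal_index_eq:
  assumes "fractional_ideal I" "I \<subseteq> \<O>"
  shows "real (ideal_index I) = ideal_vol I / ideal_vol (\<O> :: 'f set)"
  using ideal_vol_index[OF fractional_ideal_ring_of_integers assms] ideal_vol_pos[OF fractional_ideal_ring_of_integers]
  unfolding ideal_index_def index_rel_def by simp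

text \<open>The denominator \<open>d\<close> scales both indices by \<open>abs_norm d\<close> and
  cancels. Multiplicativity of the norm thereby becomes a statement about
  \<open>ideal_vol\<close>.\<close>

lemma ideal_norm_eq:
  assumes "fractional_ideal I"
  shows "ideal_norm I = ideal_vol I / ideal_vol (\<O> :: 'f set)"
proof -
  define d where "d = (SOME d. d \<in> \<O> \<and> d \<noteq> 0 \<and> (*) d ` I \<subseteq> \<O>)"
  have "\<exists>d. d \<in> \<O> \<and> d \<noteq> 0 \<and> (*) d ` I \<subseteq> \<O>" using assms by (auto simp: fractional_ideal_def)
  from someI_ex[OF this] have d: "d \<in> \<O>" "d \<noteq> 0" "(*) d ` I \<subseteq> \<O>" by (simp_all add: d_def)
  have dO: "(*) d ` \<O> \<subseteq> \<O>" using d(1) by (auto intro: ring_of_integers_simps)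
  note O = fractional_ideal_ring_of_integers
  have "ideal_norm I = real (ideal_index ((*) d ` I)) / real (ideal_index ((*) d ` \<O>))"
    unfolding ideal_norm_def d_def[symmetric] Let_def ..
  also have "\<dots> = (abs_norm d * ideal_vol I / ideal_vol \<O>) / (abs_norm d * ideal_vol \<O> / ideal_vol (\<O> :: 'f set))"
    unfolding ideal_index_eq[OF fractional_ideal_scale[OF assms d(2)] d(3)]
      ideal_index_eq[OF fractional_ideal_scale[OF O d(2)] dO] ideal_vol_scale[OF assms d(2)] ideal_vol_scale[OF O d(2)] ..
  also have "\<dots> = ideal_vol I / ideal_vol (\<O> :: 'f set)"
    using abs_norm_pos[OF d(2)] ideal_vol_pos[OF O] by simp
  finally show ?thesis .
qed

lemma discriminant_eq: "cmod (discriminant TYPE('f)) = (ideal_vol \<O>)\<^sup>2"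
  unfolding discriminant_def ideal_vol_def list_vol_def emb_mat_def embs_def[symmetric] F.int_basis_iff Let_def
  by (simp add: norm_power)

end

section \<open>Invertibility of fractional ideals\<close>

lemma ideal_multI: "x \<in> I \<Longrightarrow> y \<in> J \<Longrightarrow> x * y \<in> ideal_mult I (J :: 'f::field_char_0 set)"
  unfolding ideal_mult_def by (rule F.Z.span_base) blast

lemma ideal_mult_subspace: "F.Z.subspace (ideal_mult I (J :: 'f::field_char_0 set))"
  unfolding ideal_mult_def by (rule F.Z.subspace_span)

text \<open>The extra factor \<open>z\<close> lets the same induction serve for associativity, for
  stability under scalars, for clearing denominators and for multiplying an expansion of 1 by a
  fixed element.\<close>

lemma ideal_mult_induct:
  fixes I J T :: "'f::field_char_0 set"
  assumes "w \<in> ideal_mult I J" "F.Z.subspace T" "\<And>x y. x \<in> I \<Longrightarrow> y \<in> J \<Longrightarrow> x * y * z \<in> T"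
  shows "w * z \<in> T"
proof -
  have "F.Z.subspace {w. w * z \<in> T}"
    using F.Z.subspace_0[OF assms(2)] F.Z.subspace_add[OF assms(2)] F.Z.subspace_scale[OF assms(2)]
    by (intro F.Z.subspaceI) (auto simp: distrib_right mult.assoc)
  from F.Z.span_minimal[OF _ this, of "{x * y |x y. x \<in> I \<and> y \<in> J}"] assms(1,3)
  show ?thesis unfolding ideal_mult_def by blast
qed

lemma ideal_mult_least:
  fixes I J T :: "'f::field_char_0 set"
  assumes "F.Z.subspace T" "\<And>x y. x \<in> I \<Longrightarrow> y \<in> J \<Longrightarrow> x * y \<in> T"
  shows "ideal_mult I J \<subseteq> T"
  using ideal_mult_induct[of _ I J T 1] assms by auto

lemma ideal_mult_commute: "ideal_mult I J = ideal_mult J (I :: 'f::field_char_0 set)"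
proof -
  have "{x * y |x y. x \<in> I \<and> y \<in> J} = {x * y |x y. x \<in> J \<and> y \<in> I}"
    using mult.commute by blast
  thus ?thesis by (simp add: ideal_mult_def)
qed

lemma ideal_mult_mono: "I \<subseteq> I' \<Longrightarrow> J \<subseteq> J' \<Longrightarrow> ideal_mult I J \<subseteq> ideal_mult I' (J' :: 'f::field_char_0 set)"
  by (rule ideal_mult_least[OF ideal_mult_subspace]) (auto intro: ideal_multI)

lemma ideal_mult_assoc:
  "ideal_mult (ideal_mult I J) K = ideal_mult I (ideal_mult J (K :: 'f::field_char_0 set))"
proof -
  have sub: "ideal_mult (ideal_mult I J) K \<subseteq> ideal_mult I (ideal_mult J K)" for I J K :: "'f set"
  proof (rule ideal_mult_least[OF ideal_mult_subspace])
    fix w z assume w: "w \<in> ideal_mult I J" and z: "z \<in> K"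
    show "w * z \<in> ideal_mult I (ideal_mult J K)"
      by (rule ideal_mult_induct[OF w ideal_mult_subspace]) (auto simp: mult.assoc intro: ideal_multI z)
  qed
  have "ideal_mult I (ideal_mult J K) = ideal_mult (ideal_mult K J) I"
    by (metis ideal_mult_commute)
  also have "\<dots> \<subseteq> ideal_mult K (ideal_mult J I)" by (rule sub)
  also have "\<dots> = ideal_mult (ideal_mult I J) K" by (metis ideal_mult_commute)
  finally show ?thesis using sub by blast
qed

lemma OF_submodule_ideal_mult:
  assumes "OF_submodule (*) (I :: 'f::field_char_0 set)"
  shows "OF_submodule (*) (ideal_mult I J)"
  unfolding OF_submodule_def
proof (intro conjI ballI)
  note s = ideal_mult_subspace[of I J]
  show "0 \<in> ideal_mult I J" by (rule F.Z.subspace_0[OF s])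
  show "v + w \<in> ideal_mult I J" if "v \<in> ideal_mult I J" "w \<in> ideal_mult I J" for v w
    by (rule F.Z.subspace_add[OF s that])
  fix c w :: 'f assume c: "c \<in> \<O>" and w: "w \<in> ideal_mult I J"
  have "w * c \<in> ideal_mult I J"
  proof (rule ideal_mult_induct[OF w s])
    fix x y assume "x \<in> I" "y \<in> J"
    hence "(c * x) * y \<in> ideal_mult I J"
      using assms c by (intro ideal_multI) (auto simp: OF_submodule_def)
    thus "x * y * c \<in> ideal_mult I J" by (simp add: mult_ac)
  qed
  thus "c * w \<in> ideal_mult I J" by (simp add: mult.commute)
qed

lemma ideal_mult_unit:
  assumes "OF_submodule (*) (I :: 'f::field_char_0 set)"
  shows "ideal_mult \<O> I = I" "ideal_mult I \<O> = I"
proof -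
  show "ideal_mult \<O> I = I"
  proof
    show "ideal_mult \<O> I \<subseteq> I"
      by (rule ideal_mult_least[OF OF_submodule_subspace[OF assms]]) (use assms in \<open>auto simp: OF_submodule_def\<close>)
    show "I \<subseteq> ideal_mult \<O> I"
    proof
      fix x assume "x \<in> I"
      with ideal_multI[OF ring_of_integers_simps(2) this] show "x \<in> ideal_mult \<O> I" by simp
    qed
  qed
  thus "ideal_mult I \<O> = I" by (simp add: ideal_mult_commute)
qed

lemma fractional_ideal_OF_submodule: "fractional_ideal I \<Longrightarrow> OF_submodule (*) I"
  by (simp add: fractional_ideal_def)

lemma fractional_ideal_nonzero:
  assumes "fractional_ideal I"
  obtains y where "y \<in> I" "y \<noteq> 0"
  using assms unfolding fractional_ideal_def OF_submodule_def by blast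

lemma fractional_ideal_closed:
  assumes "fractional_ideal (I :: 'f::field_char_0 set)"
  shows "0 \<in> I" "x \<in> I \<Longrightarrow> y \<in> I \<Longrightarrow> x + y \<in> I" "x \<in> I \<Longrightarrow> y \<in> I \<Longrightarrow> x - y \<in> I"
    "c \<in> \<O> \<Longrightarrow> x \<in> I \<Longrightarrow> c * x \<in> I"
  using fractional_ideal_OF_submodule[OF assms] F.Z.subspace_diff[OF fractional_ideal_subspace[OF assms]]
  unfolding OF_submodule_def by blast+

lemma fractional_ideal_between:
  assumes "OF_submodule (*) I" "y \<in> I" "y \<noteq> 0" "I \<subseteq> K" "fractional_ideal K"
  shows "fractional_ideal I"
  using assms unfolding fractional_ideal_def by blast

lemma fractional_ideal_mult:
  assumes "fractional_ideal (I :: 'f::field_char_0 set)" "fractional_ideal J"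
  shows "fractional_ideal (ideal_mult I J)"
proof -
  obtain x y where xy: "x \<in> I" "x \<noteq> 0" "y \<in> J" "y \<noteq> 0"
    using fractional_ideal_nonzero assms by metis
  obtain d e where d: "d \<in> \<O>" "d \<noteq> 0" "\<And>x. x \<in> I \<Longrightarrow> d * x \<in> \<O>" and e: "e \<in> \<O>" "e \<noteq> 0" "\<And>x. x \<in> J \<Longrightarrow> e * x \<in> \<O>"
    using assms by (auto simp: fractional_ideal_def)
  have "w * (d * e) \<in> \<O>" if w: "w \<in> ideal_mult I J" for w
  proof (rule ideal_mult_induct[OF w subspace_ring_of_integers])
    fix x y assume "x \<in> I" "y \<in> J"
    hence "(d * x) * (e * y) \<in> \<O>" by (intro ring_of_integers_simps(5) d e)
    thus "x * y * (d * e) \<in> \<O>" by (simp add: mult_ac)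
  qed
  hence "\<forall>w\<in>ideal_mult I J. (d * e) * w \<in> \<O>" by (simp add: mult.commute)
  moreover have "d * e \<in> \<O>" "d * e \<noteq> 0" using d e by (simp_all add: ring_of_integers_simps(5))
  moreover have "x * y \<in> ideal_mult I J" "x * y \<noteq> 0" using xy by (simp_all add: ideal_multI)
  hence "ideal_mult I J \<noteq> {0}" by blast
  ultimately show ?thesis unfolding fractional_ideal_def
    using OF_submodule_ideal_mult[OF fractional_ideal_OF_submodule[OF assms(1)]] by blast
qed

lemma one_mem_imp_ring_of_integers:
  "fractional_ideal I \<Longrightarrow> I \<subseteq> \<O> \<Longrightarrow> 1 \<in> I \<Longrightarrow> I = (\<O> :: 'f::field_char_0 set)"
  using fractional_ideal_closed(4)[of I _ 1] by auto

section \<open>The ideal generated by \<open>I\<close> and one further element\<close>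

lemma OF_submodule_add_principal:
  assumes "fractional_ideal (I :: 'f::field_char_0 set)"
  shows "OF_submodule (*) {p + c * x |p c. p \<in> I \<and> c \<in> \<O>}"
  unfolding OF_submodule_def
proof (intro conjI ballI)
  let ?S = "{p + c * x |p c. p \<in> I \<and> c \<in> \<O>}"
  show "0 \<in> ?S" using fractional_ideal_closed(1)[OF assms] ring_of_integers_simps(1) by force
  fix v assume "v \<in> ?S"
  then obtain p c where v: "v = p + c * x" "p \<in> I" "c \<in> \<O>" by auto
  show "v + w \<in> ?S" if "w \<in> ?S" for w
  proof -
    from that obtain q d where w: "w = q + d * x" "q \<in> I" "d \<in> \<O>" by auto
    have "v + w = (p + q) + (c + d) * x" by (simp add: v w algebra_simps)
    thus ?thesis using v w fractional_ideal_closed(2)[OF assms] ring_of_integers_simps(4) by blast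
  qed
  show "d * v \<in> ?S" if "d \<in> \<O>" for d
  proof -
    have "d * v = d * p + (d * c) * x" by (simp add: v algebra_simps)
    thus ?thesis using v that fractional_ideal_closed(4)[OF assms] ring_of_integers_simps(5) by blast
  qed
qed

lemma add_principal_sup:
  assumes "fractional_ideal (I :: 'f::field_char_0 set)"
  shows "I \<subseteq> {p + c * x |p c. p \<in> I \<and> c \<in> \<O>}" "x \<in> {p + c * x |p c. p \<in> I \<and> c \<in> \<O>}"
proof -
  show "I \<subseteq> {p + c * x |p c. p \<in> I \<and> c \<in> \<O>}"
  proof
    fix p assume "p \<in> I"
    thus "p \<in> {p + c * x |p c. p \<in> I \<and> c \<in> \<O>}"
      using ring_of_integers_simps(1) by (intro CollectI exI[of _ p] exI[of _ 0]) auto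
  qed
  show "x \<in> {p + c * x |p c. p \<in> I \<and> c \<in> \<O>}"
    using fractional_ideal_closed(1)[OF assms] ring_of_integers_simps(2)
    by (intro CollectI exI[of _ 0] exI[of _ 1]) auto
qed

lemma fractional_ideal_add_principal:
  assumes "fractional_ideal (I :: 'f::field_char_0 set)" "fractional_ideal K" "I \<subseteq> K" "x \<in> K"
  shows "fractional_ideal {p + c * x |p c. p \<in> I \<and> c \<in> \<O>}" "{p + c * x |p c. p \<in> I \<and> c \<in> \<O>} \<subseteq> K"
proof -
  show sub: "{p + c * x |p c. p \<in> I \<and> c \<in> \<O>} \<subseteq> K"
    using fractional_ideal_closed(2,4)[OF assms(2)] assms(3,4) by blast
  obtain y where y: "y \<in> I" "y \<noteq> 0" using fractional_ideal_nonzero[OF assms(1)] .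
  show "fractional_ideal {p + c * x |p c. p \<in> I \<and> c \<in> \<O>}"
    by (rule fractional_ideal_between[OF OF_submodule_add_principal[OF assms(1)] _ y(2) sub assms(2)])
      (use y add_principal_sup(1)[OF assms(1)] in blast)
qed

context num_field
begin

text \<open>A Z-basis of \<open>I\<close> is a finite generating set preserved by \<open>z\<close>,
  so the eigenvalue argument for algebraic integers applies.\<close>

lemma fractional_ideal_stable:
  assumes "fractional_ideal (I :: 'f set)" "\<And>y. y \<in> I \<Longrightarrow> z * y \<in> I"
  shows "z \<in> \<O>"
proof -
  obtain bs where bs: "F.zbasis I bs" using fractional_ideal_zbasis[OF assms(1)] .
  hence I: "I = F.Z.span (set bs)" by (simp add: F.zbasis_def F.zspan_eq_range)
  obtain y where y: "y \<in> I" "y \<noteq> 0" using fractional_ideal_nonzero[OF assms(1)] .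
  have "\<exists>b\<in>set bs. b \<noteq> 0"
  proof (rule ccontr)
    assume "\<not> ?thesis"
    hence "set bs \<subseteq> {0}" by auto
    hence "F.Z.span (set bs) \<subseteq> {0}" by (intro F.Z.span_minimal) (auto intro: F.Z.subspaceI)
    with y I show False by auto
  qed
  then obtain b where b: "b \<in> set bs" "b \<noteq> 0" by blast
  have "algebraic_int z"
    by (rule algebraic_int_stable[OF finite_set b]) (use assms(2) I F.Z.span_base in blast)
  thus ?thesis by (simp add: ring_of_integers_def)
qed

text \<open>The index is a natural number. It is not 0, since both volumes are positive, and not 1,
  since a single class would put all of \<open>I\<close> into \<open>K\<close>; so it is at least
  2.\<close>

lemma ideal_vol_less:
  assumes "fractional_ideal I" "fractional_ideal K" "K \<subseteq> I" "K \<noteq> I"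
  shows "ideal_vol I < ideal_vol K"
proof -
  let ?c = "card (I // index_rel I K)"
  have v: "ideal_vol K = ?c * ideal_vol I" by (rule ideal_vol_index[OF assms(1-3)])
  have "?c \<noteq> 0" using v ideal_vol_pos[OF assms(2)] by (intro notI) simp
  moreover have "?c \<noteq> 1"
  proof
    assume "?c = 1"
    then obtain X where X: "I // index_rel I K = {X}" by (auto simp: card_1_singleton_iff)
    have "x \<in> K" if x: "x \<in> I" for x
    proof -
      have "index_rel I K `` {x} \<in> I // index_rel I K" "index_rel I K `` {0} \<in> I // index_rel I K"
        using x fractional_ideal_closed(1)[OF assms(1)] by (auto simp: quotient_def)
      hence "index_rel I K `` {x} = index_rel I K `` {0}" using X by auto
      moreover have "0 \<in> index_rel I K `` {0}"
        using fractional_ideal_closed(1)[OF assms(1)] fractional_ideal_closed(1)[OF assms(2)]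
        by (simp add: index_rel_def)
      ultimately have "0 \<in> index_rel I K `` {x}" by simp
      thus ?thesis by (simp add: index_rel_def)
    qed
    with assms(3,4) show False by blast
  qed
  ultimately have "real ?c \<ge> 2" by linarith
  hence "2 * ideal_vol I \<le> ?c * ideal_vol I"
    using ideal_vol_pos[OF assms(1)] by (intro mult_right_mono) auto
  thus ?thesis using v ideal_vol_pos[OF assms(1)] by linarith
qed

text \<open>Enlarging an integral ideal lowers its index, so induction on \<open>ideal_index\<close>
  plays the part of noetherian induction.\<close>

lemma ideal_index_less:
  assumes "fractional_ideal (I :: 'f set)" "fractional_ideal K" "K \<subseteq> I" "K \<noteq> I" "I \<subseteq> \<O>"
  shows "ideal_index I < ideal_index K"
proof -
  have "real (ideal_index I) < real (ideal_index K)"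
    using ideal_vol_less[OF assms(1-4)] ideal_vol_pos[OF fractional_ideal_ring_of_integers]
      ideal_index_eq[OF assms(1,5)] ideal_index_eq[OF assms(2)] assms(3,5)
    by (simp add: divide_strict_right_mono)
  thus ?thesis by simp
qed

section \<open>Maximal ideals and their products\<close>

definition maximal_ideal :: "'f set \<Rightarrow> bool" where
  "maximal_ideal P \<longleftrightarrow> fractional_ideal P \<and> P \<subseteq> \<O> \<and> P \<noteq> \<O> \<and>
     (\<forall>Q. fractional_ideal Q \<longrightarrow> P \<subseteq> Q \<longrightarrow> Q \<subseteq> \<O> \<longrightarrow> Q = P \<or> Q = \<O>)"

lemma ex_maximal_ideal:
  assumes "fractional_ideal I" "I \<subseteq> \<O>" "I \<noteq> \<O>"
  shows "\<exists>P. maximal_ideal P \<and> I \<subseteq> P"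
  using assms
proof (induction I rule: measure_induct_rule[of ideal_index])
  case (less I)
  show ?case
  proof (cases "maximal_ideal I")
    case False
    then obtain Q where Q: "fractional_ideal Q" "I \<subseteq> Q" "Q \<subseteq> \<O>" "Q \<noteq> I" "Q \<noteq> \<O>"
      using less.prems unfolding maximal_ideal_def by blast
    have "ideal_index Q < ideal_index I"
      using ideal_index_less[OF Q(1) less.prems(1) Q(2) _ Q(3)] Q(4) by simp
    from less.IH[OF this Q(1,3,5)] Q(2) show ?thesis by blast
  qed blast
qed

text \<open>The quotient of \<O> by \<open>I\<close> is finite, so two powers of \<open>x\<close>
  are congruent and \<open>x ^ i * (1 - x ^ (j - i))\<close> lies in \<open>I\<close>. Primality
  leaves \<open>1 - x ^ (j - i)\<close> in \<open>I\<close>, and an ideal \<open>Q\<close> above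
  \<open>I\<close> that contains \<open>x\<close> then contains 1.\<close>

lemma prime_imp_maximal:
  assumes "fractional_ideal I" "I \<subseteq> \<O>" "I \<noteq> \<O>"
    "\<And>x y. x \<in> \<O> \<Longrightarrow> y \<in> \<O> \<Longrightarrow> x * y \<in> I \<Longrightarrow> x \<in> I \<or> y \<in> I"
  shows "maximal_ideal I"
  unfolding maximal_ideal_def
proof (intro conjI allI impI)
  fix Q assume Q: "fractional_ideal Q" "I \<subseteq> Q" "Q \<subseteq> \<O>"
  show "Q = I \<or> Q = \<O>"
  proof (rule disjCI)
    assume "Q \<noteq> \<O>"
    show "Q = I"
    proof (rule ccontr)
      assume "Q \<noteq> I"
      then obtain x where x: "x \<in> Q" "x \<notin> I" using Q(2) by blast
      have xO: "x \<in> \<O>" using x Q(3) by blast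
      obtain bs where bs: "F.zbasis (\<O> :: 'f set) bs" "length bs = deg"
        using fractional_ideal_zbasis[OF fractional_ideal_ring_of_integers] .
      obtain cs where cs: "F.zbasis I cs" "length cs = deg" using fractional_ideal_zbasis[OF assms(1)] .
      obtain T where T: "finite T" "F.transversal \<O> I T"
        using F.zbasis_transversal[OF bs(1) cs(1) assms(2)] bs(2) cs(2) by auto
      have "\<forall>i. \<exists>t\<in>T. x ^ i - t \<in> I"
        using T(2) ring_of_integers_simps(7)[OF xO] unfolding F.transversal_def by blast
      then obtain t where t: "\<And>i. t i \<in> T" "\<And>i::nat. x ^ i - t i \<in> I" by metis
      have "\<not> inj t" using t(1) T(1) by (meson finite_subset image_subsetI infinite_UNIV_nat finite_imageD)
      then obtain i j where ij: "i < j" "t i = t j"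
        unfolding inj_def by (metis linorder_neqE_nat)
      have pow: "x ^ k \<notin> I" for k
      proof (induction k)
        case 0
        show ?case using one_mem_imp_ring_of_integers[OF assms(1,2)] assms(3) by auto
      next
        case (Suc k)
        show ?case using assms(4)[OF xO ring_of_integers_simps(7)[OF xO], of k] x(2) Suc by auto
      qed
      have "x ^ i - x ^ j \<in> I"
        using fractional_ideal_closed(3)[OF assms(1) t(2)[of i] t(2)[of j]] ij(2) by simp
      moreover have "x ^ i - x ^ j = x ^ i * (1 - x ^ (j - i))"
        using ij(1) by (simp add: right_diff_distrib power_add[symmetric])
      moreover have "1 - x ^ (j - i) \<in> \<O>"
        using fractional_ideal_closed(3)[OF fractional_ideal_ring_of_integers ring_of_integers_simps(2) ring_of_integers_simps(7)[OF xO]] .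
      ultimately have "1 - x ^ (j - i) \<in> I"
        using assms(4)[OF ring_of_integers_simps(7)[OF xO], of "1 - x ^ (j - i)" i] pow[of i] by auto
      hence a: "1 - x ^ (j - i) \<in> Q" using Q(2) by blast
      have "x ^ (j - i - 1) * x \<in> Q"
        by (rule fractional_ideal_closed(4)[OF Q(1) ring_of_integers_simps(7)[OF xO] x(1)])
      moreover have "x ^ (j - i - 1) * x = x ^ (j - i)"
        using ij(1) by (metis power_minus_mult zero_less_diff)
      ultimately have "1 \<in> Q" using fractional_ideal_closed(2)[OF Q(1) a, of "x ^ (j - i)"] by simp
      with one_mem_imp_ring_of_integers[OF Q(1,3)] \<open>Q \<noteq> \<O>\<close> show False by simp
    qed
  qed
qed (use assms in auto)

definition ideal_prod :: "'f set list \<Rightarrow> 'f set" where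
  "ideal_prod Ps = foldr ideal_mult Ps \<O>"

lemma ideal_prod_simps: "ideal_prod [] = \<O>" "ideal_prod (P # Ps) = ideal_mult P (ideal_prod Ps)"
  by (simp_all add: ideal_prod_def)

lemma maximal_idealD:
  assumes "maximal_ideal P"
  shows "fractional_ideal P" "P \<subseteq> \<O>" "P \<noteq> \<O>"
    "fractional_ideal Q \<Longrightarrow> P \<subseteq> Q \<Longrightarrow> Q \<subseteq> \<O> \<Longrightarrow> Q = P \<or> Q = \<O>"
  using assms unfolding maximal_ideal_def by blast+

lemma ideal_prod_submodule:
  assumes "\<forall>P\<in>set Ps. maximal_ideal P"
  shows "OF_submodule (*) (ideal_prod Ps)"
  using assms
proof (induction Ps)
  case Nil
  show ?case unfolding ideal_prod_simps
    by (rule fractional_ideal_OF_submodule[OF fractional_ideal_ring_of_integers])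
next
  case (Cons P Ps)
  thus ?case unfolding ideal_prod_simps
    by (intro OF_submodule_ideal_mult fractional_ideal_OF_submodule maximal_idealD) simp
qed

lemma ideal_prod_append:
  assumes "\<forall>P\<in>set Ps. maximal_ideal P" "\<forall>P\<in>set Qs. maximal_ideal P"
  shows "ideal_prod (Ps @ Qs) = ideal_mult (ideal_prod Ps) (ideal_prod Qs)"
  using assms(1)
  by (induction Ps) (simp_all add: ideal_prod_simps ideal_mult_assoc ideal_mult_unit(1)[OF ideal_prod_submodule[OF assms(2)]])

lemma ideal_prod_remove1:
  "P \<in> set Ps \<Longrightarrow> ideal_prod Ps = ideal_mult P (ideal_prod (remove1 P Ps))"
proof (induction Ps)
  case (Cons Q Ps)
  show ?case
  proof (cases "P = Q")
    case False
    hence "ideal_prod (Q # Ps) = ideal_mult Q (ideal_mult P (ideal_prod (remove1 P Ps)))"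
      using Cons by (simp add: ideal_prod_simps)
    also have "\<dots> = ideal_mult P (ideal_mult Q (ideal_prod (remove1 P Ps)))"
      by (metis ideal_mult_assoc ideal_mult_commute)
    finally show ?thesis using False by (simp add: ideal_prod_simps)
  qed (simp add: ideal_prod_simps)
qed simp

text \<open>An ideal that is neither \<O> nor maximal is not prime. With \<open>x * y\<close> in
  \<open>I\<close> and both factors outside, the ideals generated by \<open>I\<close> with
  \<open>x\<close> and by \<open>I\<close> with \<open>y\<close> have smaller index, and their
  product lies in \<open>I\<close>.\<close>

lemma contains_product_of_maximal:
  assumes "fractional_ideal I" "I \<subseteq> \<O>"
  shows "\<exists>Ps. (\<forall>P\<in>set Ps. maximal_ideal P) \<and> ideal_prod Ps \<subseteq> I"
  using assms
proof (induction I rule: measure_induct_rule[of ideal_index])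
  case (less I)
  show ?case
  proof (cases "I = \<O> \<or> maximal_ideal I")
    case True
    thus ?thesis
    proof
      assume "I = \<O>"
      thus ?thesis by (intro exI[of _ "[]"]) (simp add: ideal_prod_simps)
    next
      assume "maximal_ideal I"
      thus ?thesis by (intro exI[of _ "[I]"])
        (simp add: ideal_prod_simps ideal_mult_unit(2)[OF fractional_ideal_OF_submodule[OF less.prems(1)]])
    qed
  next
    case False
    then obtain x y where xy: "x \<in> \<O>" "y \<in> \<O>" "x * y \<in> I" "x \<notin> I" "y \<notin> I"
      using prime_imp_maximal[OF less.prems] by blast
    have step: "\<exists>Ps. (\<forall>P\<in>set Ps. maximal_ideal P) \<and> ideal_prod Ps \<subseteq> {p + c * z |p c. p \<in> I \<and> c \<in> \<O>}"
      if z: "z \<in> \<O>" "z \<notin> I" for z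
    proof -
      let ?A = "{p + c * z |p c. p \<in> I \<and> c \<in> \<O>}"
      note A = fractional_ideal_add_principal[OF less.prems(1) fractional_ideal_ring_of_integers less.prems(2) z(1)]
      note B = add_principal_sup[OF less.prems(1), where x = z]
      have ne: "I \<noteq> ?A" using B(2) z(2) by (metis (lifting))
      show ?thesis
        by (rule less.IH[OF ideal_index_less[OF A(1) less.prems(1) B(1) ne A(2)] A])
    qed
    obtain Ps where Ps: "\<forall>P\<in>set Ps. maximal_ideal P" "ideal_prod Ps \<subseteq> {p + c * x |p c. p \<in> I \<and> c \<in> \<O>}"
      using step[OF xy(1,4)] by blast
    obtain Qs where Qs: "\<forall>P\<in>set Qs. maximal_ideal P" "ideal_prod Qs \<subseteq> {p + c * y |p c. p \<in> I \<and> c \<in> \<O>}"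
      using step[OF xy(2,5)] by blast
    have "ideal_prod (Ps @ Qs) \<subseteq> I"
      unfolding ideal_prod_append[OF Ps(1) Qs(1)]
    proof (rule ideal_mult_least[OF fractional_ideal_subspace[OF less.prems(1)]])
      fix v w assume "v \<in> ideal_prod Ps" "w \<in> ideal_prod Qs"
      then obtain p c q d where vw: "v = p + c * x" "w = q + d * y" "p \<in> I" "c \<in> \<O>" "q \<in> I" "d \<in> \<O>"
        using Ps(2) Qs(2) by blast
      have eq: "v * w = w * p + ((c * x) * q + (c * d) * (x * y))" by (simp add: vw algebra_simps)
      have "w \<in> \<O>" using vw xy less.prems(2) by (auto intro!: ring_of_integers_simps(4,5))
      note cl = fractional_ideal_closed(2,4)[OF less.prems(1)]
      have "w * p \<in> I" by (rule cl(2)[OF \<open>w \<in> \<O>\<close> vw(3)])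
      moreover have "(c * x) * q \<in> I" by (rule cl(2)[OF ring_of_integers_simps(5)[OF vw(4) xy(1)] vw(5)])
      moreover have "(c * d) * (x * y) \<in> I" by (rule cl(2)[OF ring_of_integers_simps(5)[OF vw(4,6)] xy(3)])
      ultimately show "v * w \<in> I" using cl(1) eq by (simp only:)
    qed
    thus ?thesis using Ps(1) Qs(1) by (intro exI[of _ "Ps @ Qs"]) auto
  qed
qed

lemma maximal_imp_prime:
  assumes "maximal_ideal P" "x \<in> \<O>" "y \<in> \<O>" "x * y \<in> P" "x \<notin> P"
  shows "y \<in> P"
proof -
  note P = maximal_idealD[OF assms(1)]
  let ?A = "{p + c * x |p c. p \<in> P \<and> c \<in> \<O>}"
  note A = fractional_ideal_add_principal[OF P(1) fractional_ideal_ring_of_integers P(2) assms(2)]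
  note B = add_principal_sup[OF P(1), where x = x]
  have "?A \<noteq> P" using B(2) assms(5) by (metis (lifting))
  hence "?A = \<O>" using P(4)[OF A(1) B(1) A(2)] by blast
  hence "1 \<in> ?A" using ring_of_integers_simps(2) by blast
  then obtain p c where pc: "1 = p + c * x" "p \<in> P" "c \<in> \<O>" by blast
  have "y = y * p + c * (x * y)" using pc(1) by (metis distrib_right mult.assoc mult.commute mult_1)
  thus ?thesis using fractional_ideal_closed(2,4)[OF P(1)] pc assms by metis
qed

text \<open>If the first factor lies in \<open>P\<close>, the two agree by maximality. Otherwise an
  element of that factor outside \<open>P\<close> forces, by primality, the remaining product into
  \<open>P\<close>.\<close>

lemma maximal_contains_product:
  assumes "maximal_ideal P" "\<forall>Q\<in>set Qs. maximal_ideal Q" "ideal_prod Qs \<subseteq> P"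
  shows "P \<in> set Qs"
  using assms(2,3)
proof (induction Qs)
  case Nil
  thus ?case using maximal_idealD[OF assms(1)] by (auto simp: ideal_prod_simps)
next
  case (Cons Q Qs)
  note P = maximal_idealD[OF assms(1)]
  have Q: "maximal_ideal Q" using Cons.prems by simp
  show ?case
  proof (cases "Q \<subseteq> P")
    case True
    thus ?thesis using maximal_idealD(4)[OF Q P(1) True P(2)] P(3) by simp
  next
    case False
    then obtain x where x: "x \<in> Q" "x \<notin> P" by blast
    have xO: "x \<in> \<O>" using x maximal_idealD(2)[OF Q] by blast
    have "ideal_prod Qs \<subseteq> P"
    proof
      fix y assume y: "y \<in> ideal_prod Qs"
      have "ideal_prod Qs \<subseteq> \<O>" using Cons.prems(1)
      proof (induction Qs)
        case (Cons R Rs)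
        hence "ideal_prod (R # Rs) \<subseteq> ideal_mult \<O> \<O>" unfolding ideal_prod_simps
          by (intro ideal_mult_mono) (auto dest: maximal_idealD(2))
        thus ?case
          using ideal_mult_unit(1)[OF fractional_ideal_OF_submodule[OF fractional_ideal_ring_of_integers[where 'f = 'f]]]
          by simp
      qed (simp add: ideal_prod_simps)
      with y have yO: "y \<in> \<O>" by blast
      have "x * y \<in> P" using Cons.prems(2) ideal_multI[OF x(1) y] by (auto simp: ideal_prod_simps)
      thus "y \<in> P" using maximal_imp_prime[OF assms(1) xO yO] x(2) by blast
    qed
    thus ?thesis using Cons by simp
  qed
qed

text \<open>Take a non-zero \<open>a\<close> in \<open>P\<close> and a shortest product of maximal
  ideals inside \<open>a\<close> times \<O>. The ideal \<open>P\<close> is one of the factors; by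
  minimality the product without it contains some \<open>b\<close> that is not a multiple of
  \<open>a\<close> in \<O>, and \<open>b / a\<close> is the witness.\<close>

lemma ex_nonintegral_inverse:
  assumes "maximal_ideal P"
  shows "\<exists>z. z \<notin> \<O> \<and> (\<forall>y\<in>P. z * y \<in> \<O>)"
proof -
  note P = maximal_idealD[OF assms]
  note O = fractional_ideal_ring_of_integers[where 'f = 'f]
  obtain a where a: "a \<in> P" "a \<noteq> 0" using fractional_ideal_nonzero[OF P(1)] .
  let ?aO = "(*) a ` \<O>"
  have aP: "?aO \<subseteq> P" using fractional_ideal_closed(4)[OF P(1) _ a(1)] by (auto simp: mult.commute)
  define R where "R Ps \<longleftrightarrow> (\<forall>P\<in>set Ps. maximal_ideal P) \<and> ideal_prod Ps \<subseteq> ?aO" for Ps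
  obtain Ps0 where "R Ps0"
    using contains_product_of_maximal[OF fractional_ideal_scale[OF O a(2)]] aP P(2) unfolding R_def by blast
  from ex_has_least_nat[of R, OF this, of length] obtain Ps
    where Ps: "R Ps" "\<And>Qs. R Qs \<Longrightarrow> length Ps \<le> length Qs" by blast
  have PPs: "P \<in> set Ps" using maximal_contains_product[OF assms, of Ps] Ps(1) aP unfolding R_def by blast
  let ?Qs = "remove1 P Ps"
  have "length ?Qs < length Ps" using PPs length_pos_if_in_set[OF PPs] by (simp add: length_remove1)
  hence "\<not> R ?Qs" using Ps(2) by (meson leD)
  moreover have "set ?Qs \<subseteq> set Ps" by (rule set_remove1_subset)
  ultimately have "\<not> ideal_prod ?Qs \<subseteq> ?aO" using Ps(1) unfolding R_def by blast
  then obtain b where b: "b \<in> ideal_prod ?Qs" "b \<notin> ?aO" by blast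
  have "b / a \<notin> \<O>"
  proof
    assume "b / a \<in> \<O>"
    hence "a * (b / a) \<in> ?aO" by (rule imageI)
    thus False using b(2) a(2) by simp
  qed
  moreover have "b / a * y \<in> \<O>" if y: "y \<in> P" for y
  proof -
    have "y * b \<in> ideal_prod Ps" unfolding ideal_prod_remove1[OF PPs] by (rule ideal_multI[OF y b(1)])
    then obtain c where "c \<in> \<O>" "y * b = a * c" using Ps(1) unfolding R_def by blast
    moreover from this(2) have "b / a * y = c" using a(2) by (simp add: field_simps)
    ultimately show ?thesis by simp
  qed
  ultimately show ?thesis by blast
qed

section \<open>Inverse ideals\<close>

lemma fractional_ideal_inverse:
  assumes "fractional_ideal (I :: 'f set)"
  shows "fractional_ideal (ideal_inverse I)"
  unfolding fractional_ideal_def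
proof (intro conjI)
  show "OF_submodule (*) (ideal_inverse I)"
    unfolding OF_submodule_def ideal_inverse_def
    by (auto simp: distrib_right mult.assoc ring_of_integers_simps(1,4,5))
  obtain d where d: "d \<in> \<O>" "d \<noteq> 0" "\<forall>x\<in>I. d * x \<in> \<O>"
    using assms by (auto simp: fractional_ideal_def)
  thus "ideal_inverse I \<noteq> {0}" unfolding ideal_inverse_def by blast
  obtain y where y: "y \<in> I" "y \<noteq> 0" using fractional_ideal_nonzero[OF assms] .
  obtain k where k: "k > 0" "of_int k * y \<in> \<O>" using ex_int_multiple .
  have "of_int k * y * x \<in> \<O>" if "x \<in> ideal_inverse I" for x
  proof -
    have "x * y \<in> \<O>" using that y(1) by (simp add: ideal_inverse_def)
    hence "of_int k * (x * y) \<in> \<O>" by (rule ring_of_integers_simps(5)[OF ring_of_integers_simps(3)])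
    thus ?thesis by (simp add: mult_ac)
  qed
  moreover have "of_int k * y \<noteq> 0" using k y by simp
  ultimately show "\<exists>d\<in>\<O>. d \<noteq> 0 \<and> (\<forall>x\<in>ideal_inverse I. d * x \<in> \<O>)" using k(2) by blast
qed

lemma ideal_mult_inverse_subset: "ideal_mult I (ideal_inverse I) \<subseteq> (\<O> :: 'f set)"
proof (rule ideal_mult_least[OF subspace_ring_of_integers])
  fix x y :: 'f assume "x \<in> I" "y \<in> ideal_inverse I"
  hence "y * x \<in> \<O>" by (simp add: ideal_inverse_def)
  thus "x * y \<in> \<O>" by (simp only: mult.commute)
qed

lemma one_mem_ideal_inverse: "I \<subseteq> \<O> \<Longrightarrow> 1 \<in> ideal_inverse (I :: 'f set)"
  by (auto simp: ideal_inverse_def)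

lemma subset_mult_inverse:
  assumes "P \<subseteq> (\<O> :: 'f set)"
  shows "I \<subseteq> ideal_mult I (ideal_inverse P)"
  using ideal_multI[OF _ one_mem_ideal_inverse[OF assms]] by fastforce

text \<open>Equality would make \<open>I\<close> stable under the non-integral element of the
  inverse found above, contrary to \<open>fractional_ideal_stable\<close>.\<close>

lemma maximal_mult_inverse_ne:
  assumes "maximal_ideal P" "fractional_ideal I"
  shows "ideal_mult I (ideal_inverse P) \<noteq> I"
proof
  assume e: "ideal_mult I (ideal_inverse P) = I"
  obtain z where z: "z \<notin> \<O>" "\<forall>y\<in>P. z * y \<in> \<O>" using ex_nonintegral_inverse[OF assms(1)] by blast
  have "z * y \<in> I" if "y \<in> I" for y
    using ideal_multI[OF that, of z "ideal_inverse P"] z(2) e by (simp add: ideal_inverse_def mult.commute)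
  from fractional_ideal_stable[OF assms(2) this] z(1) show False by simp
qed

lemma maximal_mult_inverse:
  assumes "maximal_ideal P"
  shows "ideal_mult P (ideal_inverse P) = \<O>"
proof -
  note P = maximal_idealD[OF assms]
  show ?thesis
    using P(4)[OF fractional_ideal_mult[OF P(1) fractional_ideal_inverse[OF P(1)]] subset_mult_inverse[OF P(2)]
        ideal_mult_inverse_subset] maximal_mult_inverse_ne[OF assms P(1)] by blast
qed

text \<open>For a maximal \<open>P\<close> above \<open>I\<close>, the product of \<open>I\<close>
  with the inverse of \<open>P\<close> is still integral but strictly larger than \<open>I\<close>,
  so the induction on the index applies to it.\<close>

lemma integral_ideal_invertible:
  assumes "fractional_ideal (I :: 'f set)" "I \<subseteq> \<O>"
  shows "\<exists>J. fractional_ideal J \<and> ideal_mult I J = \<O>"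
  using assms
proof (induction I rule: measure_induct_rule[of ideal_index])
  case (less I)
  note O = fractional_ideal_ring_of_integers[where 'f = 'f]
  show ?case
  proof (cases "I = \<O>")
    case True
    show ?thesis unfolding True
      by (intro exI[of _ \<O>] conjI fractional_ideal_ring_of_integers ideal_mult_unit(1)
          fractional_ideal_OF_submodule)
  next
    case False
    then obtain P where P: "maximal_ideal P" "I \<subseteq> P" using ex_maximal_ideal less.prems by blast
    note Pi = fractional_ideal_inverse[OF maximal_idealD(1)[OF P(1)]]
    let ?I = "ideal_mult I (ideal_inverse P)"
    have I: "fractional_ideal ?I" by (rule fractional_ideal_mult[OF less.prems(1) Pi])
    have "?I \<subseteq> ideal_mult P (ideal_inverse P)" by (rule ideal_mult_mono[OF P(2) subset_refl])
    hence IO: "?I \<subseteq> \<O>" using ideal_mult_inverse_subset by blast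
    have "ideal_index ?I < ideal_index I"
      using maximal_mult_inverse_ne[OF P(1) less.prems(1)]
      by (intro ideal_index_less[OF I less.prems(1) subset_mult_inverse[OF maximal_idealD(2)[OF P(1)]] _ IO]) simp
    from less.IH[OF this I IO] obtain J where J: "fractional_ideal J" "ideal_mult ?I J = \<O>" by blast
    show ?thesis
      using J(2) fractional_ideal_mult[OF Pi J(1)] unfolding ideal_mult_assoc by blast
  qed
qed

lemma ideal_mult_scale: "ideal_mult ((*) d ` I) J = (*) d ` ideal_mult I (J :: 'f set)"
proof -
  have "{x * y |x y. x \<in> (*) d ` I \<and> y \<in> J} = (*) d ` {x * y |x y. x \<in> I \<and> y \<in> J}"
  proof safe
    fix x y assume "x \<in> I" "y \<in> J"
    thus "d * x * y \<in> (*) d ` {x * y |x y. x \<in> I \<and> y \<in> J}"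
      by (intro image_eqI[of _ _ "x * y"]) (auto simp: mult.assoc)
  next
    fix x y assume "x \<in> I" "y \<in> J"
    thus "\<exists>x' y'. d * (x * y) = x' * y' \<and> x' \<in> (*) d ` I \<and> y' \<in> J"
      by (intro exI[of _ "d * x"] exI[of _ y]) (auto simp: mult.assoc)
  qed
  hence "ideal_mult ((*) d ` I) J = module.span (\<lambda>n x. of_int n * x) ((*) d ` {x * y |x y. x \<in> I \<and> y \<in> J})"
    unfolding ideal_mult_def by (simp only:)
  also have "\<dots> = (*) d ` ideal_mult I J" unfolding ideal_mult_def
  proof -
    interpret module_hom "\<lambda>n (x::'f). of_int n * x" "\<lambda>n (x::'f). of_int n * x" "(*) d"
      by unfold_locales (auto simp: algebra_simps)
    show "module.span (\<lambda>n x. of_int n * x) ((*) d ` {x * y |x y. x \<in> I \<and> y \<in> J}) =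
      (*) d ` module.span (\<lambda>n x. of_int n * x) {x * y |x y. x \<in> I \<and> y \<in> J}"
      by (rule span_image)
  qed
  finally show ?thesis .
qed

text \<open>Any ideal \<open>J\<close> with product \<O> is contained in
  \<open>ideal_inverse I\<close>, so the existence of some inverse, obtained after scaling
  \<open>I\<close> into \<O>, already settles the matter for this one.\<close>

theorem ideal_mult_inverse:
  assumes "fractional_ideal (I :: 'f set)"
  shows "ideal_mult I (ideal_inverse I) = \<O>"
proof -
  obtain d where d: "d \<in> \<O>" "d \<noteq> 0" "\<forall>x\<in>I. d * x \<in> \<O>"
    using assms by (auto simp: fractional_ideal_def)
  have "(*) d ` I \<subseteq> \<O>" using d(3) by auto
  from integral_ideal_invertible[OF fractional_ideal_scale[OF assms d(2)] this]
  obtain J where J: "fractional_ideal J" "ideal_mult ((*) d ` I) J = \<O>" by blast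
  have K: "ideal_mult I ((*) d ` J) = \<O>"
    using J(2) by (simp only: ideal_mult_scale ideal_mult_commute[of I])
  have "(*) d ` J \<subseteq> ideal_inverse I"
    unfolding ideal_inverse_def
  proof safe
    fix x y assume "x \<in> J" "y \<in> I"
    hence "y * (d * x) \<in> ideal_mult I ((*) d ` J)" by (intro ideal_multI imageI)
    thus "d * x * y \<in> \<O>" unfolding K by (simp add: mult_ac)
  qed
  hence "\<O> \<subseteq> ideal_mult I (ideal_inverse I)" using ideal_mult_mono[OF subset_refl] K by blast
  thus ?thesis using ideal_mult_inverse_subset by blast
qed

lemma ideal_mult_cancel:
  assumes "fractional_ideal I" "OF_submodule (*) J" "OF_submodule (*) K" "ideal_mult I J = ideal_mult I K"
  shows "J = (K :: 'f set)"
proof -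
  have "ideal_mult (ideal_inverse I) (ideal_mult I L) = L" if "OF_submodule (*) L" for L
    by (simp add: ideal_mult_assoc[symmetric] ideal_mult_commute[of "ideal_inverse I"]
        ideal_mult_inverse[OF assms(1)] ideal_mult_unit(1)[OF that])
  thus ?thesis using assms(2-4) by metis
qed

text \<open>For \<open>x \<in> I - IP\<close> multiplication by \<open>x\<close> is an isomorphism \<open>\<O>/P \<cong> I/IP\<close>, since there is no
  ideal strictly between \<open>IP\<close> and \<open>I\<close>.\<close>

lemma ideal_vol_mult_maximal:
  assumes P: "maximal_ideal P" and I: "fractional_ideal I"
  shows "ideal_vol (ideal_mult I P) * ideal_vol \<O> = ideal_vol I * ideal_vol P"
proof -
  note O = fractional_ideal_ring_of_integers[where 'f = 'f]
  note Pd = maximal_idealD[OF P]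
  note subI = fractional_ideal_OF_submodule[OF I]
  let ?IP = "ideal_mult I P"
  have IP: "fractional_ideal ?IP" by (rule fractional_ideal_mult[OF I Pd(1)])
  have IPI: "?IP \<subseteq> I"
    using ideal_mult_mono[OF subset_refl Pd(2), of I] ideal_mult_unit(2)[OF subI] by simp
  have "?IP \<noteq> I"
  proof
    assume "?IP = I"
    hence "ideal_mult I P = ideal_mult I \<O>" by (simp add: ideal_mult_unit(2)[OF subI])
    from ideal_mult_cancel[OF I _ _ this] fractional_ideal_OF_submodule Pd(1,3) O show False by blast
  qed
  then obtain x where x: "x \<in> I" "x \<notin> ?IP" using IPI by blast
  let ?A = "{p + c * x |p c. p \<in> ?IP \<and> c \<in> \<O>}"
  note A = fractional_ideal_add_principal[OF IP I IPI x(1)]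
  note B = add_principal_sup[OF IP, where x = x]
  \<comment> \<open>Multiplication by the inverse of \<open>I\<close> moves \<open>?A\<close>, which
    lies between \<open>?IP\<close> and \<open>I\<close>, to an ideal between \<open>P\<close> and
    \<O>, where maximality leaves only the two ends.\<close>
  have AI: "?A = I"
  proof -
    let ?Q = "ideal_mult ?A (ideal_inverse I)"
    have Q: "fractional_ideal ?Q" by (rule fractional_ideal_mult[OF A(1) fractional_ideal_inverse[OF I]])
    have QO: "?Q \<subseteq> \<O>"
      using ideal_mult_mono[OF A(2) subset_refl, of "ideal_inverse I"] ideal_mult_inverse[OF I] by simp
    have QI: "ideal_mult ?Q I = ?A"
      by (simp only: ideal_mult_assoc ideal_mult_commute[of "ideal_inverse I"] ideal_mult_inverse[OF I]
          ideal_mult_unit(2)[OF fractional_ideal_OF_submodule[OF A(1)]])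
    have PIP: "ideal_mult ?IP (ideal_inverse I) = P"
      by (metis I Pd(1) fractional_ideal_OF_submodule ideal_mult_assoc ideal_mult_commute ideal_mult_inverse ideal_mult_unit(1))
    have "P \<subseteq> ?Q" using ideal_mult_mono[OF B(1) subset_refl, of "ideal_inverse I"] PIP by simp
    from Pd(4)[OF Q this QO] show ?thesis
    proof
      assume "?Q = P"
      hence "?A = ideal_mult P I" using QI by simp
      hence "?A = ?IP" by (simp add: ideal_mult_commute)
      with B(2) x(2) show ?thesis by blast
    next
      assume "?Q = \<O>"
      thus ?thesis using QI ideal_mult_unit(1)[OF subI] by simp
    qed
  qed
  \<comment> \<open>Injectivity modulo \<open>P\<close>: for \<open>c\<close> outside
    \<open>P\<close> one can write \<open>1 = p + d * c\<close>, and then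
    \<open>x = x * p + d * (c * x)\<close> would lie in \<open>?IP\<close>.\<close>
  have ker: "c \<in> P" if c: "c \<in> \<O>" "c * x \<in> ?IP" for c
  proof (rule ccontr)
    assume cP: "c \<notin> P"
    let ?C = "{p + d * c |p d. p \<in> P \<and> d \<in> \<O>}"
    note C = fractional_ideal_add_principal[OF Pd(1) O Pd(2) c(1)]
    note D = add_principal_sup[OF Pd(1), where x = c]
    have "?C \<noteq> P" using D(2) cP by (metis (lifting))
    hence "?C = \<O>" using Pd(4)[OF C(1) D(1) C(2)] by blast
    then obtain p d where pd: "1 = p + d * c" "p \<in> P" "d \<in> \<O>" using ring_of_integers_simps(2) by blast
    have "x = x * p + d * (c * x)" using pd(1) by (metis distrib_left mult.assoc mult.commute mult_1_right)
    moreover have "x * p + d * (c * x) \<in> ?IP"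
      by (intro fractional_ideal_closed(2,4)[OF IP] ideal_multI x pd c)
    ultimately show False using x(2) by simp
  qed
  obtain bs where bs: "F.zbasis (\<O> :: 'f set) bs" "length bs = deg" using fractional_ideal_zbasis[OF O] .
  obtain cs where cs: "F.zbasis P cs" "length cs = deg" using fractional_ideal_zbasis[OF Pd(1)] .
  obtain T where T: "finite T" "F.transversal \<O> P T"
    using F.zbasis_transversal[OF bs(1) cs(1) Pd(2)] bs(2) cs(2) by auto
  have T': "F.transversal I ?IP ((\<lambda>t. t * x) ` T)" unfolding F.transversal_def
  proof (intro conjI ballI impI)
    have TO: "T \<subseteq> \<O>" using T(2) by (simp add: F.transversal_def)
    show "(\<lambda>t. t * x) ` T \<subseteq> I" using TO fractional_ideal_closed(4)[OF I _ x(1)] by blast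
    show "\<exists>t\<in>(\<lambda>t. t * x) ` T. y - t \<in> ?IP" if y: "y \<in> I" for y
    proof -
      from y AI obtain p c where pc: "y = p + c * x" "p \<in> ?IP" "c \<in> \<O>" by blast
      obtain t where t: "t \<in> T" "c - t \<in> P" using T(2) pc(3) by (auto simp: F.transversal_def)
      have "y - t * x = p + x * (c - t)" by (simp add: pc algebra_simps)
      also have "\<dots> \<in> ?IP" by (intro fractional_ideal_closed(2)[OF IP] pc ideal_multI x t)
      finally show ?thesis using t(1) by blast
    qed
    fix s s' assume ss: "s \<in> (\<lambda>t. t * x) ` T" "s' \<in> (\<lambda>t. t * x) ` T" "s - s' \<in> ?IP"
    then obtain t t' where t: "t \<in> T" "t' \<in> T" "s = t * x" "s' = t' * x" by blast
    have "(t - t') * x \<in> ?IP" using ss(3) t by (simp add: left_diff_distrib)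
    moreover have "t - t' \<in> \<O>" using t TO by (intro fractional_ideal_closed(3)[OF O]) auto
    ultimately have "t - t' \<in> P" using ker by blast
    thus "s = s'" using t T(2) by (auto simp: F.transversal_def)
  qed
  have "x \<noteq> 0" using x(2) fractional_ideal_closed(1)[OF IP] by auto
  hence inj: "inj_on (\<lambda>t. t * x) T" by (simp add: inj_on_def)
  have "card (I // index_rel I ?IP) = card ((\<lambda>t. t * x) ` T)"
    using bij_betw_same_card[OF F.card_quotient_transversal[OF fractional_ideal_subspace[OF IP] T']]
    by (simp add: index_rel_def)
  also have "\<dots> = card T" by (rule card_image[OF inj])
  also have "\<dots> = card (\<O> // index_rel \<O> P)"
    using bij_betw_same_card[OF F.card_quotient_transversal[OF fractional_ideal_subspace[OF Pd(1)] T(2)]]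
    by (simp add: index_rel_def)
  finally show ?thesis
    using ideal_vol_index[OF I IP IPI] ideal_vol_index[OF O Pd(1,2)] by simp
qed

text \<open>A maximal factor \<open>P\<close> is split off \<open>K\<close>, leaving
  \<open>?K\<close> of smaller index. The induction keeps \<open>I\<close> arbitrary because the
  hypothesis is used twice, for the product of \<open>I\<close> and \<open>P\<close> and for
  \<open>P\<close> itself.\<close>

lemma ideal_vol_mult_integral:
  assumes "fractional_ideal K" "K \<subseteq> \<O>" "fractional_ideal I"
  shows "ideal_vol (ideal_mult I K) * ideal_vol \<O> = ideal_vol I * ideal_vol K"
  using assms
proof (induction K arbitrary: I rule: measure_induct_rule[of ideal_index])
  case (less K)
  note O = fractional_ideal_ring_of_integers[where 'f = 'f]
  show ?case
  proof (cases "K = \<O>")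
    case True
    thus ?thesis by (simp add: ideal_mult_unit(2)[OF fractional_ideal_OF_submodule[OF less.prems(3)]])
  next
    case False
    then obtain P where P: "maximal_ideal P" "K \<subseteq> P" using ex_maximal_ideal less.prems by blast
    note Pd = maximal_idealD[OF P(1)]
    note Pi = fractional_ideal_inverse[OF Pd(1)]
    let ?K = "ideal_mult K (ideal_inverse P)"
    have K: "fractional_ideal ?K" by (rule fractional_ideal_mult[OF less.prems(1) Pi])
    have "?K \<subseteq> ideal_mult P (ideal_inverse P)" by (rule ideal_mult_mono[OF P(2) subset_refl])
    hence KO: "?K \<subseteq> \<O>" using ideal_mult_inverse_subset by blast
    have idx: "ideal_index ?K < ideal_index K"
      using maximal_mult_inverse_ne[OF P(1) less.prems(1)]
      by (intro ideal_index_less[OF K less.prems(1) subset_mult_inverse[OF Pd(2)] _ KO]) simp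
    have PK: "ideal_mult P ?K = K"
      by (metis P(1) fractional_ideal_OF_submodule ideal_mult_assoc ideal_mult_commute ideal_mult_unit(1) less.prems(1)
          maximal_mult_inverse)
    have IP: "fractional_ideal (ideal_mult I P)" by (rule fractional_ideal_mult[OF less.prems(3) Pd(1)])
    have 1: "ideal_vol (ideal_mult (ideal_mult I P) ?K) * ideal_vol \<O> = ideal_vol (ideal_mult I P) * ideal_vol ?K"
      by (rule less.IH[OF idx K KO IP])
    have 2: "ideal_vol (ideal_mult P ?K) * ideal_vol \<O> = ideal_vol P * ideal_vol ?K"
      by (rule less.IH[OF idx K KO Pd(1)])
    have 3: "ideal_vol (ideal_mult I P) * ideal_vol \<O> = ideal_vol I * ideal_vol P"
      by (rule ideal_vol_mult_maximal[OF P(1) less.prems(3)])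
    have "ideal_vol (ideal_mult I K) * ideal_vol \<O> = ideal_vol (ideal_mult I P) * ideal_vol ?K"
      using 1 unfolding ideal_mult_assoc PK .
    hence "ideal_vol (ideal_mult I K) * ideal_vol \<O> * ideal_vol \<O> = (ideal_vol (ideal_mult I P) * ideal_vol \<O>) * ideal_vol ?K"
      by (simp add: mult_ac)
    also have "\<dots> = ideal_vol I * (ideal_vol P * ideal_vol ?K)" by (simp only: 3 mult.assoc)
    also have "\<dots> = ideal_vol I * ideal_vol K * ideal_vol \<O>" unfolding 2[symmetric] PK by (simp add: mult_ac)
    finally show ?thesis using ideal_vol_pos[OF O] by simp
  qed
qed

text \<open>Scaling \<open>K\<close> into \<O> by \<open>d\<close> multiplies both sides by
  \<open>abs_norm d\<close>.\<close>

lemma ideal_vol_mult: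
  assumes "fractional_ideal I" "fractional_ideal K"
  shows "ideal_vol (ideal_mult I K) * ideal_vol \<O> = ideal_vol I * ideal_vol K"
proof -
  obtain d where d: "d \<in> \<O>" "d \<noteq> 0" "\<forall>x\<in>K. d * x \<in> \<O>"
    using assms by (auto simp: fractional_ideal_def)
  let ?K = "(*) d ` K"
  have "?K \<subseteq> \<O>" using d(3) by auto
  from ideal_vol_mult_integral[OF fractional_ideal_scale[OF assms(2) d(2)] this assms(1)]
  have "ideal_vol (ideal_mult I ?K) * ideal_vol \<O> = ideal_vol I * ideal_vol ?K" .
  moreover have "ideal_mult I ?K = (*) d ` ideal_mult I K"
    by (simp only: ideal_mult_commute[of I] ideal_mult_scale)
  hence "ideal_vol (ideal_mult I ?K) = abs_norm d * ideal_vol (ideal_mult I K)"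
    using ideal_vol_scale[OF fractional_ideal_mult[OF assms] d(2)] by (simp only:)
  moreover have "ideal_vol ?K = abs_norm d * ideal_vol K" by (rule ideal_vol_scale[OF assms(2) d(2)])
  ultimately have "abs_norm d * (ideal_vol (ideal_mult I K) * ideal_vol \<O>) = abs_norm d * (ideal_vol I * ideal_vol K)"
    by (simp only: mult.assoc mult.left_commute)
  thus ?thesis using abs_norm_pos[OF d(2)] by simp
qed

theorem ideal_norm_mult:
  assumes "fractional_ideal (I :: 'f set)" "fractional_ideal K"
  shows "ideal_norm (ideal_mult I K) = ideal_norm I * ideal_norm K"
proof -
  have "ideal_vol (\<O> :: 'f set) > 0" by (rule ideal_vol_pos[OF fractional_ideal_ring_of_integers])
  thus ?thesis using ideal_vol_mult[OF assms] fractional_ideal_mult[OF assms] assms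
    by (simp add: ideal_norm_eq field_simps)
qed

end

section \<open>Covolumes of lattices\<close>

text \<open>Additivity is all that a change of Z-basis uses, since an additive map commutes with
  integer scaling.\<close>

locale biadditive =
  fixes ip :: "'v::ab_group_add \<Rightarrow> 'v \<Rightarrow> real"
  assumes add_left: "ip (x + y) z = ip x z + ip y z"
    and add_right: "ip z (x + y) = ip z x + ip z y"

definition gram :: "('v \<Rightarrow> 'v \<Rightarrow> real) \<Rightarrow> 'v list \<Rightarrow> real mat" where
  "gram ip bs = Matrix.mat (length bs) (length bs) (\<lambda>(i, j). ip (bs ! i) (bs ! j))"

lemma gram_carrier [simp]: "gram ip bs \<in> carrier_mat (length bs) (length bs)"
  by (simp add: gram_def)

context rat_space
begin

lemma additive_zs:
  fixes f :: "'v \<Rightarrow> real"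
  assumes "\<And>x y. f (x + y) = f x + f y"
  shows "f (zs n x) = of_int n * f x"
proof (induction n rule: int_induct[where k = 0])
  case base
  have "f (0 + 0) = f 0 + f 0" by (rule assms)
  thus ?case by simp
next
  case (step1 i)
  thus ?case by (simp add: Z.scale_left_distrib assms distrib_right)
next
  case (step2 i)
  have "f (zs (i - 1) x + x) = f (zs (i - 1) x) + f x" by (rule assms)
  moreover have "zs (i - 1) x + x = zs i x" by (simp add: Z.scale_left_diff_distrib)
  ultimately show ?case using step2 by (simp add: algebra_simps)
qed

lemma additive_zcomb:
  fixes f :: "'v \<Rightarrow> real"
  assumes "\<And>x y. f (x + y) = f x + f y"
  shows "f (zcomb c bs) = (\<Sum>i<length bs. of_int (c i) * f (bs ! i))"
proof -
  have "f (0 + 0) = f 0 + f 0" by (rule assms)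
  hence "f (sum g I) = (\<Sum>i\<in>I. f (g i))" for g and I :: "nat set"
    by (induction I rule: infinite_finite_induct) (auto simp: assms)
  thus ?thesis by (simp add: zcomb_def additive_zs[of f, OF assms])
qed

lemma gram_coords:
  assumes "biadditive ip" "A \<in> carrier_mat (length bs) (length cs)"
    "\<And>j. j < length cs \<Longrightarrow> cs ! j = zcomb (\<lambda>i. A $$ (i, j)) bs"
  shows "gram ip cs = transpose_mat (map_mat of_int A) * (gram ip bs * map_mat of_int A)"
proof (rule eq_matI)
  interpret biadditive ip by fact
  let ?B = "map_mat of_int A :: real mat"
  have B: "?B \<in> carrier_mat (length bs) (length cs)" using assms(2) by simp
  fix i j assume "i < dim_row (transpose_mat ?B * (gram ip bs * ?B))"
    "j < dim_col (transpose_mat ?B * (gram ip bs * ?B))"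
  hence i: "i < length cs" and j: "j < length cs" using B by auto
  have "gram ip cs $$ (i, j) = ip (zcomb (\<lambda>k. A $$ (k, i)) bs) (zcomb (\<lambda>l. A $$ (l, j)) bs)"
    using i j by (simp add: gram_def assms(3))
  also have "\<dots> = (\<Sum>k<length bs. of_int (A $$ (k, i)) * ip (bs ! k) (zcomb (\<lambda>l. A $$ (l, j)) bs))"
    by (rule additive_zcomb[of "\<lambda>x. ip x _"]) (rule add_left)
  also have "\<dots> = (\<Sum>k<length bs. of_int (A $$ (k, i)) * (\<Sum>l<length bs. ip (bs ! k) (bs ! l) * of_int (A $$ (l, j))))"
    by (intro sum.cong refl arg_cong[where f = "(*) _"])
      (simp add: additive_zcomb[of "\<lambda>y. ip _ y", OF add_right] mult.commute)
  also have "\<dots> = (\<Sum>k<length bs. of_int (A $$ (k, i)) * (gram ip bs * ?B) $$ (k, j))"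
    using j assms(2) by (intro sum.cong refl arg_cong[where f = "(*) _"])
      (simp add: gram_def scalar_prod_def atLeast0LessThan)
  also have "\<dots> = (transpose_mat ?B * (gram ip bs * ?B)) $$ (i, j)"
  proof -
    have "(transpose_mat ?B * (gram ip bs * ?B)) $$ (i, j) = Matrix.row (transpose_mat ?B) i \<bullet> Matrix.col (gram ip bs * ?B) j"
      using i j B by (intro index_mult_mat) auto
    also have "\<dots> = (\<Sum>k<length bs. vec_index (Matrix.row (transpose_mat ?B) i) k * vec_index (Matrix.col (gram ip bs * ?B) j) k)"
      by (simp add: scalar_prod_def atLeast0LessThan gram_def)
    also have "\<dots> = (\<Sum>k<length bs. of_int (A $$ (k, i)) * (gram ip bs * ?B) $$ (k, j))"
      using i j assms(2) by (intro sum.cong) (auto simp: gram_def)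
    finally show ?thesis ..
  qed
  finally show "gram ip cs $$ (i, j) = (transpose_mat ?B * (gram ip bs * ?B)) $$ (i, j)" .
qed (use assms(2) in \<open>auto simp: gram_def\<close>)

lemma det_gram_coords:
  assumes "biadditive ip" "A \<in> carrier_mat (length bs) (length cs)" "length bs = length cs"
    "\<And>j. j < length cs \<Longrightarrow> cs ! j = zcomb (\<lambda>i. A $$ (i, j)) bs"
  shows "Determinant.det (gram ip cs) = (of_int (Determinant.det A))\<^sup>2 * Determinant.det (gram ip bs)"
proof -
  let ?n = "length cs"
  let ?B = "map_mat of_int A :: real mat"
  have B: "?B \<in> carrier_mat ?n ?n" using assms(2,3) by simp
  have G: "gram ip bs \<in> carrier_mat ?n ?n" using gram_carrier[of ip bs] assms(3) by simp
  have e: "gram ip cs = transpose_mat ?B * (gram ip bs * ?B)"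
    by (rule gram_coords[OF assms(1,2,4)])
  have "Determinant.det (gram ip cs) = Determinant.det (transpose_mat ?B) * (Determinant.det (gram ip bs) * Determinant.det ?B)"
    unfolding e using det_mult[of "transpose_mat ?B" ?n "gram ip bs * ?B"] det_mult[OF G B] B G by simp
  thus ?thesis using Determinant.det_transpose[OF B] by (simp add: of_int_hom.hom_det power2_eq_square)
qed

end

global_interpretation V: rat_space "\<lambda>q (v::'f::field_char_0 ^ 'n). of_rat q *s v" "\<lambda>n v. of_int n *s v"
  by unfold_locales (simp_all add: vec_eq_iff algebra_simps of_rat_add of_rat_mult)

lemma covolume_eq:
  fixes ip :: "'f::field_char_0 ^ 2 \<Rightarrow> 'f ^ 2 \<Rightarrow> real"
  assumes "biadditive ip" "V.zbasis L bs"
  shows "covolume ip L = sqrt (Determinant.det (gram ip bs))"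
proof -
  define cs where "cs = (SOME bs. int_basis (\<lambda>n v. of_int n *s v) L bs)"
  have cs: "V.zbasis L cs" using someI[of "V.zbasis L"] assms(2) unfolding cs_def V.int_basis_iff by blast
  have len: "length bs = length cs" using V.zbasis_length[OF cs] V.zbasis_length[OF assms(2)] by simp
  have "set cs \<subseteq> L" using V.zbasis_mem[OF cs] by (auto simp: in_set_conv_nth)
  from V.zbasis_coords[OF assms(2) this] obtain A where A: "A \<in> carrier_mat (length bs) (length cs)"
    "\<And>j. j < length cs \<Longrightarrow> cs ! j = V.zcomb (\<lambda>i. A $$ (i, j)) bs" by metis
  have "\<bar>Determinant.det A\<bar> = 1" by (rule V.zbasis_change_det[OF assms(2) cs len A])
  hence "(Determinant.det A)\<^sup>2 = 1" by (metis power2_abs one_power2)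
  hence "(real_of_int (Determinant.det A))\<^sup>2 = 1" by (metis of_int_1 of_int_power)
  hence "Determinant.det (gram ip cs) = Determinant.det (gram ip bs)"
    using V.det_gram_coords[OF assms(1) A(1) len A(2)] by simp
  moreover have "covolume ip L = sqrt (Determinant.det (gram ip cs))"
    unfolding covolume_def cs_def[symmetric] gram_def Let_def ..
  ultimately show ?thesis by simp
qed

text \<open>At equal rank the coordinate matrix of \<open>cs\<close> has a non-zero integer
  determinant, of absolute value at least 1. The sign assumption on the covolume matters because
  \<open>sqrt\<close> is negative on negative numbers.\<close>

lemma covolume_antimono:
  fixes ip :: "'f::field_char_0 ^ 2 \<Rightarrow> 'f ^ 2 \<Rightarrow> real"
  assumes "biadditive ip" "V.zbasis L bs" "V.zbasis K cs" "K \<subseteq> L" "length bs = length cs" "covolume ip L \<ge> 0"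
  shows "covolume ip L \<le> covolume ip K"
proof -
  have "set cs \<subseteq> K" using V.zbasis_mem[OF assms(3)] by (auto simp: in_set_conv_nth)
  hence "set cs \<subseteq> L" using assms(4) by (rule order.trans)
  from V.zbasis_coords[OF assms(2) this] obtain A where A: "A \<in> carrier_mat (length bs) (length cs)"
    "\<And>j. j < length cs \<Longrightarrow> cs ! j = V.zcomb (\<lambda>i. A $$ (i, j)) bs" by metis
  have "Determinant.det A \<noteq> 0"
    using V.zindep_coords_det_nonzero[OF _ A(1) assms(5) A(2)] assms(3) by (simp add: V.zbasis_def)
  hence d: "\<bar>real_of_int (Determinant.det A)\<bar> \<ge> 1" by linarith
  have "covolume ip K = sqrt ((of_int (Determinant.det A))\<^sup>2 * Determinant.det (gram ip bs))"
  proof -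
    have "Determinant.det (gram ip cs) = (of_int (Determinant.det A))\<^sup>2 * Determinant.det (gram ip bs)"
      by (rule V.det_gram_coords[OF assms(1) A(1) assms(5) A(2)])
    thus ?thesis using covolume_eq[OF assms(1,3)] by (simp only:)
  qed
  also have "\<dots> = \<bar>of_int (Determinant.det A)\<bar> * covolume ip L"
    unfolding covolume_eq[OF assms(1,2)] by (simp add: real_sqrt_mult)
  finally show ?thesis using mult_right_mono[OF d assms(6)] by simp
qed

section \<open>Places and local norms\<close>

lemma field_homI:
  assumes "f 0 = 0" "f 1 = 1" "\<And>x y. f (x + y) = f x + f y" "\<And>x y. f (x * y) = f x * f y"
  shows "field_hom f"
  by unfold_locales (use assms in auto)

lemma field_homD:
  assumes "field_hom f"
  shows "f 0 = 0" "f 1 = 1" "f (x + y) = f x + f y" "f (x * y) = f x * f y" "f (- x) = - f x"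
proof -
  interpret field_hom f by fact
  show "f 0 = 0" "f 1 = 1" "f (x + y) = f x + f y" "f (x * y) = f x * f y" "f (- x) = - f x"
    by (simp_all add: hom_distribs)
qed

text \<open>The square of the local norm, as in \<open>norm_complex\<close>.\<close>

definition norm_real :: "('f \<Rightarrow> real) \<Rightarrow> real ^ 2 ^ 2 \<Rightarrow> 'f ^ 2 \<Rightarrow> real" where
  "norm_real \<sigma> A v = inner (local_vector \<sigma> A v) (local_vector \<sigma> A v)"

definition norm_complex :: "('f \<Rightarrow> complex) \<Rightarrow> complex ^ 2 ^ 2 \<Rightarrow> 'f ^ 2 \<Rightarrow> real" where
  "norm_complex \<sigma> A v = (cmod (local_vector \<sigma> A v $ 1))\<^sup>2 + (cmod (local_vector \<sigma> A v $ 2))\<^sup>2"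

lemma local_vector_nth:
  "local_vector \<sigma> A v $ j = A $ 1 $ j * \<sigma> (v $ 1) + A $ 2 $ j * \<sigma> (v $ 2)"
  by (simp add: local_vector_def vector_matrix_mult_def sum_2)

lemma local_vector_add:
  "field_hom \<sigma> \<Longrightarrow> local_vector \<sigma> A (v + w) = local_vector \<sigma> A v + local_vector \<sigma> A w"
  by (simp add: vec_eq_iff local_vector_nth field_homD algebra_simps)

lemma local_vector_scale:
  "field_hom \<sigma> \<Longrightarrow> local_vector \<sigma> A (c *s v) = \<sigma> c *s local_vector \<sigma> A v"
  by (simp add: vec_eq_iff local_vector_nth field_homD algebra_simps)

lemma inner_local_scale:
  assumes "field_hom \<sigma>"
  shows "inner (local_vector \<sigma> A (c *s v)) (local_vector \<sigma> A (d *s v)) = \<sigma> c * \<sigma> d * norm_real \<sigma> A v"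
  by (simp add: local_vector_scale[OF assms] norm_real_def inner_vec_def sum_2 algebra_simps)

lemma hermitian_local_scale:
  assumes "field_hom \<sigma>"
  shows "hermitian (local_vector \<sigma> A (c *s v)) (local_vector \<sigma> A (d *s v)) =
    \<sigma> c * cnj (\<sigma> d) * of_real (norm_complex \<sigma> A v)"
proof -
  have "hermitian (local_vector \<sigma> A (c *s v)) (local_vector \<sigma> A (d *s v)) =
      \<sigma> c * cnj (\<sigma> d) * (local_vector \<sigma> A v $ 1 * cnj (local_vector \<sigma> A v $ 1) +
        local_vector \<sigma> A v $ 2 * cnj (local_vector \<sigma> A v $ 2))"
    by (simp add: local_vector_scale[OF assms] hermitian_def sum_2 algebra_simps)
  thus ?thesis by (simp only: norm_complex_def of_real_add complex_norm_square)
qed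

lemma norm_real_nonneg: "norm_real \<sigma> A v \<ge> 0"
  by (simp add: norm_real_def)

text \<open>Over the common denominator \<open>D\<close>, the image of \<i> under the automorphy
  computation has the two entries of the row vector times \<open>A\<close> as its imaginary and real
  numerators, while the height is the inverse square of the modulus of \<open>D\<close>.\<close>

lemma cmod_act2_i:
  assumes "A \<in> SL2"
  shows "Im (act2 A \<i>) > 0"
    "(cmod (of_real x * act2 A \<i> + of_real y))\<^sup>2 =
      ((A $ 1 $ 1 * x + A $ 2 $ 1 * y)\<^sup>2 + (A $ 1 $ 2 * x + A $ 2 $ 2 * y)\<^sup>2) * Im (act2 A \<i>)"
proof -
  show "Im (act2 A \<i>) > 0" using act2_i_in_upper_half_plane[OF assms] by (simp add: upper_half_plane_def)
  define a b c d where abcd: "a = A $ 1 $ 1" "b = A $ 1 $ 2" "c = A $ 2 $ 1" "d = A $ 2 $ 2"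
  have det: "a * d - b * c = 1" using assms by (simp add: SL2_def det_2 abcd)
  have pos: "d\<^sup>2 + c\<^sup>2 > 0"
    using det by (metis diff_0 mult_zero_right neg_equal_0_iff_equal sum_power2_gt_zero_iff zero_neq_one)
  define D where "D = of_real c * \<i> + of_real d"
  have D2: "(cmod D)\<^sup>2 = d\<^sup>2 + c\<^sup>2" by (simp add: D_def cmod_power2)
  have D0: "D \<noteq> 0" using D2 pos by auto
  have act: "act2 A \<i> = (of_real a * \<i> + of_real b) / D" by (simp add: act2_def abcd D_def)
  have Im: "Im (act2 A \<i>) = 1 / (d\<^sup>2 + c\<^sup>2)"
    unfolding act D_def using det by (simp add: Im_divide algebra_simps)
  have g: "u * (N / D) + v = (u * N + v * D) / D" for u v N
    using D0 by (simp add: add_divide_distrib)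
  have "of_real x * act2 A \<i> + of_real y = (of_real x * (of_real a * \<i> + of_real b) + of_real y * D) / D"
    unfolding act by (rule g)
  also have "of_real x * (of_real a * \<i> + of_real b) + of_real y * D = Complex (b * x + d * y) (a * x + c * y)"
    by (simp add: D_def complex_eq_iff algebra_simps)
  finally have "(cmod (of_real x * act2 A \<i> + of_real y))\<^sup>2 = ((b * x + d * y)\<^sup>2 + (a * x + c * y)\<^sup>2) / (d\<^sup>2 + c\<^sup>2)"
    by (simp only: norm_divide power_divide D2 cmod_power2[of "Complex _ _"] complex.sel)
  thus "(cmod (of_real x * act2 A \<i> + of_real y))\<^sup>2 =
      ((A $ 1 $ 1 * x + A $ 2 $ 1 * y)\<^sup>2 + (A $ 1 $ 2 * x + A $ 2 $ 2 * y)\<^sup>2) * Im (act2 A \<i>)"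
    unfolding Im by (simp add: abcd add.commute)
qed

lemma quat_norm_mult: "quat_norm (p * q) = quat_norm p * quat_norm q"
proof -
  have "complex_of_real ((quat_norm (p * q))\<^sup>2) = complex_of_real ((quat_norm p)\<^sup>2 * (quat_norm q)\<^sup>2)"
    unfolding of_real_mult of_real_quat_norm_sq by (simp add: times_quat_def algebra_simps)
  hence "(quat_norm (p * q))\<^sup>2 = (quat_norm p * quat_norm q)\<^sup>2"
    by (simp only: of_real_eq_iff power_mult_distrib)
  thus ?thesis by (rule power2_eq_imp_eq) (simp_all add: quat_norm_def)
qed

text \<open>For \<open>A\<close> with rows (a, b) and (c, d) the image of j is (b + a j) q^-1 with q
  = d + c j. Right multiplication by q clears the inverse and leaves the two entries of the row
  vector times \<open>A\<close>; the quaternion norm is multiplicative and the height is the inverse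
  square of the norm of q.\<close>

lemma quat_norm_act3_j:
  assumes "A \<in> SL2"
  shows "height (act3 A (Quat 0 1)) > 0"
    "quat_norm (Quat x 0 * act3 A (Quat 0 1) + Quat y 0) ^ 4 =
      ((cmod (A $ 1 $ 1 * x + A $ 2 $ 1 * y))\<^sup>2 + (cmod (A $ 1 $ 2 * x + A $ 2 $ 2 * y))\<^sup>2)\<^sup>2 *
      (height (act3 A (Quat 0 1)))\<^sup>2"
proof -
  let ?P = "act3 A (Quat 0 1)"
  have det: "A $ 1 $ 1 * A $ 2 $ 2 - A $ 1 $ 2 * A $ 2 $ 1 = 1"
    using assms by (simp add: SL2_def det_2)
  define q where "q = Quat (A $ 2 $ 2) (A $ 2 $ 1)"
  have q0: "q \<noteq> 0" using det by (auto simp: q_def zero_quat_def)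
  hence qpos: "(quat_norm q)\<^sup>2 > 0" using quat_norm_sq_eq_0[of q] by simp
  have "quat_v ?P = (A $ 1 $ 1 * A $ 2 $ 2 - A $ 1 $ 2 * A $ 2 $ 1) / of_real ((quat_norm q)\<^sup>2)"
    by (simp add: act3_def times_quat_def plus_quat_def inverse_quat_def q_def diff_divide_distrib)
  hence "quat_v ?P = of_real (1 / (quat_norm q)\<^sup>2)" unfolding det by simp
  hence h: "height ?P = 1 / (quat_norm q)\<^sup>2" unfolding height_def by (simp only: Re_complex_of_real)
  show "height ?P > 0" using h qpos by simp
  have P: "?P = Quat (A $ 1 $ 2) (A $ 1 $ 1) * inverse q"
    by (simp add: act3_def q_def) (simp add: times_quat_def plus_quat_def)
  have "(Quat x 0 * ?P + Quat y 0) * q = Quat x 0 * (?P * q) + Quat y 0 * q"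
    by (simp add: distrib_right mult.assoc)
  also have "?P * q = Quat (A $ 1 $ 2) (A $ 1 $ 1)" unfolding P using q0 by (simp add: mult.assoc)
  also have "Quat x 0 * Quat (A $ 1 $ 2) (A $ 1 $ 1) + Quat y 0 * q =
      Quat (A $ 1 $ 2 * x + A $ 2 $ 2 * y) (A $ 1 $ 1 * x + A $ 2 $ 1 * y)"
    by (simp add: q_def times_quat_def plus_quat_def mult.commute)
  finally have "(quat_norm ((Quat x 0 * ?P + Quat y 0) * q))\<^sup>2 =
      (cmod (A $ 1 $ 2 * x + A $ 2 $ 2 * y))\<^sup>2 + (cmod (A $ 1 $ 1 * x + A $ 2 $ 1 * y))\<^sup>2"
    by (simp add: quat_norm_def)
  hence e: "(quat_norm (Quat x 0 * ?P + Quat y 0))\<^sup>2 * (quat_norm q)\<^sup>2 =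
      (cmod (A $ 1 $ 1 * x + A $ 2 $ 1 * y))\<^sup>2 + (cmod (A $ 1 $ 2 * x + A $ 2 $ 2 * y))\<^sup>2"
    by (simp add: quat_norm_mult power_mult_distrib)
  have "quat_norm (Quat x 0 * ?P + Quat y 0) ^ 4 = ((quat_norm (Quat x 0 * ?P + Quat y 0))\<^sup>2)\<^sup>2"
    by (simp flip: power_mult)
  also have "\<dots> = ((quat_norm (Quat x 0 * ?P + Quat y 0))\<^sup>2 * (quat_norm q)\<^sup>2)\<^sup>2 * (height ?P)\<^sup>2"
    unfolding h using qpos by (simp add: power_mult_distrib power_divide)
  finally show "quat_norm (Quat x 0 * ?P + Quat y 0) ^ 4 =
      ((cmod (A $ 1 $ 1 * x + A $ 2 $ 1 * y))\<^sup>2 + (cmod (A $ 1 $ 2 * x + A $ 2 $ 2 * y))\<^sup>2)\<^sup>2 * (height ?P)\<^sup>2"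
    unfolding e .
qed

section \<open>Embeddings sorted into real and complex places\<close>

context
  fixes \<Phi> :: "('f::field_char_0 \<Rightarrow> complex) set"
  assumes nf: "number_field TYPE('f)" and \<Phi>: "complex_places \<Phi>"
begin

text \<open>Lets sums and products over all embeddings be read place by place, a complex place
  contributing two conjugate embeddings. This accounts for the factor 2 in the inner product and for
  the squares at complex places.\<close>

lemma embeddings_partition:
  "embeddings = (\<lambda>\<rho>. complex_of_real \<circ> \<rho>) ` (real_places :: ('f \<Rightarrow> real) set) \<union> (\<Phi> \<union> (\<lambda>\<sigma>. cnj \<circ> \<sigma>) ` \<Phi>)"
  "(\<lambda>\<rho>. complex_of_real \<circ> \<rho>) ` (real_places :: ('f \<Rightarrow> real) set) \<inter> (\<Phi> \<union> (\<lambda>\<sigma>. cnj \<circ> \<sigma>) ` \<Phi>) = {}"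
  "\<Phi> \<inter> (\<lambda>\<sigma>. cnj \<circ> \<sigma>) ` \<Phi> = {}"
proof -
  let ?R = "(\<lambda>\<rho>. complex_of_real \<circ> \<rho>) ` (real_places :: ('f \<Rightarrow> real) set)"
  let ?C = "(\<lambda>\<sigma>. cnj \<circ> \<sigma>) ` \<Phi>"
  have P: "\<sigma> \<in> nonreal_embeddings" if "\<sigma> \<in> \<Phi>" for \<sigma> using \<Phi> that by (auto simp: complex_places_def)
  have P2: "\<sigma> \<in> \<Phi> \<longleftrightarrow> cnj \<circ> \<sigma> \<notin> \<Phi>" if "\<sigma> \<in> nonreal_embeddings" for \<sigma>
    using \<Phi> that by (auto simp: complex_places_def)
  have cc: "cnj \<circ> (cnj \<circ> \<sigma>) = \<sigma>" for \<sigma> :: "'f \<Rightarrow> complex" by (auto simp: fun_eq_iff)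
  have hom_cnj: "field_hom (cnj \<circ> \<sigma>)" if "field_hom \<sigma>" for \<sigma> :: "'f \<Rightarrow> complex"
    by (rule field_homI) (simp_all add: field_homD[OF that])
  have hom_real: "field_hom (complex_of_real \<circ> \<rho>)" if "field_hom \<rho>" for \<rho> :: "'f \<Rightarrow> real"
    by (rule field_homI) (simp_all add: field_homD[OF that])
  have real: "\<sigma> \<in> ?R" if s: "field_hom \<sigma>" "range \<sigma> \<subseteq> \<real>" for \<sigma>
  proof -
    have e: "complex_of_real (Re (\<sigma> x)) = \<sigma> x" for x
    proof -
      have "\<sigma> x \<in> \<real>" using s(2) by blast
      thus ?thesis by (rule of_real_Re)
    qed
    have "Re (\<sigma> (x * y)) = Re (\<sigma> x) * Re (\<sigma> y)" for x y
      using arg_cong[OF field_homD(4)[OF s(1), of x y], of Re] e[of x] e[of y] by (metis Re_complex_of_real of_real_mult)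
    hence "field_hom (Re \<circ> \<sigma>)"
      by (intro field_homI) (simp_all add: field_homD(1-3)[OF s(1)])
    moreover have "\<sigma> = complex_of_real \<circ> (Re \<circ> \<sigma>)" using e by (auto simp: fun_eq_iff)
    ultimately show ?thesis unfolding real_places_def by blast
  qed
  show "embeddings = ?R \<union> (\<Phi> \<union> ?C)"
  proof
    show "embeddings \<subseteq> ?R \<union> (\<Phi> \<union> ?C)"
    proof
      fix \<sigma> :: "'f \<Rightarrow> complex" assume s: "\<sigma> \<in> embeddings"
      show "\<sigma> \<in> ?R \<union> (\<Phi> \<union> ?C)"
      proof (cases "range \<sigma> \<subseteq> \<real>")
        case True
        thus ?thesis using real s by (simp add: embeddings_def)
      next
        case False
        hence "\<sigma> \<in> nonreal_embeddings" using s by (simp add: embeddings_def nonreal_embeddings_def)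
        hence "\<sigma> \<in> \<Phi> \<or> cnj \<circ> \<sigma> \<in> \<Phi>" using P2 by blast
        thus ?thesis using cc[of \<sigma>] by (metis UnI1 UnI2 imageI)
      qed
    qed
    show "?R \<union> (\<Phi> \<union> ?C) \<subseteq> embeddings"
      using P hom_cnj hom_real by (auto simp: embeddings_def nonreal_embeddings_def real_places_def)
  qed
  have "range \<sigma> \<subseteq> \<real>" if "\<sigma> \<in> ?R" for \<sigma> using that by auto
  moreover have "\<not> range \<sigma> \<subseteq> \<real>" if "\<sigma> \<in> \<Phi> \<union> ?C" for \<sigma>
  proof -
    from that consider "\<sigma> \<in> \<Phi>" | \<sigma>' where "\<sigma>' \<in> \<Phi>" "\<sigma> = cnj \<circ> \<sigma>'" by auto
    thus ?thesis
    proof cases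
      case 1
      thus ?thesis using P by (auto simp: nonreal_embeddings_def)
    next
      case 2
      then obtain x where "\<sigma>' x \<notin> \<real>" using P by (auto simp: nonreal_embeddings_def)
      hence "\<sigma> x \<notin> \<real>" using 2 by (metis Reals_cnj_iff comp_apply complex_cnj_cnj)
      thus ?thesis by blast
    qed
  qed
  ultimately show "?R \<inter> (\<Phi> \<union> ?C) = {}" by blast
  show "\<Phi> \<inter> ?C = {}" using P P2 by auto
qed

lemma inj_of_real_comp: "inj_on (\<lambda>\<rho>. complex_of_real \<circ> \<rho>) S"
  by (rule inj_onI) (auto simp: fun_eq_iff)

lemma inj_cnj_comp: "inj_on (\<lambda>\<sigma>. cnj \<circ> \<sigma>) S"
  by (rule inj_onI) (auto simp: fun_eq_iff)

lemma finite_places: "finite (real_places :: ('f \<Rightarrow> real) set)" "finite \<Phi>"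
proof -
  have "finite (embeddings :: ('f \<Rightarrow> complex) set)" by (rule card_embeddings(1)[OF nf])
  hence "finite ((\<lambda>\<rho>. complex_of_real \<circ> \<rho>) ` (real_places :: ('f \<Rightarrow> real) set))" "finite \<Phi>"
    unfolding embeddings_partition(1) by auto
  thus "finite (real_places :: ('f \<Rightarrow> real) set)" "finite \<Phi>"
    using finite_imageD[OF _ inj_of_real_comp] by auto
qed

lemma sum_embeddings:
  "(\<Sum>\<sigma>\<in>embeddings. f \<sigma>) = (\<Sum>\<rho>\<in>(real_places :: ('f \<Rightarrow> real) set). f (complex_of_real \<circ> \<rho>)) +
     ((\<Sum>\<sigma>\<in>\<Phi>. f \<sigma>) + (\<Sum>\<sigma>\<in>\<Phi>. f (cnj \<circ> \<sigma>) :: 'a::comm_monoid_add))"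
  unfolding embeddings_partition(1) using finite_places embeddings_partition(2,3)
  by (simp add: sum.union_disjoint sum.reindex[OF inj_of_real_comp] sum.reindex[OF inj_cnj_comp])

lemma prod_embeddings:
  "(\<Prod>\<sigma>\<in>embeddings. f \<sigma>) = (\<Prod>\<rho>\<in>(real_places :: ('f \<Rightarrow> real) set). f (complex_of_real \<circ> \<rho>)) *
     ((\<Prod>\<sigma>\<in>\<Phi>. f \<sigma>) * (\<Prod>\<sigma>\<in>\<Phi>. f (cnj \<circ> \<sigma>) :: 'a::comm_monoid_mult))"
  unfolding embeddings_partition(1) using finite_places embeddings_partition(2,3)
  by (simp add: prod.union_disjoint prod.reindex[OF inj_of_real_comp] prod.reindex[OF inj_cnj_comp])

lemma real_placeD: "\<rho> \<in> real_places \<Longrightarrow> field_hom (\<rho> :: 'f \<Rightarrow> real)"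
  by (simp add: real_places_def)

lemma \<Phi>D: "\<sigma> \<in> \<Phi> \<Longrightarrow> field_hom \<sigma>"
  using \<Phi> by (auto simp: complex_places_def nonreal_embeddings_def)

lemma biadditive_lattice_inner: "biadditive (lattice_inner \<Phi> g\<^sub>R g\<^sub>C)"
proof
  have herm: "hermitian (u + v) w = hermitian u w + hermitian v w" "hermitian w (u + v) = hermitian w u + hermitian w v"
    for u v w :: "complex ^ 2"
    by (simp_all add: hermitian_def sum_2 algebra_simps)
  fix x y z :: "'f ^ 2"
  show "lattice_inner \<Phi> g\<^sub>R g\<^sub>C (x + y) z = lattice_inner \<Phi> g\<^sub>R g\<^sub>C x z + lattice_inner \<Phi> g\<^sub>R g\<^sub>C y z"
    "lattice_inner \<Phi> g\<^sub>R g\<^sub>C z (x + y) = lattice_inner \<Phi> g\<^sub>R g\<^sub>C z x + lattice_inner \<Phi> g\<^sub>R g\<^sub>C z y"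
    unfolding lattice_inner_def
    by (simp_all add: local_vector_add real_placeD \<Phi>D herm inner_add_left inner_add_right sum.distrib
        cong: sum.cong)
qed

text \<open>Spreads the local norms over all complex embeddings: both members of a conjugate pair
  receive the norm at the chosen one, and a real embedding is traced back to its real place by
  taking real parts.\<close>

definition weight :: "(('f \<Rightarrow> real) \<Rightarrow> real ^ 2 ^ 2) \<Rightarrow> (('f \<Rightarrow> complex) \<Rightarrow> complex ^ 2 ^ 2) \<Rightarrow> 'f ^ 2 \<Rightarrow> ('f \<Rightarrow> complex) \<Rightarrow> real" where
  "weight g\<^sub>R g\<^sub>C v \<sigma> = (if \<sigma> \<in> \<Phi> then norm_complex \<sigma> (g\<^sub>C \<sigma>) v
     else if cnj \<circ> \<sigma> \<in> \<Phi> then norm_complex (cnj \<circ> \<sigma>) (g\<^sub>C (cnj \<circ> \<sigma>)) v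
     else norm_real (Re \<circ> \<sigma>) (g\<^sub>R (Re \<circ> \<sigma>)) v)"

lemma weight_simps:
  "\<sigma> \<in> \<Phi> \<Longrightarrow> weight g\<^sub>R g\<^sub>C v \<sigma> = norm_complex \<sigma> (g\<^sub>C \<sigma>) v"
  "\<sigma> \<in> \<Phi> \<Longrightarrow> weight g\<^sub>R g\<^sub>C v (cnj \<circ> \<sigma>) = norm_complex \<sigma> (g\<^sub>C \<sigma>) v"
  "\<rho> \<in> real_places \<Longrightarrow> weight g\<^sub>R g\<^sub>C v (complex_of_real \<circ> \<rho>) = norm_real \<rho> (g\<^sub>R \<rho>) v"
proof -
  have cc: "cnj \<circ> (cnj \<circ> \<sigma>) = \<sigma>" for \<sigma> :: "'f \<Rightarrow> complex" by (auto simp: fun_eq_iff)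
  show "\<sigma> \<in> \<Phi> \<Longrightarrow> weight g\<^sub>R g\<^sub>C v \<sigma> = norm_complex \<sigma> (g\<^sub>C \<sigma>) v" by (simp add: weight_def)
  show "\<sigma> \<in> \<Phi> \<Longrightarrow> weight g\<^sub>R g\<^sub>C v (cnj \<circ> \<sigma>) = norm_complex \<sigma> (g\<^sub>C \<sigma>) v"
    using embeddings_partition(3) by (auto simp: weight_def cc)
  assume r: "\<rho> \<in> real_places"
  have "complex_of_real \<circ> \<rho> \<notin> \<Phi>" using r embeddings_partition(2) by blast
  moreover have "cnj \<circ> (complex_of_real \<circ> \<rho>) = complex_of_real \<circ> \<rho>" "Re \<circ> (complex_of_real \<circ> \<rho>) = \<rho>"
    by (auto simp: fun_eq_iff)
  ultimately show "weight g\<^sub>R g\<^sub>C v (complex_of_real \<circ> \<rho>) = norm_real \<rho> (g\<^sub>R \<rho>) v"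
    by (simp add: weight_def)
qed

text \<open>Twice a real part is a number plus its conjugate, which splits each complex place into
  its two embeddings. On a line the inner product is thus diagonal in the embeddings.\<close>

lemma lattice_inner_scale:
  "complex_of_real (lattice_inner \<Phi> g\<^sub>R g\<^sub>C (c *s v) (d *s v)) =
     (\<Sum>\<sigma>\<in>embeddings. \<sigma> c * of_real (weight g\<^sub>R g\<^sub>C v \<sigma>) * cnj (\<sigma> d))"
proof -
  let ?z = "\<lambda>\<sigma>. \<sigma> c * cnj (\<sigma> d) * of_real (norm_complex \<sigma> (g\<^sub>C \<sigma>) v)"
  have re: "complex_of_real (2 * Re z) = z + cnj z" for z by (simp add: complex_add_cnj)
  have "complex_of_real (lattice_inner \<Phi> g\<^sub>R g\<^sub>C (c *s v) (d *s v)) =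
      (\<Sum>\<rho>\<in>real_places. complex_of_real (\<rho> c * \<rho> d * norm_real \<rho> (g\<^sub>R \<rho>) v)) + complex_of_real (2 * Re (\<Sum>\<sigma>\<in>\<Phi>. ?z \<sigma>))"
    by (simp add: lattice_inner_def inner_local_scale hermitian_local_scale real_placeD \<Phi>D cong: sum.cong)
  also have "complex_of_real (2 * Re (\<Sum>\<sigma>\<in>\<Phi>. ?z \<sigma>)) = (\<Sum>\<sigma>\<in>\<Phi>. ?z \<sigma>) + (\<Sum>\<sigma>\<in>\<Phi>. cnj (?z \<sigma>))"
    by (simp only: re cnj_sum)
  also have "(\<Sum>\<rho>\<in>real_places. complex_of_real (\<rho> c * \<rho> d * norm_real \<rho> (g\<^sub>R \<rho>) v)) =
      (\<Sum>\<rho>\<in>real_places. (complex_of_real \<circ> \<rho>) c * of_real (weight g\<^sub>R g\<^sub>C v (complex_of_real \<circ> \<rho>)) * cnj ((complex_of_real \<circ> \<rho>) d))"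
    by (intro sum.cong) (simp_all add: weight_simps)
  also have "(\<Sum>\<sigma>\<in>\<Phi>. ?z \<sigma>) = (\<Sum>\<sigma>\<in>\<Phi>. \<sigma> c * of_real (weight g\<^sub>R g\<^sub>C v \<sigma>) * cnj (\<sigma> d))"
    by (intro sum.cong) (simp_all add: weight_simps)
  also have "(\<Sum>\<sigma>\<in>\<Phi>. cnj (?z \<sigma>)) = (\<Sum>\<sigma>\<in>\<Phi>. (cnj \<circ> \<sigma>) c * of_real (weight g\<^sub>R g\<^sub>C v (cnj \<circ> \<sigma>)) * cnj ((cnj \<circ> \<sigma>) d))"
    by (intro sum.cong) (simp_all add: weight_simps)
  finally show ?thesis unfolding sum_embeddings .
qed

lemma prod_weight:
  "(\<Prod>\<sigma>\<in>embeddings. weight g\<^sub>R g\<^sub>C v \<sigma>) =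
     (\<Prod>\<rho>\<in>real_places. norm_real \<rho> (g\<^sub>R \<rho>) v) * (\<Prod>\<sigma>\<in>\<Phi>. (norm_complex \<sigma> (g\<^sub>C \<sigma>) v)\<^sup>2)"
  unfolding prod_embeddings by (simp add: weight_simps power2_eq_square prod.distrib cong: prod.cong)

end

section \<open>Sublattices of rank one and two\<close>

lemma zcomb_line: "V.zcomb c (map (\<lambda>b. b *s w) bs) = F.zcomb c bs *s w"
  by (simp add: V.zcomb_def F.zcomb_def vec_eq_iff sum_distrib_right mult.assoc)

lemma zbasis_line:
  assumes "F.zbasis I bs" "w \<noteq> 0"
  shows "V.zbasis ((\<lambda>c. c *s w) ` I) (map (\<lambda>b. b *s w) bs)"
proof -
  have "V.zindep (map (\<lambda>b. b *s w) bs)"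
    using assms unfolding F.zbasis_def F.zindep_def V.zindep_def by (simp add: zcomb_line)
  thus ?thesis using assms(1) unfolding V.zbasis_def F.zbasis_def by (auto simp: zcomb_line)
qed

context num_field
begin

lemma sum_embs: "(\<Sum>k<deg. f (embs ! k)) = (\<Sum>\<sigma>\<in>embeddings. f \<sigma>)"
  using sum.reindex_bij_betw[OF bij_betw_nth[OF embs(1) refl refl], of f] embs by simp

lemma det_gram_line:
  assumes \<Phi>: "complex_places \<Phi>" and len: "length bs = deg"
  shows "Determinant.det (gram (lattice_inner \<Phi> g\<^sub>R g\<^sub>C) (map (\<lambda>b. b *s v) bs)) =
    (list_vol bs)\<^sup>2 * (\<Prod>\<sigma>\<in>embeddings. weight \<Phi> g\<^sub>R g\<^sub>C v \<sigma>)"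
proof -
  let ?G = "gram (lattice_inner \<Phi> g\<^sub>R g\<^sub>C) (map (\<lambda>b. b *s v) bs)"
  let ?M = "emb_mat embs bs"
  let ?w = "weight \<Phi> g\<^sub>R g\<^sub>C v"
  define D where "D = Matrix.mat deg deg (\<lambda>(i, j). if i = j then complex_of_real (?w (embs ! i)) else 0)"
  have D: "D \<in> carrier_mat deg deg" by (simp add: D_def)
  have M: "?M \<in> carrier_mat deg deg" using len embs by (simp add: emb_mat_def)
  have G: "?G \<in> carrier_mat deg deg" using len by (simp add: gram_def)
  interpret cnj: comm_ring_hom cnj by unfold_locales auto
  have DM: "(D * map_mat cnj ?M) $$ (k, j) = of_real (?w (embs ! k)) * cnj ((embs ! k) (bs ! j))"
    if k: "k < deg" and j: "j < deg" for k j
  proof -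
    have "(D * map_mat cnj ?M) $$ (k, j) = (\<Sum>l<deg. D $$ (k, l) * cnj ((embs ! l) (bs ! j)))"
      using k j D M len embs by (simp add: scalar_prod_def atLeast0LessThan emb_mat_def)
    also have "\<dots> = (\<Sum>l<deg. if l = k then of_real (?w (embs ! k)) * cnj ((embs ! k) (bs ! j)) else 0)"
      by (rule sum.cong) (use k in \<open>auto simp: D_def\<close>)
    finally show ?thesis using k by simp
  qed
  \<comment> \<open>The Gram matrix factors through the embeddings: \<open>?M\<close> and its
    conjugate contribute the volume of the ideal, and the diagonal \<open>D\<close> contributes the
    local norms of \<open>v\<close>.\<close>
  have "map_mat complex_of_real ?G = transpose_mat ?M * (D * map_mat cnj ?M)"
  proof (rule eq_matI)
    fix i j assume "i < dim_row (transpose_mat ?M * (D * map_mat cnj ?M))"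
      "j < dim_col (transpose_mat ?M * (D * map_mat cnj ?M))"
    hence i: "i < deg" and j: "j < deg" using D M by auto
    have "map_mat complex_of_real ?G $$ (i, j) =
        complex_of_real (lattice_inner \<Phi> g\<^sub>R g\<^sub>C (bs ! i *s v) (bs ! j *s v))"
      using i j len by (simp add: gram_def)
    also have "\<dots> = (\<Sum>k<deg. (embs ! k) (bs ! i) * of_real (?w (embs ! k)) * cnj ((embs ! k) (bs ! j)))"
      unfolding lattice_inner_scale[OF nf \<Phi>] by (rule sum_embs[symmetric])
    also have "\<dots> = (\<Sum>k<deg. vec_index (Matrix.row (transpose_mat ?M) i) k * vec_index (Matrix.col (D * map_mat cnj ?M) j) k)"
    proof (rule sum.cong[OF refl])
      fix k assume "k \<in> {..<deg}"
      hence k: "k < deg" by simp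
      have "vec_index (Matrix.row (transpose_mat ?M) i) k = (embs ! k) (bs ! i)"
        using i k len embs by (simp add: emb_mat_def)
      moreover have "vec_index (Matrix.col (D * map_mat cnj ?M) j) k = (D * map_mat cnj ?M) $$ (k, j)"
        using j k D M by simp
      ultimately show "(embs ! k) (bs ! i) * of_real (?w (embs ! k)) * cnj ((embs ! k) (bs ! j)) =
          vec_index (Matrix.row (transpose_mat ?M) i) k * vec_index (Matrix.col (D * map_mat cnj ?M) j) k"
        by (simp only: DM[OF k j] mult.assoc)
    qed
    also have "\<dots> = Matrix.row (transpose_mat ?M) i \<bullet> Matrix.col (D * map_mat cnj ?M) j"
      using D by (simp add: scalar_prod_def atLeast0LessThan)
    also have "\<dots> = (transpose_mat ?M * (D * map_mat cnj ?M)) $$ (i, j)"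
      using i j D M by (intro index_mult_mat(1)[symmetric]) auto
    finally show "map_mat complex_of_real ?G $$ (i, j) = (transpose_mat ?M * (D * map_mat cnj ?M)) $$ (i, j)" .
  qed (use G D M in auto)
  hence "complex_of_real (Determinant.det ?G) = Determinant.det (transpose_mat ?M * (D * map_mat cnj ?M))"
    by (metis of_real_hom.hom_det)
  also have "\<dots> = Determinant.det ?M * (Determinant.det D * cnj (Determinant.det ?M))"
  proof -
    have c: "map_mat cnj ?M \<in> carrier_mat deg deg" using M by simp
    have "Determinant.det (transpose_mat ?M * (D * map_mat cnj ?M)) =
        Determinant.det (transpose_mat ?M) * Determinant.det (D * map_mat cnj ?M)"
      by (rule det_mult[of _ deg]) (use M D c in auto)
    also have "Determinant.det (D * map_mat cnj ?M) = Determinant.det D * Determinant.det (map_mat cnj ?M)"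
      by (rule det_mult[OF D c])
    finally show ?thesis by (simp only: Determinant.det_transpose[OF M] cnj.hom_det)
  qed
  also have "Determinant.det D = complex_of_real (\<Prod>\<sigma>\<in>embeddings. ?w \<sigma>)"
  proof -
    have "upper_triangular D" by (auto simp: D_def)
    from det_upper_triangular[OF this D]
    have "Determinant.det D = (\<Prod>i = 0..<deg. complex_of_real (?w (embs ! i)))"
      by (simp add: prod_list_diag_prod D_def)
    thus ?thesis using prod_embs[of "\<lambda>\<sigma>. complex_of_real (?w \<sigma>)"] by simp
  qed
  also have "Determinant.det ?M * (complex_of_real (\<Prod>\<sigma>\<in>embeddings. ?w \<sigma>) * cnj (Determinant.det ?M)) =
      (Determinant.det ?M * cnj (Determinant.det ?M)) * complex_of_real (\<Prod>\<sigma>\<in>embeddings. ?w \<sigma>)"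
    by (simp only: mult_ac)
  also have "\<dots> = complex_of_real ((list_vol bs)\<^sup>2 * (\<Prod>\<sigma>\<in>embeddings. ?w \<sigma>))"
    unfolding list_vol_def by (simp only: complex_norm_square[symmetric] of_real_mult)
  finally show ?thesis by (simp only: of_real_eq_iff)
qed

lemma covolume_line:
  assumes "complex_places \<Phi>" "fractional_ideal I" "v \<noteq> 0"
  shows "(covolume (lattice_inner \<Phi> g\<^sub>R g\<^sub>C) ((\<lambda>c. c *s v) ` I))\<^sup>2 =
     (ideal_vol I)\<^sup>2 * ((\<Prod>\<rho>\<in>real_places. norm_real \<rho> (g\<^sub>R \<rho>) v) * (\<Prod>\<sigma>\<in>\<Phi>. (norm_complex \<sigma> (g\<^sub>C \<sigma>) v)\<^sup>2))"
    "covolume (lattice_inner \<Phi> g\<^sub>R g\<^sub>C) ((\<lambda>c. c *s v) ` I) \<ge> 0"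
proof -
  let ?P = "(\<Prod>\<rho>\<in>real_places. norm_real \<rho> (g\<^sub>R \<rho>) v) * (\<Prod>\<sigma>\<in>\<Phi>. (norm_complex \<sigma> (g\<^sub>C \<sigma>) v)\<^sup>2)"
  obtain bs where bs: "F.zbasis I bs" "length bs = deg" using fractional_ideal_zbasis[OF assms(2)] .
  have "Determinant.det (gram (lattice_inner \<Phi> g\<^sub>R g\<^sub>C) (map (\<lambda>b. b *s v) bs)) = (ideal_vol I)\<^sup>2 * ?P"
    unfolding det_gram_line[OF assms(1) bs(2)] prod_weight[OF nf assms(1)] ideal_vol_eq[OF assms(2) bs(1)] ..
  hence c: "covolume (lattice_inner \<Phi> g\<^sub>R g\<^sub>C) ((\<lambda>c. c *s v) ` I) = sqrt ((ideal_vol I)\<^sup>2 * ?P)"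
    using covolume_eq[OF biadditive_lattice_inner[OF nf assms(1)] zbasis_line[OF bs(1) assms(3)]] by simp
  have "?P \<ge> 0" by (intro mult_nonneg_nonneg prod_nonneg) (auto simp: norm_real_nonneg)
  hence nn: "(ideal_vol I)\<^sup>2 * ?P \<ge> 0" by simp
  show "(covolume (lattice_inner \<Phi> g\<^sub>R g\<^sub>C) ((\<lambda>c. c *s v) ` I))\<^sup>2 = (ideal_vol I)\<^sup>2 * ?P"
    unfolding c by (rule real_sqrt_pow2[OF nn])
  show "covolume (lattice_inner \<Phi> g\<^sub>R g\<^sub>C) ((\<lambda>c. c *s v) ` I) \<ge> 0"
    unfolding c using nn by (rule real_sqrt_ge_zero)
qed

section \<open>The ideal of a cusp and the distance as a covolume\<close>

definition cusp_ideal :: "'f set \<Rightarrow> 'f \<Rightarrow> 'f \<Rightarrow> 'f set" where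
  "cusp_ideal \<aa> \<alpha> \<beta> = {x * \<alpha> + y * \<beta> | x y. x \<in> \<O> \<and> y \<in> \<aa>}"

lemma fractional_ideal_cusp_ideal:
  assumes "fractional_ideal \<aa>" "\<alpha> \<noteq> 0 \<or> \<beta> \<noteq> 0"
  shows "fractional_ideal (cusp_ideal \<aa> \<alpha> \<beta>)"
  unfolding fractional_ideal_def
proof (intro conjI)
  note cl = fractional_ideal_closed[OF assms(1)]
  note O = ring_of_integers_simps
  have mem: "x * \<alpha> + y * \<beta> \<in> cusp_ideal \<aa> \<alpha> \<beta>" if "x \<in> \<O>" "y \<in> \<aa>" for x y
    using that by (auto simp: cusp_ideal_def)
  show "OF_submodule (*) (cusp_ideal \<aa> \<alpha> \<beta>)" unfolding OF_submodule_def
  proof (intro conjI ballI)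
    show "0 \<in> cusp_ideal \<aa> \<alpha> \<beta>" using mem[OF O(1) cl(1)] by simp
    fix v assume "v \<in> cusp_ideal \<aa> \<alpha> \<beta>"
    then obtain x y where v: "v = x * \<alpha> + y * \<beta>" "x \<in> \<O>" "y \<in> \<aa>" by (auto simp: cusp_ideal_def)
    show "v + w \<in> cusp_ideal \<aa> \<alpha> \<beta>" if "w \<in> cusp_ideal \<aa> \<alpha> \<beta>" for w
    proof -
      from that obtain x' y' where w: "w = x' * \<alpha> + y' * \<beta>" "x' \<in> \<O>" "y' \<in> \<aa>" by (auto simp: cusp_ideal_def)
      have "v + w = (x + x') * \<alpha> + (y + y') * \<beta>" by (simp add: v w algebra_simps)
      thus ?thesis using mem[OF O(4)[OF v(2) w(2)] cl(2)[OF v(3) w(3)]] by simp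
    qed
    show "c * v \<in> cusp_ideal \<aa> \<alpha> \<beta>" if "c \<in> \<O>" for c
    proof -
      have "c * v = (c * x) * \<alpha> + (c * y) * \<beta>" by (simp add: v algebra_simps)
      thus ?thesis using mem[OF O(5)[OF that v(2)] cl(4)[OF that v(3)]] by simp
    qed
  qed
  obtain a where a: "a \<in> \<aa>" "a \<noteq> 0" using fractional_ideal_nonzero[OF assms(1)] .
  have "\<alpha> \<in> cusp_ideal \<aa> \<alpha> \<beta>" "a * \<beta> \<in> cusp_ideal \<aa> \<alpha> \<beta>"
    using mem[OF O(2) cl(1)] mem[OF O(1) a(1)] by simp_all
  thus "cusp_ideal \<aa> \<alpha> \<beta> \<noteq> {0}" using assms(2) a(2) by (metis mult_eq_0_iff singletonD)
  obtain d where d: "d \<in> \<O>" "d \<noteq> 0" "\<forall>x\<in>\<aa>. d * x \<in> \<O>"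
    using assms(1) by (auto simp: fractional_ideal_def)
  obtain k where k: "k > 0" "of_int k * \<alpha> \<in> \<O>" using ex_int_multiple .
  obtain l where l: "l > 0" "of_int l * \<beta> \<in> \<O>" using ex_int_multiple .
  \<comment> \<open>A common denominator: \<open>k\<close> and \<open>l\<close> clear the two
    coordinates of the cusp, and \<open>d\<close> clears the elements of \<aa>.\<close>
  let ?e = "d * of_int (k * l)"
  have "?e * v \<in> \<O>" if "v \<in> cusp_ideal \<aa> \<alpha> \<beta>" for v
  proof -
    from that obtain x y where v: "v = x * \<alpha> + y * \<beta>" "x \<in> \<O>" "y \<in> \<aa>" by (auto simp: cusp_ideal_def)
    have e: "?e * v = (d * of_int l * x) * (of_int k * \<alpha>) + (of_int k * (d * y)) * (of_int l * \<beta>)"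
      by (simp add: v algebra_simps)
    have dy: "d * y \<in> \<O>" using d(3) v(3) by blast
    show ?thesis unfolding e
      by (rule O(4)[OF O(5)[OF O(5)[OF O(5)[OF d(1) O(3)] v(2)] k(2)] O(5)[OF O(5)[OF O(3) dy] l(2)]])
  qed
  moreover have "?e \<in> \<O>" by (rule O(5)[OF d(1) O(3)])
  moreover have "?e \<noteq> 0" using d(2) k(1) l(1) by simp
  ultimately show "\<exists>d\<in>\<O>. d \<noteq> 0 \<and> (\<forall>x\<in>cusp_ideal \<aa> \<alpha> \<beta>. d * x \<in> \<O>)" by blast
qed

text \<open>This is the intersection of \<open>\<O> \<oplus> \<aa>\<close> with the line through \<open>(-\<beta>, \<alpha>)\<close>, and \<open>cusp_ideal\<close> is
  the ideal \<open>\<bb>\<close> in the definition of the reciprocal distance.\<close>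

lemma line_ideal_eq:
  assumes "fractional_ideal \<aa>" "\<alpha> \<noteq> 0 \<or> \<beta> \<noteq> 0"
  shows "{c. c * - \<beta> \<in> \<O> \<and> c * \<alpha> \<in> \<aa>} = ideal_mult \<aa> (ideal_inverse (cusp_ideal \<aa> \<alpha> \<beta>))" (is "?J = _")
proof
  let ?b = "cusp_ideal \<aa> \<alpha> \<beta>"
  note cl = fractional_ideal_closed[OF assms(1)]
  note O = ring_of_integers_simps
  have neg: "c * - \<beta> \<in> \<O> \<longleftrightarrow> c * \<beta> \<in> \<O>" for c
    using O(6)[of "c * \<beta>"] O(6)[of "c * - \<beta>"] by auto
  have mem: "x * \<alpha> + y * \<beta> \<in> ?b" if "x \<in> \<O>" "y \<in> \<aa>" for x y
    using that by (auto simp: cusp_ideal_def)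
  show "?J \<subseteq> ideal_mult \<aa> (ideal_inverse ?b)"
  proof
    fix c assume "c \<in> ?J"
    hence c: "c * \<beta> \<in> \<O>" "c * \<alpha> \<in> \<aa>" by (simp_all only: mem_Collect_eq neg)
    \<comment> \<open>Invertibility writes 1 as a sum of products \<open>z * t\<close> with
      \<open>z\<close> in \<bb> and \<open>t\<close> in its inverse. After multiplication by
      \<open>c\<close> each \<open>c * z\<close> lies in \<aa>, so \<open>c\<close> lies in the
      product ideal.\<close>
    have "1 \<in> ideal_mult ?b (ideal_inverse ?b)"
      unfolding ideal_mult_inverse[OF fractional_ideal_cusp_ideal[OF assms]] by (rule O(2))
    hence "1 * c \<in> ideal_mult \<aa> (ideal_inverse ?b)"
    proof (rule ideal_mult_induct[OF _ ideal_mult_subspace])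
      fix z t assume z: "z \<in> ?b" and t: "t \<in> ideal_inverse ?b"
      then obtain x y where xy: "z = x * \<alpha> + y * \<beta>" "x \<in> \<O>" "y \<in> \<aa>" by (auto simp: cusp_ideal_def)
      have "c * z = x * (c * \<alpha>) + (c * \<beta>) * y" by (simp add: xy algebra_simps)
      hence "c * z \<in> \<aa>" using cl(2)[OF cl(4)[OF xy(2) c(2)] cl(4)[OF c(1) xy(3)]] by simp
      from ideal_multI[OF this t] show "z * t * c \<in> ideal_mult \<aa> (ideal_inverse ?b)" by (simp add: mult_ac)
    qed
    thus "c \<in> ideal_mult \<aa> (ideal_inverse ?b)" by simp
  qed
  show "ideal_mult \<aa> (ideal_inverse ?b) \<subseteq> ?J"
  proof (rule ideal_mult_least)
    show "F.Z.subspace ?J" unfolding neg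
    proof (rule F.Z.subspaceI)
      show "0 \<in> {c. c * \<beta> \<in> \<O> \<and> c * \<alpha> \<in> \<aa>}" using O(1) cl(1) by simp
      show "x + y \<in> {c. c * \<beta> \<in> \<O> \<and> c * \<alpha> \<in> \<aa>}"
        if "x \<in> {c. c * \<beta> \<in> \<O> \<and> c * \<alpha> \<in> \<aa>}" "y \<in> {c. c * \<beta> \<in> \<O> \<and> c * \<alpha> \<in> \<aa>}" for x y
        using that by (simp add: distrib_right O(4) cl(2))
      show "of_int n * x \<in> {c. c * \<beta> \<in> \<O> \<and> c * \<alpha> \<in> \<aa>}"
        if "x \<in> {c. c * \<beta> \<in> \<O> \<and> c * \<alpha> \<in> \<aa>}" for n x
        using that O(5)[OF O(3)[of n], of "x * \<beta>"] cl(4)[OF O(3)[of n], of "x * \<alpha>"]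
        by (simp add: mult.assoc)
    qed
    fix s t assume s: "s \<in> \<aa>" and t: "t \<in> ideal_inverse ?b"
    have t1: "t * z \<in> \<O>" if "z \<in> ?b" for z using t that by (simp add: ideal_inverse_def)
    \<comment> \<open>Both memberships come from elements of \<bb>: \<open>s * \<beta>\<close> with
      \<open>s\<close> in \<aa> for this one, and \<alpha> itself for the next.\<close>
    have "s * t * \<beta> \<in> \<O>" using t1[OF mem[OF O(1) s]] by (simp add: mult_ac)
    moreover have "(t * \<alpha>) * s \<in> \<aa>" using cl(4)[OF t1[OF mem[OF O(2) cl(1)]] s] by simp
    hence "s * t * \<alpha> \<in> \<aa>" by (simp add: mult_ac)
    ultimately show "s * t \<in> ?J" unfolding neg by simp
  qed
qed

lemma recip_dist_coords_eq:
  assumes \<Phi>: "complex_places \<Phi>" and a: "fractional_ideal \<aa>" and ab: "\<alpha> \<noteq> 0 \<or> \<beta> \<noteq> 0"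
    and R: "\<forall>\<sigma>\<in>real_places. g\<^sub>R \<sigma> \<in> SL2" and C: "\<forall>\<sigma>\<in>\<Phi>. g\<^sub>C \<sigma> \<in> SL2"
    and v: "(v :: 'f ^ 2) $ 1 = - \<beta>" "v $ 2 = \<alpha>"
  shows "1 / recip_dist_coords \<Phi> \<aa> \<alpha> \<beta> (act g\<^sub>R g\<^sub>C ImJ) =
    (covolume (lattice_inner \<Phi> g\<^sub>R g\<^sub>C) ((\<lambda>c. c *s v) ` {c. c * - \<beta> \<in> \<O> \<and> c * \<alpha> \<in> \<aa>}))\<^sup>2 /
    (ideal_norm \<aa> * cmod (discriminant TYPE('f)))"
proof -
  let ?b = "cusp_ideal \<aa> \<alpha> \<beta>"
  let ?bi = "ideal_inverse ?b"
  let ?J = "ideal_mult \<aa> ?bi"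
  let ?I = "\<Prod>\<sigma>\<in>real_places. Im (act2 (g\<^sub>R \<sigma>) \<i>)"
  let ?H = "\<Prod>\<sigma>\<in>\<Phi>. (height (act3 (g\<^sub>C \<sigma>) (Quat 0 1)))\<^sup>2"
  let ?NR = "\<Prod>\<rho>\<in>real_places. norm_real \<rho> (g\<^sub>R \<rho>) v"
  let ?NC = "\<Prod>\<sigma>\<in>\<Phi>. (norm_complex \<sigma> (g\<^sub>C \<sigma>) v)\<^sup>2"
  note O = fractional_ideal_ring_of_integers[where 'f = 'f]
  have b: "fractional_ideal ?b" by (rule fractional_ideal_cusp_ideal[OF a ab])
  note bi = fractional_ideal_inverse[OF b]
  have J: "fractional_ideal ?J" by (rule fractional_ideal_mult[OF a bi])
  have v0: "v \<noteq> 0" using ab v by auto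
  have real: "(cmod (- of_real (\<sigma> \<beta>) * act2 (g\<^sub>R \<sigma>) \<i> + of_real (\<sigma> \<alpha>)))\<^sup>2 =
      norm_real \<sigma> (g\<^sub>R \<sigma>) v * Im (act2 (g\<^sub>R \<sigma>) \<i>)" if s: "\<sigma> \<in> real_places" for \<sigma>
  proof -
    have h: "field_hom \<sigma>" using s by (simp add: real_places_def)
    show ?thesis
      using cmod_act2_i(2)[of "g\<^sub>R \<sigma>" "\<sigma> (- \<beta>)" "\<sigma> \<alpha>"] R s
      by (simp add: norm_real_def inner_vec_def sum_2 local_vector_nth v field_homD(5)[OF h] power2_eq_square)
  qed
  have comp: "quat_norm (- Quat (\<sigma> \<beta>) 0 * act3 (g\<^sub>C \<sigma>) (Quat 0 1) + Quat (\<sigma> \<alpha>) 0) ^ 4 =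
      (norm_complex \<sigma> (g\<^sub>C \<sigma>) v)\<^sup>2 * (height (act3 (g\<^sub>C \<sigma>) (Quat 0 1)))\<^sup>2" if s: "\<sigma> \<in> \<Phi>" for \<sigma>
  proof -
    have h: "field_hom \<sigma>" using s \<Phi> by (auto simp: complex_places_def nonreal_embeddings_def)
    have "- Quat (\<sigma> \<beta>) 0 = Quat (\<sigma> (- \<beta>)) 0" by (simp add: uminus_quat_def field_homD(5)[OF h])
    thus ?thesis
      using quat_norm_act3_j(2)[of "g\<^sub>C \<sigma>" "\<sigma> (- \<beta>)" "\<sigma> \<alpha>"] C s
      by (simp add: norm_complex_def local_vector_nth v)
  qed
  have pI: "?I > 0" using cmod_act2_i(1) R by (intro prod_pos) blast
  have pH: "?H > 0" using quat_norm_act3_j(1) C by (auto intro!: prod_pos zero_less_power)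
  have pO: "ideal_vol (\<O> :: 'f set) > 0" by (rule ideal_vol_pos[OF O])
  have pa: "ideal_norm \<aa> > 0" using ideal_vol_pos[OF a] pO by (simp add: ideal_norm_eq[OF a])
  have prodR: "(\<Prod>\<sigma>\<in>real_places. (cmod (- of_real (\<sigma> \<beta>) * act2 (g\<^sub>R \<sigma>) \<i> + of_real (\<sigma> \<alpha>)))\<^sup>2) = ?NR * ?I"
    unfolding prod.distrib[symmetric] by (rule prod.cong[OF refl real])
  have prodC: "(\<Prod>\<sigma>\<in>\<Phi>. quat_norm (- Quat (\<sigma> \<beta>) 0 * act3 (g\<^sub>C \<sigma>) (Quat 0 1) + Quat (\<sigma> \<alpha>) 0) ^ 4) = ?NC * ?H"
    unfolding prod.distrib[symmetric] by (rule prod.cong[OF refl comp])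
  \<comment> \<open>Each local factor of the denominator carries the same height factor as the
    numerator, so the heights cancel and only the local norms of \<open>v\<close> remain.\<close>
  have "recip_dist_coords \<Phi> \<aa> \<alpha> \<beta> (act g\<^sub>R g\<^sub>C ImJ) =
      1 / ideal_norm (ideal_mult \<aa> (ideal_mult ?bi ?bi)) * ((?I * ?H) / ((?NR * ?I) * (?NC * ?H)))"
    unfolding recip_dist_coords_def Let_def cusp_ideal_def[symmetric] act_def ImJ_def fst_conv snd_conv
      prodR prodC ..
  also have "\<dots> = 1 / (ideal_norm (ideal_mult \<aa> (ideal_mult ?bi ?bi)) * (?NR * ?NC))"
    using pI pH by simp
  finally have 1: "1 / recip_dist_coords \<Phi> \<aa> \<alpha> \<beta> (act g\<^sub>R g\<^sub>C ImJ) =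
      ideal_norm (ideal_mult \<aa> (ideal_mult ?bi ?bi)) * (?NR * ?NC)" by simp
  \<comment> \<open>The squared covolume contains N(\<aa>)^2 N(\<bb>^-1)^2 |\<Delta>|, whereas the
    distance contains N(\<aa>) N(\<bb>^-1)^2. The quotient of the two is the divisor N(\<aa>)
    |\<Delta>| in the claim.\<close>
  have "ideal_vol ?J = ideal_norm ?J * ideal_vol \<O>" using pO by (simp add: ideal_norm_eq[OF J])
  hence "(covolume (lattice_inner \<Phi> g\<^sub>R g\<^sub>C) ((\<lambda>c. c *s v) ` ?J))\<^sup>2 =
      (ideal_norm \<aa> * ideal_norm ?bi * ideal_vol \<O>)\<^sup>2 * (?NR * ?NC)"
    using covolume_line(1)[OF \<Phi> J v0] by (simp add: ideal_norm_mult[OF a bi])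
  thus ?thesis
    unfolding 1 line_ideal_eq[OF a ab] discriminant_eq
    using pa pO by (simp add: ideal_norm_mult[OF a fractional_ideal_mult[OF bi bi]] ideal_norm_mult[OF bi bi]
        power2_eq_square)
qed

text \<open>Every element of the field is a rational multiple of an algebraic integer, so the
  rational span of an \<O>-module is already stable under the field. This links
  \<open>vec.dim\<close> to the lengths of Z-bases.\<close>

lemma span_OF_submodule:
  fixes L :: "('f ^ 'n) set"
  assumes "OF_submodule (*s) L"
  shows "V.span L = vec.span L"
proof
  show "V.span L \<subseteq> vec.span L"
  proof (rule V.span_minimal[OF vec.span_superset], rule V.subspaceI)
    show "0 \<in> vec.span L" by (rule vec.span_zero)
  qed (auto intro: vec.span_add vec.span_scale)
  show "vec.span L \<subseteq> V.span L"
  proof (rule vec.span_minimal[OF V.span_superset], rule vec.subspaceI)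
    fix c v assume v: "v \<in> V.span L"
    have "V.subspace {v. c *s v \<in> V.span L}"
    proof (rule V.subspaceI)
      show "0 \<in> {v. c *s v \<in> V.span L}" by (simp add: V.span_zero)
      show "x + y \<in> {v. c *s v \<in> V.span L}" if "x \<in> {v. c *s v \<in> V.span L}" "y \<in> {v. c *s v \<in> V.span L}" for x y
        using that by (simp add: vec.scale_right_distrib V.span_add)
      show "of_rat q *s x \<in> {v. c *s v \<in> V.span L}" if "x \<in> {v. c *s v \<in> V.span L}" for q x
      proof -
        have "of_rat q *s (c *s x) \<in> V.span L" using that V.span_scale by blast
        thus ?thesis by (simp add: mult.commute)
      qed
    qed
    moreover have "L \<subseteq> {v. c *s v \<in> V.span L}"
    proof
      fix x assume x: "x \<in> L"
      obtain k where k: "k > 0" "of_int k * c \<in> \<O>" using ex_int_multiple .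
      have "(of_int k * c) *s x \<in> L" using assms k(2) x unfolding OF_submodule_def by blast
      hence "of_rat (inverse (of_int k)) *s ((of_int k * c) *s x) \<in> V.span L"
        by (rule V.span_scale[OF V.span_base])
      moreover have "of_rat (inverse (of_int k)) * of_int k = (1 :: 'f)" using k(1) by (simp add: of_rat_inverse)
      hence "of_rat (inverse (of_int k)) *s ((of_int k * c) *s x) = c *s x"
        by (simp only: vector_smult_assoc mult.assoc[symmetric] mult_1_left)
      ultimately show "x \<in> {v. c *s v \<in> V.span L}" by (simp only: mem_Collect_eq)
    qed
    ultimately show "c *s v \<in> V.span L" using V.span_minimal v by blast
  qed (auto intro: V.span_zero V.span_add)
qed

lemma OF_submodule_std_module:
  assumes "fractional_ideal (\<aa> :: 'f set)"
  shows "OF_submodule (*s) (std_module \<aa>)"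
  using fractional_ideal_closed(1,2,4)[OF assms]
  unfolding OF_submodule_def std_module_def by (simp add: ring_of_integers_simps(1,4,5))

lemma OF_submodule_zsubspace:
  assumes "OF_submodule (*s) (L :: ('f ^ 'n) set)"
  shows "V.Z.subspace L"
  by (rule V.Z.subspaceI) (use assms in \<open>auto simp: OF_submodule_def ring_of_integers_simps(3)\<close>)

lemma vec_span_std_module:
  assumes "fractional_ideal (\<aa> :: 'f set)"
  shows "vec.span (std_module \<aa>) = UNIV"
proof -
  obtain a where a: "a \<in> \<aa>" "a \<noteq> 0" using fractional_ideal_nonzero[OF assms] .
  have "v \<in> vec.span (std_module \<aa>)" for v :: "'f ^ 2"
  proof -
    have "v $ 1 *s axis 1 1 + (v $ 2 / a) *s axis 2 a \<in> vec.span (std_module \<aa>)"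
      using a fractional_ideal_closed(1)[OF assms] ring_of_integers_simps(1,2)
      by (intro vec.span_add vec.span_scale vec.span_base) (auto simp: std_module_def axis_def)
    moreover have "v $ 1 *s axis 1 1 + (v $ 2 / a) *s axis 2 a = v"
      using a(2) by (simp add: vec_eq_iff forall_2 axis_def)
    ultimately show ?thesis by simp
  qed
  thus ?thesis by blast
qed

lemma std_module_zbasis:
  assumes "fractional_ideal (\<aa> :: 'f set)"
  shows "\<exists>bs. V.zbasis (std_module \<aa>) bs"
proof -
  obtain bs where bs: "F.zbasis (\<O> :: 'f set) bs" using ring_of_integers_zbasis by blast
  obtain cs where cs: "F.zbasis \<aa> cs" using fractional_ideal_zbasis[OF assms] .
  let ?n = "length bs"
  let ?xs = "map (\<lambda>b. b *s axis 1 1) bs @ map (\<lambda>b. b *s axis 2 1) cs :: ('f ^ 2) list"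
  have "V.zcomb c (us @ ws) = V.zcomb c us + V.zcomb (\<lambda>i. c (length us + i)) ws" for c and us ws :: "('f ^ 2) list"
    by (induction us arbitrary: c) (simp_all add: V.zcomb_Cons add.assoc)
  hence z: "V.zcomb c ?xs = F.zcomb c bs *s axis 1 1 + F.zcomb (\<lambda>i. c (?n + i)) cs *s axis 2 1" for c
    by (simp only: zcomb_line length_map)
  hence z1: "V.zcomb c ?xs $ 1 = F.zcomb c bs" and z2: "V.zcomb c ?xs $ 2 = F.zcomb (\<lambda>i. c (?n + i)) cs" for c
    by (simp_all add: axis_def)
  have "V.zindep ?xs" unfolding V.zindep_def
  proof (intro allI impI)
    fix c i assume c: "V.zcomb c ?xs = 0" and i: "i < length ?xs"
    have "F.zcomb c bs = 0" "F.zcomb (\<lambda>i. c (?n + i)) cs = 0"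
      using z1[of c] z2[of c] unfolding c by simp_all
    hence 0: "\<forall>i<?n. c i = 0" "\<forall>i<length cs. c (?n + i) = 0"
      using bs cs unfolding F.zbasis_def F.zindep_def by blast+
    show "c i = 0"
    proof (cases "i < ?n")
      case False
      with i 0(2)[rule_format, of "i - ?n"] show ?thesis by simp
    qed (use 0 in simp)
  qed
  moreover have "std_module \<aa> = range (\<lambda>c. V.zcomb c ?xs)"
  proof
    show "range (\<lambda>c. V.zcomb c ?xs) \<subseteq> std_module \<aa>"
      using bs cs by (auto simp: std_module_def z1 z2 F.zbasis_def)
    show "std_module \<aa> \<subseteq> range (\<lambda>c. V.zcomb c ?xs)"
    proof
      fix v assume "v \<in> std_module \<aa>"
      hence "v $ 1 \<in> range (\<lambda>c. F.zcomb c bs)" "v $ 2 \<in> range (\<lambda>c. F.zcomb c cs)"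
        using bs cs by (simp_all add: std_module_def F.zbasis_def)
      then obtain c d where cd: "v $ 1 = F.zcomb c bs" "v $ 2 = F.zcomb d cs" by (elim rangeE)
      let ?e = "\<lambda>i. if i < ?n then c i else d (i - ?n)"
      have "F.zcomb ?e bs = F.zcomb c bs" by (rule F.zcomb_cong) simp
      moreover have "F.zcomb (\<lambda>i. ?e (?n + i)) cs = F.zcomb d cs" by (rule F.zcomb_cong) simp
      ultimately have "v = V.zcomb ?e ?xs" unfolding vec_eq_iff forall_2 z1 z2 cd by (simp only: simp_thms)
      thus "v \<in> range (\<lambda>c. V.zcomb c ?xs)" by blast
    qed
  qed
  ultimately show ?thesis unfolding V.zbasis_def by blast
qed

lemma OF_submodule_line:
  assumes "OF_submodule (*s) (L :: ('f ^ 'n) set)"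
  shows "OF_submodule (*) {c. c *s v \<in> L}"
  unfolding OF_submodule_def
proof (intro conjI ballI)
  show "0 \<in> {c. c *s v \<in> L}" using assms by (simp add: OF_submodule_def)
  fix c assume c: "c \<in> {c. c *s v \<in> L}"
  show "c + d \<in> {c. c *s v \<in> L}" if "d \<in> {c. c *s v \<in> L}" for d
    using c that assms by (simp add: OF_submodule_def vec.scale_left_distrib)
  show "d * c \<in> {c. c *s v \<in> L}" if "d \<in> \<O>" for d
  proof -
    have "d *s (c *s v) \<in> L" using c that assms unfolding OF_submodule_def by blast
    thus ?thesis by simp
  qed
qed

lemma std_module_line: "{c. c *s v \<in> std_module \<aa>} = {c. c * (v $ 1) \<in> \<O> \<and> c * (v $ 2) \<in> \<aa>}"
  by (simp add: std_module_def)

text \<open>Any non-zero \<open>v\<close> has the form (-\<beta>, \<alpha>) with \<alpha> its second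
  entry and \<beta> the negative of its first, so \<open>line_ideal_eq\<close> applies.\<close>

lemma fractional_ideal_line:
  assumes "fractional_ideal \<aa>" "(v :: 'f ^ 2) \<noteq> 0"
  shows "fractional_ideal {c. c *s v \<in> std_module \<aa>}"
proof -
  have ab: "v $ 2 \<noteq> 0 \<or> - v $ 1 \<noteq> 0" using assms(2) by (auto simp: vec_eq_iff forall_2)
  have "{c. c *s v \<in> std_module \<aa>} = ideal_mult \<aa> (ideal_inverse (cusp_ideal \<aa> (v $ 2) (- v $ 1)))"
    unfolding std_module_line line_ideal_eq[OF assms(1) ab, symmetric] by simp
  thus ?thesis
    using fractional_ideal_mult[OF assms(1) fractional_ideal_inverse[OF fractional_ideal_cusp_ideal[OF assms(1) ab]]]
    by simp
qed

text \<open>Full rank over the field gives the same rational span, hence Z-bases of equal length,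
  and \<open>covolume_antimono\<close> compares them.\<close>

lemma rank_two_covolume:
  fixes L :: "('f ^ 2) set"
  assumes "biadditive ip" "fractional_ideal \<aa>" "OF_submodule (*s) L" "L \<subseteq> std_module \<aa>" "vec.dim L = 2"
    "covolume ip (std_module \<aa>) \<ge> 0"
  shows "covolume ip (std_module \<aa>) \<le> covolume ip L"
proof -
  obtain bs where bs: "V.zbasis (std_module \<aa>) bs" using std_module_zbasis[OF assms(2)] by blast
  obtain cs where cs: "V.zbasis L cs"
    using V.zbasis_subgroup[OF bs OF_submodule_zsubspace[OF assms(3)] assms(4)] by blast
  have "vec.span L = UNIV"
    using assms(5) vec.dim_eq_full[of L] by (simp add: vec.dimension_def card_cart_basis)
  hence "V.span L = V.span (std_module \<aa>)"
    using span_OF_submodule[OF assms(3)] span_OF_submodule[OF OF_submodule_std_module[OF assms(2)]]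
      vec_span_std_module[OF assms(2)] by simp
  hence "V.dim L = V.dim (std_module \<aa>)" by (rule V.span_eq_dim)
  hence "length bs = length cs" using V.zbasis_length[OF bs] V.zbasis_length[OF cs] by simp
  from covolume_antimono[OF assms(1) bs cs assms(4) this assms(6)] show ?thesis .
qed

text \<open>A sublattice of the line is an ideal times \<open>v\<close>, contained in the ideal cut
  out by the full lattice. Both ideals have Z-bases of length \<open>deg\<close>, so
  \<open>covolume_antimono\<close> applies.\<close>

lemma rank_one_covolume:
  assumes \<Phi>: "complex_places \<Phi>" and a: "fractional_ideal \<aa>"
    and L: "OF_submodule (*s) (L :: ('f ^ 2) set)" "L \<subseteq> std_module \<aa>" "L \<noteq> {0}" and v: "L \<subseteq> range (\<lambda>c. c *s v)"
  shows "covolume (lattice_inner \<Phi> g\<^sub>R g\<^sub>C) ((\<lambda>c. c *s v) ` {c. c *s v \<in> std_module \<aa>})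
    \<le> covolume (lattice_inner \<Phi> g\<^sub>R g\<^sub>C) L"
proof -
  let ?J = "{c. c *s v \<in> std_module \<aa>}" and ?I = "{c. c *s v \<in> L}"
  obtain u where u: "u \<in> L" "u \<noteq> 0" using L(1,3) unfolding OF_submodule_def by blast
  then obtain c where c: "u = c *s v" using v by blast
  have v0: "v \<noteq> 0" and c0: "c \<noteq> 0" using u(2) c by auto
  have J: "fractional_ideal ?J" by (rule fractional_ideal_line[OF a v0])
  have I: "fractional_ideal ?I"
    by (rule fractional_ideal_between[OF OF_submodule_line[OF L(1)] _ c0 _ J]) (use u c L(2) in auto)
  obtain bs where bs: "F.zbasis ?J bs" "length bs = deg" using fractional_ideal_zbasis[OF J] .
  obtain cs where cs: "F.zbasis ?I cs" "length cs = deg" using fractional_ideal_zbasis[OF I] .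
  have Lv: "(\<lambda>c. c *s v) ` ?I = L" using v by blast
  show ?thesis
  proof (rule covolume_antimono[OF biadditive_lattice_inner[OF nf \<Phi>] zbasis_line[OF bs(1) v0]])
    show "V.zbasis L (map (\<lambda>b. b *s v) cs)" using zbasis_line[OF cs(1) v0] unfolding Lv .
    show "L \<subseteq> (\<lambda>c. c *s v) ` ?J" using v L(2) by blast
    show "length (map (\<lambda>b. b *s v) bs) = length (map (\<lambda>b. b *s v) cs)" using bs(2) cs(2) by simp
    show "0 \<le> covolume (lattice_inner \<Phi> g\<^sub>R g\<^sub>C) ((\<lambda>c. c *s v) ` ?J)" by (rule covolume_line(2)[OF \<Phi> J v0])
  qed
qed

end

section \<open>Semi-stability compared with the distances to all cusps\<close>

theorem mainTheorem5:
  fixes \<aa> :: "'f::field_char_0 set"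
    and \<Phi> :: "('f \<Rightarrow> complex) set"
    and g\<^sub>R :: "('f \<Rightarrow> real) \<Rightarrow> real ^ 2 ^ 2"
    and g\<^sub>C :: "('f \<Rightarrow> complex) \<Rightarrow> complex ^ 2 ^ 2"
  assumes "number_field TYPE('f)"
    and "complex_places \<Phi>"
    and "fractional_ideal \<aa>"
    and "\<forall>\<sigma>\<in>real_places. g\<^sub>R \<sigma> \<in> SL2"
    and "\<forall>\<sigma>\<in>\<Phi>. g\<^sub>C \<sigma> \<in> SL2"
    and "covolume (lattice_inner \<Phi> g\<^sub>R g\<^sub>C) (std_module \<aa>) =
         ideal_norm \<aa> * cmod (discriminant TYPE('f))"
  shows "semistable (lattice_inner \<Phi> g\<^sub>R g\<^sub>C) (std_module \<aa>) \<longleftrightarrow>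
         (\<forall>\<eta>\<in>cusps. cusp_dist \<Phi> \<aa> \<eta> (act g\<^sub>R g\<^sub>C ImJ) \<ge> 1)"
proof -
  interpret num_field "TYPE('f)" by unfold_locales (rule assms(1))
  let ?ip = "lattice_inner \<Phi> g\<^sub>R g\<^sub>C"
  let ?L = "std_module \<aa>"
  let ?line = "\<lambda>w :: 'f ^ 2. (\<lambda>c. c *s w) ` {c. c *s w \<in> ?L}"
  let ?cusp = "\<lambda>v :: 'f ^ 2. {w. w \<noteq> 0 \<and> (\<exists>c. c \<noteq> 0 \<and> w = c *s v)}"
  \<comment> \<open>The quarter turn that takes a cusp vector (\<alpha>, \<beta>) to the direction
    (-\<beta>, \<alpha>) of its line.\<close>
  define rot :: "'f ^ 2 \<Rightarrow> 'f ^ 2" where "rot v = (\<chi> i. if i = 1 then - v $ 2 else v $ 1)" for v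
  have rot: "rot v $ 1 = - v $ 2" "rot v $ 2 = v $ 1" for v by (simp_all add: rot_def)
  have rot0: "rot v \<noteq> 0 \<longleftrightarrow> v \<noteq> 0" for v by (auto simp: vec_eq_iff forall_2 rot)
  have pL: "covolume ?ip ?L > 0"
    using ideal_vol_pos[OF assms(3)] ideal_vol_pos[OF fractional_ideal_ring_of_integers]
    unfolding assms(6) discriminant_eq ideal_norm_eq[OF assms(3)] by simp
  have dimL: "vec.dim ?L = 2"
    using vec_span_std_module[OF assms(3)] vec.dim_span[of ?L] vec_dim_card[where 'a = 'f and 'n = 2] by simp
  have dist: "1 / recip_dist_coords \<Phi> \<aa> (v $ 1) (v $ 2) (act g\<^sub>R g\<^sub>C ImJ) \<ge> 1 \<longleftrightarrow>
      (covolume ?ip (?line (rot v)))\<^sup>2 \<ge> covolume ?ip ?L" if "v \<noteq> 0" for v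
  proof -
    have ab: "v $ 1 \<noteq> 0 \<or> v $ 2 \<noteq> 0" using that by (auto simp: vec_eq_iff forall_2)
    have "1 / recip_dist_coords \<Phi> \<aa> (v $ 1) (v $ 2) (act g\<^sub>R g\<^sub>C ImJ) = (covolume ?ip (?line (rot v)))\<^sup>2 / covolume ?ip ?L"
      using recip_dist_coords_eq[OF assms(2,3) ab assms(4,5) rot] unfolding assms(6) std_module_line rot .
    thus ?thesis using pL by (simp add: le_divide_eq)
  qed
  \<comment> \<open>\<open>recip_dist\<close> selects a representative by \<open>SOME\<close>. It is
    only known to be a non-zero multiple of \<open>v\<close>, which suffices because the argument is
    carried out on the line of the selected vector.\<close>
  have rep: "\<exists>c. c \<noteq> 0 \<and> (SOME w. w \<in> ?cusp v) = c *s v" if "v \<noteq> 0" for v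
  proof -
    have "v \<in> ?cusp v" using that by (auto intro!: exI[of _ 1])
    hence "(SOME w. w \<in> ?cusp v) \<in> ?cusp v" by (rule someI[of "\<lambda>w. w \<in> ?cusp v"])
    thus ?thesis by blast
  qed
  have cusps: "cusps = {?cusp v | v. v \<noteq> 0}"
    unfolding cusps_def quotient_def by auto
  have cusp_dist: "cusp_dist \<Phi> \<aa> (?cusp v) (act g\<^sub>R g\<^sub>C ImJ) \<ge> 1 \<longleftrightarrow>
      (covolume ?ip (?line (rot (SOME w. w \<in> ?cusp v))))\<^sup>2 \<ge> covolume ?ip ?L" if v: "v \<noteq> 0" for v
  proof -
    have "(SOME w. w \<in> ?cusp v) \<noteq> 0" using rep[OF v] v by auto
    thus ?thesis unfolding cusp_dist_def recip_dist_def Let_def by (rule dist)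
  qed
  show ?thesis
  proof
    assume ss: "semistable ?ip ?L"
    show "\<forall>\<eta>\<in>cusps. cusp_dist \<Phi> \<aa> \<eta> (act g\<^sub>R g\<^sub>C ImJ) \<ge> 1"
    proof
      fix \<eta> :: "('f ^ 2) set" assume "\<eta> \<in> cusps"
      then obtain v where v: "\<eta> = ?cusp v" "v \<noteq> 0" unfolding cusps by blast
      define w where "w = rot (SOME w. w \<in> ?cusp v)"
      have w0: "w \<noteq> 0" unfolding w_def rot0 using rep[OF v(2)] v(2) by auto
      have J: "fractional_ideal {c. c *s w \<in> ?L}" by (rule fractional_ideal_line[OF assms(3) w0])
      obtain c where c: "c *s w \<in> ?L" "c \<noteq> 0" using fractional_ideal_nonzero[OF J] by blast
      have sub: "OF_submodule (*s) (?line w)"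
        unfolding OF_submodule_def
      proof (intro conjI ballI)
        note cl = fractional_ideal_closed[OF J]
        show "0 \<in> ?line w" using cl(1) by (intro image_eqI[of _ _ 0]) auto
        fix x assume "x \<in> ?line w"
        then obtain d where d: "x = d *s w" "d \<in> {c. c *s w \<in> ?L}" by blast
        show "x + y \<in> ?line w" if "y \<in> ?line w" for y
        proof -
          from that obtain e where e: "y = e *s w" "e \<in> {c. c *s w \<in> ?L}" by blast
          show ?thesis using cl(2)[OF d(2) e(2)]
            by (rule rev_image_eqI) (simp add: d e vec.scale_left_distrib)
        qed
        show "k *s x \<in> ?line w" if "k \<in> \<O>" for k
          using cl(4)[OF that d(2)] by (rule rev_image_eqI) (simp add: d)
      qed
      have cw: "c *s w \<in> ?line w" "c *s w \<noteq> 0" using c w0 by auto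
      have "vec.span (?line w) = vec.span {w}"
      proof
        show "vec.span (?line w) \<subseteq> vec.span {w}"
          by (rule vec.span_minimal[OF _ vec.subspace_span]) (auto intro: vec.span_scale vec.span_base)
        have "inverse c *s (c *s w) \<in> vec.span (?line w)" by (rule vec.span_scale[OF vec.span_base[OF cw(1)]])
        hence "w \<in> vec.span (?line w)" using c(2) by simp
        thus "vec.span {w} \<subseteq> vec.span (?line w)" by (intro vec.span_minimal[OF _ vec.subspace_span]) auto
      qed
      hence "vec.dim (?line w) = 1"
        using vec.span_eq_dim[of "?line w" "{w}"] vec.dim_eq_card_independent[of "{w}"] w0
        by (simp add: vec.dependent_single)
      moreover have "?line w \<noteq> {0}" using cw by blast
      moreover have "?line w \<subseteq> ?L" by blast
      ultimately have "covolume ?ip (?line w) ^ 2 \<ge> covolume ?ip ?L"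
        using ss sub dimL unfolding semistable_def by fastforce
      thus "cusp_dist \<Phi> \<aa> \<eta> (act g\<^sub>R g\<^sub>C ImJ) \<ge> 1"
        unfolding v(1) cusp_dist[OF v(2)] w_def .
    qed
  next
    assume d: "\<forall>\<eta>\<in>cusps. cusp_dist \<Phi> \<aa> \<eta> (act g\<^sub>R g\<^sub>C ImJ) \<ge> 1"
    show "semistable ?ip ?L" unfolding semistable_def
    proof (intro allI impI)
      fix L assume L: "OF_submodule (*s) L \<and> L \<subseteq> ?L \<and> L \<noteq> {0}"
      obtain B where B: "B \<subseteq> L" "vec.independent B" "L \<subseteq> vec.span B" "card B = vec.dim L"
        using vec.basis_exists[of L] by blast
      have "vec.dim L \<le> 2" using vec.dim_subset[of L ?L] L dimL by simp
      moreover have "vec.dim L \<noteq> 0"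
      proof
        assume "vec.dim L = 0"
        hence "L \<subseteq> {0}" by (simp add: vec.dim_eq_0)
        with L show False unfolding OF_submodule_def by blast
      qed
      ultimately consider "vec.dim L = 1" | "vec.dim L = 2" by linarith
      thus "covolume ?ip L ^ vec.dim ?L \<ge> covolume ?ip ?L ^ vec.dim L"
      proof cases
        case 2
        have "covolume ?ip ?L \<le> covolume ?ip L"
          using rank_two_covolume[OF biadditive_lattice_inner[OF assms(1,2)] assms(3)] L 2 pL by simp
        thus ?thesis using pL by (simp add: dimL 2 power_mono)
      next
        case 1
        then obtain b where b: "B = {b}" using B(4) by (auto simp: card_1_singleton_iff)
        have b0: "b \<noteq> 0" using B(2) b by (simp add: vec.dependent_single)
        \<comment> \<open>The inverse quarter turn of \<open>b\<close>, so that the line belonging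
          to this cusp is the one containing \<open>L\<close>. The selected representative of the
          cusp only rescales the direction to \<open>w = c *s b\<close>.\<close>
        define v :: "'f ^ 2" where "v = (\<chi> i. if i = 1 then b $ 2 else - b $ 1)"
        have rv: "rot v = b" by (simp add: vec_eq_iff forall_2 rot v_def)
        have v0: "v \<noteq> 0" using b0 rv rot0 by metis
        obtain c where c: "c \<noteq> 0" "(SOME w. w \<in> ?cusp v) = c *s v" using rep[OF v0] by blast
        define w where "w = rot (SOME w. w \<in> ?cusp v)"
        have w: "w = c *s b" unfolding w_def c(2) by (simp add: vec_eq_iff forall_2 rot v_def)
        have "L \<subseteq> range (\<lambda>k. k *s w)"
        proof
          fix x assume "x \<in> L"
          then obtain k where "x = k *s b" using B(3) b by (auto simp: vec.span_singleton)
          hence "x = (k / c) *s w" using c(1) w by simp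
          thus "x \<in> range (\<lambda>k. k *s w)" by blast
        qed
        hence le: "covolume ?ip (?line w) \<le> covolume ?ip L"
          using rank_one_covolume[OF assms(2,3)] L by blast
        have w0: "w \<noteq> 0" using w c(1) b0 by simp
        have "cusp_dist \<Phi> \<aa> (?cusp v) (act g\<^sub>R g\<^sub>C ImJ) \<ge> 1" using d v0 unfolding cusps by blast
        hence "(covolume ?ip (?line w))\<^sup>2 \<ge> covolume ?ip ?L" unfolding cusp_dist[OF v0] w_def .
        also have "(covolume ?ip (?line w))\<^sup>2 \<le> (covolume ?ip L)\<^sup>2"
          by (rule power_mono[OF le covolume_line(2)[OF assms(2) fractional_ideal_line[OF assms(3) w0] w0]])
        finally show ?thesis by (simp add: dimL 1)
      qed
    qed
  qed
qed

end
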